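(* Let $D$ be a column-convex diagram all of whose boxes lie in rows $1,\dots,n$, and let $\mathrm{Par}_D=\{\lambda^{(1)},\ldots,\lambda^{(n)}\}$. Let \[\mathcal{P}_D=\mathrm{GT}(\lambda^{(1)})+\mathrm{GT}(\lambda^{(2)})+\cdots+\mathrm{GT}(\lambda^{(n)})\subset\mathbb{R}^{\binom{n+1}{2}}\] (Minkowski sum, each summand embedded in $\mathbb{R}^{\binom{n+1}{2}}$ as described in the context). Then the character $\mathfrak{s}_D(x_1,\dots,x_n)$ of the flagged Schur module of $D$ is obtained from the integer point transform $\sigma_{\mathcal{P}_D}(x_{ij})$ via the specialization \[x_{ij}\mapsto\begin{cases}x_1 & \text{when } i=1,\\ x_{i-1}^{-1}x_i & \text{when } i>1.\end{cases}\]
   Context: A diagram is a finite subset of $\mathbb{N}\times\mathbb{N}$, whose elements $(i,j)$ are boxes in row $i$ and column $j$ (matrix convention, row $1$ on top). $D$ is column-convex if for each $j$ the set $\{i : (i,j)\in D\}$ is an interval. Flagged Schur module: let $N=|D|$, let $\mathcal{T}_D$ be the $\mathbb{C}$-vector space with basis the fillings $T\colon D\to[n]$. Let $\Sigma_D$ be the symmetric group on the boxes of $D$, acting on $\mathcal{T}_D$ on the right by permuting filled boxes, and let $\mathrm{Row}(D)$ (resp. $\mathrm{Col}(D)$) be the subgroup permuting boxes within rows (resp. columns). Set $\alpha_D=\frac{1}{|\mathrm{Row}(D)|}\sum_{w\in\mathrm{Row}(D)}w$, $\beta_D=\frac{1}{|\mathrm{Col}(D)|}\sum_{w\in\mathrm{Col}(D)}\mathrm{sgn}(w)w$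 and $e_T=T\cdot\alpha_D\beta_D$. Fixing an order on the boxes identifies $\mathcal{T}_D$ with $(\mathbb{C}^n)^{\otimes N}$ (filling read as word $i_1\dots i_N\mapsto e_{i_1}\otimes\cdots\otimes e_{i_N}$), on which $GL_n(\mathbb{C})$ acts diagonally. A filling is row-flagged if $T(i,j)\le i$ for all boxes $(i,j)$. The flagged Schur module $\mathcal{S}_D$ is the $B_n$-submodule (upper triangular matrices $B_n$) spanned by $e_T$ for $T$ row-flagged, and its character is $\mathfrak{s}_D(x_1,\dots,x_n)=\mathrm{Trace}(X\colon\mathcal{S}_D\to\mathcal{S}_D)$ with $X=\mathrm{diag}(x_1,\dots,x_n)$. $\mathrm{Par}_D$: for $k\in[n]$, $\lambda^{(k)}=(\lambda^{(k)}_1\ge\cdots\ge\lambda^{(k)}_k\ge0)$ is the partition with $k$ (possibly zero) parts obtained by taking the columns of $D$ whose lowest box is in row $k$, ordering them by decreasing length, and reading them off as a partition in French notation; i.e. $\lambda^{(k)}_j$ is the number of columns of $D$ whose lowest box is in row $k$ and which contain a box in row $k-j+1$. Gelfand–Tsetlin polytope: for a partition $\lambda=(\lambda_1\ge\dots\ge\lambda_k\ge 0)$, $\mathrm{GT}(\lambda)\subset\mathbb{R}^{\binom{k+1}{2}}$ is the set of nonnegative triangular arrays $(y_{ij})_{1\le i\le j\le k}$ with $y_{1j}=\lambda_j$ for $1\le j\le k$ and $y_{i-1,j-1}\ge y_{ij}\ge y_{i-1,j}$ for all $2\le i\le j\le k$. Embedding: $\mathbb{R}^{\binom{k+1}{2}}$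 (coordinates $y_{ij}$) is embedded in $\mathbb{R}^{\binom{n+1}{2}}$ (coordinates $x_{ij}$, $1\le i\le j\le n$) by $y_{ij}\mapsto x_{i,j+n-k}$, all other coordinates being $0$. The integer point transform of a polytope $P\subset\mathbb{R}^{\binom{n+1}{2}}$ is $\sigma_P(x_{ij})=\sum_{(c_{ij})\in P\cap\mathbb{Z}^{\binom{n+1}{2}}}\prod_{1\le i\le j\le n}x_{ij}^{c_{ij}}$. *)

theory Defs
  imports
    Complex_Main
    "HOL-Library.FuncSet"
    "HOL-Library.Function_Algebras"
    "HOL-Library.Set_Algebras"
    "HOL-Combinatorics.Permutations"
begin

section \<open>Diagrams\<close>

text \<open>A box \<open>(i, j)\<close> lies in row \<open>i\<close> and column \<open>j\<close>; both are numbered from 1.\<close>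

type_synonym box = "nat \<times> nat"

definition diagram :: "box set \<Rightarrow> bool" where
  "diagram D \<longleftrightarrow> finite D \<and> D \<subseteq> {1..} \<times> {1..}"

definition column_convex :: "box set \<Rightarrow> bool" where
  "column_convex D \<longleftrightarrow> (\<forall>j. \<exists>a b. {i. (i, j) \<in> D} = {a..b})"

text \<open>Row 1 is on top, so the lowest box of a column is the one with the largest row index.
  Only meaningful for non-empty columns.\<close>

definition lowest_row :: "box set \<Rightarrow> nat \<Rightarrow> nat" where
  "lowest_row D c = Max {i. (i, c) \<in> D}"

text \<open>\<open>Par D k j\<close> is the part \<open>\<lambda>\<^sup>(\<^sup>k\<^sup>)\<^sub>j\<close>, for \<open>1 \<le> j \<le> k\<close>.\<close>

definition Par :: "box set \<Rightarrow> nat \<Rightarrow> nat \<Rightarrow> nat" where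
  "Par D k j = card {c. (k - j + 1, c) \<in> D \<and> lowest_row D c = k}"


section \<open>Complex vector spaces of functions\<close>

definition cscale :: "complex \<Rightarrow> ('a \<Rightarrow> complex) \<Rightarrow> 'a \<Rightarrow> complex" where
  "cscale c F = (\<lambda>T. c * F T)"

global_interpretation cfun: vector_space "cscale :: complex \<Rightarrow> ('a \<Rightarrow> complex) \<Rightarrow> 'a \<Rightarrow> complex"
  by unfold_locales (auto simp: cscale_def fun_eq_iff algebra_simps)

text \<open>The trace of a linear map \<open>f\<close> that maps the finite-dimensional subspace \<open>V\<close> into itself,
  computed as the sum of the diagonal coefficients with respect to an arbitrary basis of \<open>V\<close>.\<close>

definition trace_on :: "('a \<Rightarrow> complex) set \<Rightarrow> (('a \<Rightarrow> complex) \<Rightarrow> ('a \<Rightarrow> complex)) \<Rightarrow> complex" where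
  "trace_on V f =
     (let B = (SOME B. cfun.independent B \<and> cfun.span B = V)
      in \<Sum>b\<in>B. cfun.representation B (f b) b)"


section \<open>The flagged Schur module\<close>

type_synonym filling = "box \<Rightarrow> nat"

definition fillings :: "nat \<Rightarrow> box set \<Rightarrow> filling set" where
  "fillings n D = D \<rightarrow>\<^sub>E {1..n}"

text \<open>An element of \<open>\<T>\<^sub>D\<close> is represented by its coefficient function on fillings, which is zero
  outside \<^term>\<open>fillings n D\<close>; a filling \<open>T\<close> itself becomes the indicator function \<open>basis_vec T\<close>.\<close>

definition basis_vec :: "filling \<Rightarrow> filling \<Rightarrow> complex" where
  "basis_vec T = (\<lambda>S. if S = T then 1 else 0)"

definition Sym :: "box set \<Rightarrow> (box \<Rightarrow> box) set" where
  "Sym D = {w. w permutes D}"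

definition Row :: "box set \<Rightarrow> (box \<Rightarrow> box) set" where
  "Row D = {w \<in> Sym D. \<forall>b\<in>D. fst (w b) = fst b}"

definition Col :: "box set \<Rightarrow> (box \<Rightarrow> box) set" where
  "Col D = {w \<in> Sym D. \<forall>b\<in>D. snd (w b) = snd b}"

text \<open>The right action of \<open>\<Sigma>\<^sub>D\<close> is the linear extension of \<open>T \<cdot> w = T \<circ> w\<close>.  In terms of coefficient
  functions, the coefficient of \<open>S\<close> in \<open>F \<cdot> w\<close> is the one of \<open>S \<circ> w\<^sup>-\<^sup>1\<close> in \<open>F\<close>.\<close>

definition sym_act :: "(filling \<Rightarrow> complex) \<Rightarrow> (box \<Rightarrow> box) \<Rightarrow> filling \<Rightarrow> complex" where
  "sym_act F w = (\<lambda>S. F (S \<circ> inv w))"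

text \<open>Elements of the group algebra of \<open>\<Sigma>\<^sub>D\<close> are represented by their coefficient functions.\<close>

definition group_alg_act ::
    "box set \<Rightarrow> (filling \<Rightarrow> complex) \<Rightarrow> ((box \<Rightarrow> box) \<Rightarrow> complex) \<Rightarrow> filling \<Rightarrow> complex" where
  "group_alg_act D F a = (\<Sum>w\<in>Sym D. cscale (a w) (sym_act F w))"

definition alpha :: "box set \<Rightarrow> (box \<Rightarrow> box) \<Rightarrow> complex" where
  "alpha D w = (if w \<in> Row D then 1 / of_nat (card (Row D)) else 0)"

definition beta :: "box set \<Rightarrow> (box \<Rightarrow> box) \<Rightarrow> complex" where
  "beta D w = (if w \<in> Col D then of_int (sign w) / of_nat (card (Col D)) else 0)"

definition e_vec :: "box set \<Rightarrow> filling \<Rightarrow> filling \<Rightarrow> complex" where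
  "e_vec D T = group_alg_act D (group_alg_act D (basis_vec T) (alpha D)) (beta D)"

text \<open>Matrices are functions of row and column index, of which only the entries with indices in
  \<open>{1..n}\<close> matter.  The diagonal action of \<open>g\<close> on \<open>(\<complex>\<^sup>n)\<^sup>\<otimes>\<^sup>N\<close> sends
  \<open>\<Otimes>\<^sub>b e\<^bsub>T(b)\<^esub>\<close> to \<open>\<Otimes>\<^sub>b (\<Sum>\<^sub>i g i (T b) e\<^sub>i)\<close>, so \<open>S\<close> occurs in \<open>g \<cdot> T\<close> with coefficient
  \<open>\<Prod>\<^sub>b g (S b) (T b)\<close>.\<close>

definition gl_act ::
    "nat \<Rightarrow> box set \<Rightarrow> (nat \<Rightarrow> nat \<Rightarrow> complex) \<Rightarrow> (filling \<Rightarrow> complex) \<Rightarrow> filling \<Rightarrow> complex" where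
  "gl_act n D g F =
     (\<lambda>S. if S \<in> fillings n D then \<Sum>T\<in>fillings n D. (\<Prod>b\<in>D. g (S b) (T b)) * F T else 0)"

definition borel :: "nat \<Rightarrow> (nat \<Rightarrow> nat \<Rightarrow> complex) set" where
  "borel n = {g. (\<forall>i\<in>{1..n}. g i i \<noteq> 0) \<and> (\<forall>i\<in>{1..n}. \<forall>j\<in>{1..n}. j < i \<longrightarrow> g i j = 0)}"

definition diag :: "(nat \<Rightarrow> complex) \<Rightarrow> nat \<Rightarrow> nat \<Rightarrow> complex" where
  "diag x = (\<lambda>i j. if i = j then x i else 0)"

definition row_flagged :: "box set \<Rightarrow> filling \<Rightarrow> bool" where
  "row_flagged D T \<longleftrightarrow> (\<forall>(i, j)\<in>D. T (i, j) \<le> i)"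

text \<open>The linear span is already stable under upper triangular matrices; see
  \<open>flagged_schur_module_borel_stable\<close> below.\<close>

definition flagged_schur_module :: "nat \<Rightarrow> box set \<Rightarrow> (filling \<Rightarrow> complex) set" where
  "flagged_schur_module n D = cfun.span (e_vec D ` {T \<in> fillings n D. row_flagged D T})"

definition flagged_character :: "nat \<Rightarrow> box set \<Rightarrow> (nat \<Rightarrow> complex) \<Rightarrow> complex" where
  "flagged_character n D x = trace_on (flagged_schur_module n D) (gl_act n D (diag x))"


section \<open>Gelfand--Tsetlin polytopes\<close>

text \<open>\<open>\<real>\<^bsup>binom(n+1,2)\<^esup>\<close> is rendered as the space of functions on \<^typ>\<open>nat \<times> nat\<close> that vanish
  outside \<open>tri n\<close>.\<close>

definition tri :: "nat \<Rightarrow> (nat \<times> nat) set" where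
  "tri n = {(i, j). 1 \<le> i \<and> i \<le> j \<and> j \<le> n}"

definition GT :: "nat \<Rightarrow> (nat \<Rightarrow> nat) \<Rightarrow> (nat \<times> nat \<Rightarrow> real) set" where
  "GT k l = {y. (\<forall>p. p \<notin> tri k \<longrightarrow> y p = 0) \<and> (\<forall>p\<in>tri k. 0 \<le> y p) \<and>
      (\<forall>j. 1 \<le> j \<and> j \<le> k \<longrightarrow> y (1, j) = real (l j)) \<and>
      (\<forall>i j. 2 \<le> i \<and> i \<le> j \<and> j \<le> k \<longrightarrow>
         y (i - 1, j - 1) \<ge> y (i, j) \<and> y (i, j) \<ge> y (i - 1, j))}"

text \<open>The coordinate \<open>y (i, j)\<close> becomes the coordinate \<open>(i, j + n - k)\<close>, for \<open>k \<le> n\<close>.\<close>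

definition embed :: "nat \<Rightarrow> nat \<Rightarrow> (nat \<times> nat \<Rightarrow> real) \<Rightarrow> nat \<times> nat \<Rightarrow> real" where
  "embed n k y = (\<lambda>(i, j). if (i, j - (n - k)) \<in> tri k then y (i, j - (n - k)) else 0)"

text \<open>Addition of sets is the Minkowski sum of \<^theory>\<open>HOL-Library.Set_Algebras\<close>.\<close>

definition GT_sum :: "nat \<Rightarrow> box set \<Rightarrow> (nat \<times> nat \<Rightarrow> real) set" where
  "GT_sum n D = (\<Sum>k\<in>{1..n}. embed n k ` GT k (Par D k))"

definition integer_point_transform ::
    "nat \<Rightarrow> (nat \<times> nat \<Rightarrow> real) set \<Rightarrow> (nat \<times> nat \<Rightarrow> complex) \<Rightarrow> complex" where
  "integer_point_transform n P z =
     (\<Sum>c | (\<lambda>p. real_of_int (c p)) \<in> P. \<Prod>p\<in>tri n. z p powi c p)"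


section \<open>Stability of the flagged Schur module\<close>

lemma finite_fillings: "finite D \<Longrightarrow> finite (fillings n D)"
  by (simp add: fillings_def finite_PiE)

lemma sum_fun_apply: "(\<Sum>a\<in>A. f a) x = (\<Sum>a\<in>A. f a (x :: 'b) :: 'c :: comm_monoid_add)"
  by (induction A rule: infinite_finite_induct) auto

lemma fillings_comp_perm:
  assumes "w permutes D" "T \<in> fillings n D"
  shows "T \<circ> w \<in> fillings n D"
proof (unfold fillings_def, rule PiE_I)
  fix b assume "b \<in> D"
  then have "w b \<in> D" using permutes_in_image[OF assms(1)] by blast
  then show "(T \<circ> w) b \<in> {1..n}" using assms(2) by (auto simp: fillings_def)
next
  fix b assume "b \<notin> D"
  then have "w b = b" using assms(1) by (simp add: permutes_not_in)
  then show "(T \<circ> w) b = undefined" using assms(2) \<open>b \<notin> D\<close> by (auto simp: fillings_def)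
qed

lemma gl_act_sym_act:
  assumes "w permutes D"
  shows "gl_act n D g (sym_act F w) = sym_act (gl_act n D g F) w"
proof
  fix S
  have iw: "inv w permutes D" using assms by (rule permutes_inv)
  have ww: "inv w \<circ> w = id" "w \<circ> inv w = id" using permutes_inv_o[OF assms] by auto
  have mem: "S \<circ> inv w \<in> fillings n D \<longleftrightarrow> S \<in> fillings n D"
  proof
    assume "S \<circ> inv w \<in> fillings n D"
    from fillings_comp_perm[OF assms this] show "S \<in> fillings n D"
      by (simp add: comp_assoc ww)
  qed (rule fillings_comp_perm[OF iw])
  have "(\<Sum>T\<in>fillings n D. (\<Prod>b\<in>D. g (S b) (T b)) * F (T \<circ> inv w)) =
        (\<Sum>T\<in>fillings n D. (\<Prod>b\<in>D. g ((S \<circ> inv w) b) (T b)) * F T)"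
  proof (rule sum.reindex_bij_witness[where i = "\<lambda>T. T \<circ> w" and j = "\<lambda>T. T \<circ> inv w"])
    fix T assume T: "T \<in> fillings n D"
    show "(T \<circ> inv w) \<circ> w = T" "(T \<circ> w) \<circ> inv w = T" by (simp_all add: comp_assoc ww)
    show "T \<circ> inv w \<in> fillings n D" "T \<circ> w \<in> fillings n D"
      using T fillings_comp_perm iw assms by auto
    have "(\<Prod>b\<in>D. g (S (inv w b)) (T (inv w b))) = (\<Prod>b\<in>D. g (S b) (T b))"
      using prod.permute[OF iw, of "\<lambda>b. g (S b) (T b)"] by (simp add: comp_def)
    then show "(\<Prod>b\<in>D. g ((S \<circ> inv w) b) ((T \<circ> inv w) b)) * F (T \<circ> inv w) =
      (\<Prod>b\<in>D. g (S b) (T b)) * F (T \<circ> inv w)" by simp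
  qed
  then show "gl_act n D g (sym_act F w) S = sym_act (gl_act n D g F) w S"
    by (simp add: gl_act_def sym_act_def mem)
qed

lemma gl_act_sum: "gl_act n D g (\<Sum>a\<in>A. cscale (c a) (f a)) = (\<Sum>a\<in>A. cscale (c a) (gl_act n D g (f a)))"
proof
  fix S
  show "gl_act n D g (\<Sum>a\<in>A. cscale (c a) (f a)) S = (\<Sum>a\<in>A. cscale (c a) (gl_act n D g (f a))) S"
    unfolding sum_fun_apply gl_act_def cscale_def
    by (simp add: sum_distrib_left mult_ac, subst sum.swap, simp)
qed

lemma gl_act_group_alg_act:
  "gl_act n D g (group_alg_act D F a) = group_alg_act D (gl_act n D g F) a"
  unfolding group_alg_act_def gl_act_sum
  by (intro sum.cong refl) (simp add: gl_act_sym_act Sym_def)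

lemma group_alg_act_sum:
  "group_alg_act D (\<Sum>a\<in>A. cscale (c a) (f a)) u = (\<Sum>a\<in>A. cscale (c a) (group_alg_act D (f a) u))"
  unfolding group_alg_act_def fun_eq_iff sum_fun_apply cscale_def sym_act_def
  by (simp add: sum_distrib_left mult_ac, subst sum.swap, simp)

lemma gl_act_basis_vec:
  assumes "finite D" "T \<in> fillings n D"
  shows "gl_act n D g (basis_vec T) =
    (\<Sum>S\<in>fillings n D. cscale (\<Prod>b\<in>D. g (S b) (T b)) (basis_vec S))"
proof
  fix S
  have "(\<Sum>U\<in>fillings n D. (\<Prod>b\<in>D. g (U b) (T b)) * (if S = U then 1 else 0)) =
    (if S \<in> fillings n D then \<Prod>b\<in>D. g (S b) (T b) else 0)"
    using finite_fillings[OF assms(1)] by (simp only: if_distrib[where f="(*) _"] mult_zero_right sum.delta' sum.delta mult_1_right)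
  moreover have "(\<Sum>U\<in>fillings n D. (\<Prod>b\<in>D. g (S b) (U b)) * (if U = T then 1 else 0)) =
    (\<Prod>b\<in>D. g (S b) (T b))"
    using finite_fillings[OF assms(1)] assms(2)
    by (simp only: if_distrib[where f="(*) _"] mult_zero_right sum.delta' sum.delta mult_1_right if_True)
  ultimately show "gl_act n D g (basis_vec T) S =
    (\<Sum>S\<in>fillings n D. cscale (\<Prod>b\<in>D. g (S b) (T b)) (basis_vec S)) S"
    unfolding sum_fun_apply gl_act_def cscale_def basis_vec_def by presburger
qed

lemma flagged_schur_module_borel_stable:
  assumes "finite D" "g \<in> borel n" "F \<in> flagged_schur_module n D"
  shows "gl_act n D g F \<in> flagged_schur_module n D"
proof -
  let ?E = "e_vec D ` {T \<in> fillings n D. row_flagged D T}"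
  have e: "gl_act n D g (e_vec D T) \<in> cfun.span ?E"
    if T: "T \<in> fillings n D" "row_flagged D T" for T
  proof -
    have "gl_act n D g (e_vec D T) =
        (\<Sum>S\<in>fillings n D. cscale (\<Prod>b\<in>D. g (S b) (T b)) (e_vec D S))"
      by (simp add: e_vec_def gl_act_group_alg_act gl_act_basis_vec[OF assms(1) T(1)]
          group_alg_act_sum)
    also have "\<dots> \<in> cfun.span ?E"
    proof (rule cfun.span_sum)
      fix S assume S: "S \<in> fillings n D"
      show "cscale (\<Prod>b\<in>D. g (S b) (T b)) (e_vec D S) \<in> cfun.span ?E"
      proof (cases "row_flagged D S")
        case True
        then show ?thesis using S by (intro cfun.span_scale cfun.span_base) auto
      next
        case False
        then obtain i j where b: "(i, j) \<in> D" "\<not> S (i, j) \<le> i"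
          by (auto simp: row_flagged_def)
        then have "T (i, j) < S (i, j)" using T(2) by (fastforce simp: row_flagged_def)
        moreover have "S (i, j) \<in> {1..n}" "T (i, j) \<in> {1..n}"
          using b S T(1) unfolding fillings_def by (meson PiE_mem)+
        ultimately have "g (S (i, j)) (T (i, j)) = 0"
          using assms(2) unfolding borel_def by blast
        then have "(\<Prod>b\<in>D. g (S b) (T b)) = 0"
          using b(1) assms(1) by (intro prod_zero) auto
        then show ?thesis by (simp only: cfun.scale_zero_left cfun.span_zero)
      qed
    qed
    finally show ?thesis .
  qed
  obtain t r where tr: "finite t" "t \<subseteq> ?E" "F = (\<Sum>a\<in>t. cscale (r a) a)"
    using assms(3) unfolding flagged_schur_module_def cfun.span_explicit by auto
  have "gl_act n D g F = (\<Sum>a\<in>t. cscale (r a) (gl_act n D g a))"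
    unfolding tr(3) gl_act_sum ..
  also have "\<dots> \<in> cfun.span ?E"
    using tr(2) e by (intro cfun.span_sum cfun.span_scale) auto
  finally show ?thesis unfolding flagged_schur_module_def .
qed

end

theory Submission
  imports Defs "HOL-Computational_Algebra.Polynomial"
begin

text \<open>
  Up to scalars, the matrix of coefficients of the vectors \<open>e\<^sub>T\<close> has as its columns the products of the minors
  of a generic lower triangular matrix \<open>Y\<close> on the rows occupied by the columns of the diagram. Order
  the monomials so that \<open>y\<^sub>n\<^sub>1, \<dots>, y\<^sub>1\<^sub>1, y\<^sub>n\<^sub>2, \<dots>\<close> are compared one after the other, smaller exponents
  leading. A linear combination of such products vanishes to order at least
  \<open>c(r, s) = #{columns meeting the rows r and s}\<close> wherever row \<open>r\<close> of \<open>Y\<close> lies in the span of the rows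
  \<open>s, \<dots>, r - 1\<close>. Dividing by the largest power of one variable and then setting this variable to zero
  preserves such conditions, except that \<open>c(r, s)\<close> becomes \<open>max (c(r, s) - h\<^sub>s) (c(r, s - 1))\<close> once the power
  \<open>h\<^sub>s\<close> of the variable in row \<open>s\<close> has been removed. Hence every leading exponent satisfies an explicit system
  of inequalities. Conversely, every array of exponents satisfying it is the content of a column-strict
  row-flagged filling, obtained by cutting top boxes off the columns, those of the longest columns first;
  by the rearrangement inequality the corresponding \<open>e\<^sub>T\<close> are linearly independent. So they form a
  basis, consisting of eigenvectors of the torus. Finally, the inequalities cut out
  exactly the integer points of the Minkowski sum, whose coordinate \<open>x\<^sub>i\<^sub>j\<close> counts the boxes of row
  \<open>n - j + i\<close> with entry at least \<open>i\<close>.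
\<close>

text \<open>Why bounds on leading exponents give a spanning set: \<open>e_vec D T\<close> depends
  only on the row content of \<open>T\<close>, and a linear functional turns these vectors into the
  coefficients of a combination of products of minors. If it kills one \<open>e_vec\<close> for each
  admissible content, the combination has no monomial with an admissible exponent. A nonzero
  combination would have an admissible leading one, so the functional kills the whole module. The
  obstacle is that points of a rank locus on the hyperplane of the removed variable need not be
  limits of points of the locus off it. This happens only for the variable in row \<open>s\<close>
  itself, and each entry of the maximum is one way out: accept the loss \<open>h_s\<close>, or read
  the relation as one over the rows from \<open>s - 1\<close> on, for which the hyperplane is
  harmless. Cutting top boxes obeys the same recursion, so necessary and sufficient conditions
  coincide. Column convexity lets a relation between the rows \<open>s, ..., r\<close> act inside
  every minor that meets rows \<open>r\<close> and \<open>s\<close>. Integer decomposition of the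
  Minkowski sum is not presupposed: real summands already force the inequalities, and a filling then
  supplies integral ones.\<close>

section \<open>Order of vanishing along lines\<close>

text \<open>The polynomial \<open>\<Sum>\<^sub>e A e Y\<^sup>e\<close> in the variables \<open>V\<close>, restricted to the line \<open>Y + t Q\<close>.\<close>

definition line_poly ::
    "(('i \<Rightarrow> nat) \<Rightarrow> complex) \<Rightarrow> ('i \<Rightarrow> nat) set \<Rightarrow> 'i set \<Rightarrow> ('i \<Rightarrow> complex) \<Rightarrow> ('i \<Rightarrow> complex) \<Rightarrow> complex poly" where
  "line_poly A E V Y Q = (\<Sum>e\<in>E. smult (A e) (\<Prod>i\<in>V. [:Y i, Q i:] ^ e i))"

text \<open>Order of vanishing at least \<open>c\<close> at the point \<open>Y\<close>.\<close>

definition vanishes ::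
    "(('i \<Rightarrow> nat) \<Rightarrow> complex) \<Rightarrow> ('i \<Rightarrow> nat) set \<Rightarrow> 'i set \<Rightarrow> nat \<Rightarrow> ('i \<Rightarrow> complex) \<Rightarrow> bool" where
  "vanishes A E V c Y \<longleftrightarrow> (\<forall>Q. monom 1 c dvd line_poly A E V Y Q)"

lemma line_poly_cong:
  assumes "\<And>i. i \<in> V \<Longrightarrow> Y i = Y' i" "\<And>i. i \<in> V \<Longrightarrow> Q i = Q' i"
  shows "line_poly A E V Y Q = line_poly A E V Y' Q'"
  unfolding line_poly_def
  by (intro sum.cong arg_cong2[where f = smult] prod.cong refl) (use assms in auto)

section \<open>Polynomials whose coefficients depend continuously on a parameter\<close>

definition coeffs_cont :: "(complex \<Rightarrow> complex poly) \<Rightarrow> bool" where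
  "coeffs_cont P \<longleftrightarrow> (\<forall>j. isCont (\<lambda>t. coeff (P t) j) 0)"

lemma coeffs_cont_add: "coeffs_cont P \<Longrightarrow> coeffs_cont R \<Longrightarrow> coeffs_cont (\<lambda>t. P t + R t)"
  by (simp add: coeffs_cont_def)

lemma coeffs_cont_const: "coeffs_cont (\<lambda>t. p)"
  by (simp add: coeffs_cont_def)

lemma coeffs_cont_mult: "coeffs_cont P \<Longrightarrow> coeffs_cont R \<Longrightarrow> coeffs_cont (\<lambda>t. P t * R t)"
  by (simp add: coeffs_cont_def coeff_mult)

lemma coeffs_cont_power: "coeffs_cont P \<Longrightarrow> coeffs_cont (\<lambda>t. P t ^ k)"
  by (induction k) (simp_all add: coeffs_cont_const coeffs_cont_mult)

lemma coeffs_cont_prod: "(\<And>i. i \<in> I \<Longrightarrow> coeffs_cont (P i)) \<Longrightarrow> coeffs_cont (\<lambda>t. \<Prod>i\<in>I. P i t)"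
  by (induction I rule: infinite_finite_induct) (simp_all add: coeffs_cont_const coeffs_cont_mult)

lemma coeffs_cont_sum: "(\<And>i. i \<in> I \<Longrightarrow> coeffs_cont (P i)) \<Longrightarrow> coeffs_cont (\<lambda>t. \<Sum>i\<in>I. P i t)"
  by (induction I rule: infinite_finite_induct) (simp_all add: coeffs_cont_const coeffs_cont_add)

lemma coeffs_cont_smult: "coeffs_cont P \<Longrightarrow> coeffs_cont (\<lambda>t. smult a (P t))"
  by (simp add: coeffs_cont_def)

lemma coeffs_cont_linear:
  assumes "isCont a 0" "isCont b 0"
  shows "coeffs_cont (\<lambda>t. [:a t, b t:])"
  unfolding coeffs_cont_def
proof
  fix j show "isCont (\<lambda>t. coeff [:a t, b t:] j) 0"
    using assms by (cases j; cases "j - 1") (auto simp: coeff_pCons split: nat.splits)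
qed

lemmas coeffs_cont_intros = coeffs_cont_const coeffs_cont_mult coeffs_cont_power coeffs_cont_prod
  coeffs_cont_sum coeffs_cont_smult coeffs_cont_linear

text \<open>Semicontinuity of the order of vanishing: coefficients that are zero near the parameter
  0 are zero at 0 by continuity.\<close>

lemma monom_dvd_limit:
  assumes "coeffs_cont P" "eventually (\<lambda>t. monom 1 c dvd P t) (at 0)"
  shows "monom 1 c dvd P 0"
  unfolding monom_1_dvd_iff'
proof (intro allI impI)
  fix j assume "j < c"
  then have "eventually (\<lambda>t. coeff (P t) j = 0) (at 0)"
    using assms(2) by (elim eventually_mono) (auto simp: monom_1_dvd_iff')
  then have "((\<lambda>t. coeff (P t) j) \<longlongrightarrow> 0) (at 0)"
    by (rule tendsto_eventually)
  moreover have "((\<lambda>t. coeff (P t) j) \<longlongrightarrow> coeff (P 0) j) (at 0)"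
    using assms(1) by (simp add: coeffs_cont_def isCont_def)
  ultimately show "coeff (P 0) j = 0" using LIM_unique by blast
qed

lemma monom_dvd_cancel:
  fixes p :: "complex poly"
  assumes "a \<noteq> 0" "monom 1 c dvd [:a, b:] ^ h * p"
  shows "monom 1 c dvd p"
proof (cases "p = 0")
  case False
  have m: "monom 1 c = ([:- 0, 1:] :: complex poly) ^ c" by (simp add: monom_altdef)
  have ne: "[:a, b:] ^ h \<noteq> 0" using assms(1) by simp
  have o: "order 0 ([:a, b:] ^ h) = 0" using assms(1) by (intro order_0I) simp
  show ?thesis
    using assms(2) False ne o unfolding m order_divides
    by (auto simp: order_mult[of "[:a, b:] ^ h" p])
qed simp

lemma monom_dvd_cancel_monom:
  fixes p :: "complex poly"
  assumes "b \<noteq> 0" "monom 1 c dvd [:0, b:] ^ h * p"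
  shows "monom 1 (c - h) dvd p"
  unfolding monom_1_dvd_iff'
proof (intro allI impI)
  fix j assume "j < c - h"
  then have "coeff ([:0, b:] ^ h * p) (j + h) = 0"
    using assms(2) by (auto simp: monom_1_dvd_iff')
  moreover have "[:0, b:] = monom b 1" by (simp add: monom_altdef)
  ultimately show "coeff p j = 0"
    using assms(1) by (simp add: monom_power coeff_monom_mult)
qed

section \<open>Dividing by a power of one variable and setting it to zero\<close>

context
  fixes A :: "('i \<Rightarrow> nat) \<Rightarrow> complex" and E :: "('i \<Rightarrow> nat) set" and V :: "'i set" and v :: 'i and h :: nat
  assumes V: "finite V" "v \<in> V" and h: "\<And>e. e \<in> E \<Longrightarrow> h \<le> e v" and E: "finite E"
begin

text \<open>The restriction to a line of the polynomial divided by the \<open>h\<close>-th power of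
  \<open>v\<close>. The truncated difference \<open>e v - h\<close> is exact because
  \<open>h\<close> bounds these exponents from below.\<close>

definition lead_quot :: "('i \<Rightarrow> complex) \<Rightarrow> ('i \<Rightarrow> complex) \<Rightarrow> complex poly" where
  "lead_quot Y Q = (\<Sum>e\<in>E. smult (A e) ([:Y v, Q v:] ^ (e v - h) * (\<Prod>i\<in>V - {v}. [:Y i, Q i:] ^ e i)))"

lemma line_poly_quot: "line_poly A E V Y Q = [:Y v, Q v:] ^ h * lead_quot Y Q"
  unfolding line_poly_def lead_quot_def sum_distrib_left
proof (rule sum.cong[OF refl])
  fix e assume "e \<in> E"
  then have "[:Y v, Q v:] ^ e v = [:Y v, Q v:] ^ h * [:Y v, Q v:] ^ (e v - h)"
    using h by (simp flip: power_add)
  then show "smult (A e) (\<Prod>i\<in>V. [:Y i, Q i:] ^ e i) =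
    [:Y v, Q v:] ^ h * smult (A e) ([:Y v, Q v:] ^ (e v - h) * (\<Prod>i\<in>V - {v}. [:Y i, Q i:] ^ e i))"
    by (simp add: prod.remove[OF V] mult_ac)
qed

lemma lead_quot_zero:
  assumes "Y v = 0" "Q v = 0"
  shows "lead_quot Y Q = line_poly A {e \<in> E. e v = h} (V - {v}) Y Q"
proof -
  have "lead_quot Y Q = (\<Sum>e\<in>E. if e v = h then smult (A e) (\<Prod>i\<in>V - {v}. [:Y i, Q i:] ^ e i) else 0)"
    unfolding lead_quot_def using assms h by (intro sum.cong) (force simp: power_0_left)+
  then show ?thesis by (simp add: line_poly_def sum.inter_filter E)
qed

lemma coeffs_cont_quot:
  assumes "\<And>i. isCont (\<lambda>t. Y t i) 0" "\<And>i. isCont (\<lambda>t. Q t i) 0"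
  shows "coeffs_cont (\<lambda>t. lead_quot (Y t) (Q t))"
  unfolding lead_quot_def by (intro coeffs_cont_intros assms)

text \<open>At points with nonzero coordinate \<open>v\<close> the divided power does not vanish, so
  the quotient keeps the order \<open>c\<close> there. The order then passes to the limit point on
  the hyperplane.\<close>

lemma vanishes_lead_curve:
  fixes Y :: "complex \<Rightarrow> 'i \<Rightarrow> complex"
  assumes Y: "\<And>i. isCont (\<lambda>t. Y t i) 0" "Y 0 v = 0"
    and ev: "eventually (\<lambda>t. Y t v \<noteq> 0 \<and> vanishes A E V c (Y t)) (at 0)"
  shows "vanishes A {e \<in> E. e v = h} (V - {v}) c (Y 0)"
  unfolding vanishes_def
proof
  fix Q :: "'i \<Rightarrow> complex"
  \<comment> \<open>The result does not involve \<open>v\<close>, so the direction may be taken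
    tangent to the hyperplane, where \<open>lead_quot_zero\<close> applies.\<close>
  define R where "R = Q(v := 0)"
  have "monom 1 c dvd lead_quot (Y 0) R"
  proof (rule monom_dvd_limit)
    show "coeffs_cont (\<lambda>t. lead_quot (Y t) R)" by (intro coeffs_cont_quot Y) simp
    show "eventually (\<lambda>t. monom 1 c dvd lead_quot (Y t) R) (at 0)"
      using ev
    proof eventually_elim
      case (elim t)
      then have "monom 1 c dvd [:Y t v, R v:] ^ h * lead_quot (Y t) R"
        by (simp add: vanishes_def flip: line_poly_quot)
      then show ?case using elim monom_dvd_cancel by blast
    qed
  qed
  also have "lead_quot (Y 0) R = line_poly A {e \<in> E. e v = h} (V - {v}) (Y 0) R"
    using Y(2) by (intro lead_quot_zero) (auto simp: R_def)
  also have "\<dots> = line_poly A {e \<in> E. e v = h} (V - {v}) (Y 0) Q"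
    by (intro line_poly_cong) (auto simp: R_def)
  finally show "monom 1 c dvd line_poly A {e \<in> E. e v = h} (V - {v}) (Y 0) Q" .
qed

text \<open>Along a line through \<open>Y\<close> transverse to the hyperplane, the divided power
  vanishes to order exactly \<open>h\<close>, so the division costs \<open>h\<close>. Tangent
  directions are limits of transverse ones.\<close>

lemma vanishes_lead_diff:
  assumes "Y v = 0" "vanishes A E V c Y"
  shows "vanishes A {e \<in> E. e v = h} (V - {v}) (c - h) Y"
  unfolding vanishes_def
proof
  fix Q :: "'i \<Rightarrow> complex"
  define R where "R t = Q(v := t)" for t :: complex
  have "monom 1 (c - h) dvd lead_quot Y (R 0)"
  proof (rule monom_dvd_limit)
    have "isCont (\<lambda>t. R t i) 0" for i by (cases "i = v") (auto simp: R_def)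
    then show "coeffs_cont (\<lambda>t. lead_quot Y (R t))" by (intro coeffs_cont_quot) simp
    have "monom 1 (c - h) dvd lead_quot Y (R t)" if "t \<noteq> 0" for t
    proof -
      have "monom 1 c dvd [:0, t:] ^ h * lead_quot Y (R t)"
        using assms(2) line_poly_quot[of Y "R t"] assms(1) unfolding vanishes_def
        by (metis R_def fun_upd_same)
      then show ?thesis using that monom_dvd_cancel_monom by blast
    qed
    then show "eventually (\<lambda>t. monom 1 (c - h) dvd lead_quot Y (R t)) (at 0)"
      by (simp add: eventually_at_filter)
  qed
  also have "lead_quot Y (R 0) = line_poly A {e \<in> E. e v = h} (V - {v}) Y (R 0)"
    using assms by (intro lead_quot_zero) (auto simp: R_def)
  also have "\<dots> = line_poly A {e \<in> E. e v = h} (V - {v}) Y Q"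
    by (intro line_poly_cong) (auto simp: R_def)
  finally show "monom 1 (c - h) dvd line_poly A {e \<in> E. e v = h} (V - {v}) Y Q" .
qed

end

section \<open>Nonvanishing of polynomials and lexicographically least exponents\<close>

lemma monomial_sum_nonzero:
  assumes "finite V" "finite E" "E \<noteq> {}" "\<And>e. e \<in> E \<Longrightarrow> A e \<noteq> 0"
    "\<And>e e'. e \<in> E \<Longrightarrow> e' \<in> E \<Longrightarrow> \<forall>i\<in>V. e i = e' i \<Longrightarrow> e = e'"
  shows "\<exists>Y :: 'i \<Rightarrow> complex. (\<Sum>e\<in>E. A e * (\<Prod>i\<in>V. Y i ^ e i)) \<noteq> 0"
  using assms
proof (induction V arbitrary: E rule: finite_induct)
  case empty
  then obtain e where "E = {e}" by (metis all_not_in_conv ball_empty is_singletonI' is_singleton_def)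
  then show ?case using empty by simp
next
  case (insert v V)
  obtain e0 where e0: "e0 \<in> E" using insert.prems by blast
  define h where "h = e0 v"
  let ?E = "{e \<in> E. e v = h}"
  have "\<exists>Y :: 'i \<Rightarrow> complex. (\<Sum>e\<in>?E. A e * (\<Prod>i\<in>V. Y i ^ e i)) \<noteq> 0"
  proof (rule insert.IH)
    show "finite ?E" "?E \<noteq> {}" using insert.prems e0 by (auto simp: h_def)
    show "\<And>e. e \<in> ?E \<Longrightarrow> A e \<noteq> 0" using insert.prems by auto
    show "\<And>e e'. e \<in> ?E \<Longrightarrow> e' \<in> ?E \<Longrightarrow> \<forall>i\<in>V. e i = e' i \<Longrightarrow> e = e'"
      using insert.prems(4) by auto
  qed
  then obtain Y :: "'i \<Rightarrow> complex" where Y: "(\<Sum>e\<in>?E. A e * (\<Prod>i\<in>V. Y i ^ e i)) \<noteq> 0" by blast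
  define p where "p = (\<Sum>e\<in>E. monom (A e * (\<Prod>i\<in>V. Y i ^ e i)) (e v))"
  have "coeff p h = (\<Sum>e\<in>?E. A e * (\<Prod>i\<in>V. Y i ^ e i))"
    unfolding p_def coeff_sum using insert.prems(1) by (simp add: sum.inter_filter)
  then have "p \<noteq> 0" using Y by auto
  then obtain t where t: "poly p t \<noteq> 0" using poly_all_0_iff_0 by blast
  have "(\<Sum>e\<in>E. A e * (\<Prod>i\<in>insert v V. (Y(v := t)) i ^ e i)) = poly p t"
    unfolding p_def poly_sum
  proof (rule sum.cong[OF refl])
    fix e
    have "(\<Prod>i\<in>V. (Y(v := t)) i ^ e i) = (\<Prod>i\<in>V. Y i ^ e i)"
      using insert.hyps by (intro prod.cong) auto
    then show "A e * (\<Prod>i\<in>insert v V. (Y(v := t)) i ^ e i) = poly (monom (A e * (\<Prod>i\<in>V. Y i ^ e i)) (e v)) t"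
      using insert.hyps by (simp add: poly_monom)
  qed
  then show ?case using t by metis
qed

text \<open>The variables are treated in the order of \<open>key\<close>, each exponent being
  minimised among the candidates that agree so far. The second property is the lower bound that
  makes each later division by \<open>v ^ e0 v\<close> exact.\<close>

lemma lex_least_exponent:
  fixes key :: "'i \<Rightarrow> nat"
  assumes "finite V" "inj_on key V" "E \<noteq> {}"
  obtains e0 where "e0 \<in> E"
    "\<And>v e. v \<in> V \<Longrightarrow> e \<in> E \<Longrightarrow> (\<And>w. w \<in> V \<Longrightarrow> key w < key v \<Longrightarrow> e w = e0 w) \<Longrightarrow> e0 v \<le> (e v :: nat)"
proof -
  have "\<exists>e0\<in>E. \<forall>v\<in>V. key v < m \<longrightarrow> (\<forall>e\<in>E. (\<forall>w\<in>V. key w < key v \<longrightarrow> e w = e0 w) \<longrightarrow> e0 v \<le> e v)" for m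
  proof (induction m)
    case 0
    then show ?case using assms(3) by blast
  next
    case (Suc m)
    then obtain e0 where e0: "e0 \<in> E"
      "\<And>v e. v \<in> V \<Longrightarrow> key v < m \<Longrightarrow> e \<in> E \<Longrightarrow> (\<forall>w\<in>V. key w < key v \<longrightarrow> e w = e0 w) \<Longrightarrow> e0 v \<le> e v"
      by blast
    show ?case
    proof (cases "\<exists>v\<in>V. key v = m")
      case False
      then have "key v < m" if "v \<in> V" "key v < Suc m" for v using that by (metis less_SucE)
      then show ?thesis using e0 by blast
    next
      case True
      then obtain v where v: "v \<in> V" "key v = m" by blast
      define E' where "E' = {e \<in> E. \<forall>w\<in>V. key w < m \<longrightarrow> e w = e0 w}"
      have "e0 \<in> E'" using e0 by (auto simp: E'_def)
      then obtain e1 where e1: "e1 \<in> E'" "\<And>e. e \<in> E' \<Longrightarrow> e1 v \<le> e v"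
        using exists_least_iff[of "\<lambda>k. \<exists>e\<in>E'. e v = k"] by (metis linorder_not_le)
      have eq: "e1 w = e0 w" if "w \<in> V" "key w < m" for w using e1(1) that by (auto simp: E'_def)
      have "e1 u \<le> e u" if u: "u \<in> V" "key u < Suc m" "e \<in> E" "\<forall>w\<in>V. key w < key u \<longrightarrow> e w = e1 w" for u e
      proof (cases "key u < m")
        case True
        then show ?thesis using e0(2)[OF u(1) True u(3)] u(4) eq u(1) by auto
      next
        case False
        then have "key u = key v" using u(2) v(2) by simp
        then have "u = v" using assms(2) u(1) v(1) by (meson inj_onD)
        moreover have "e \<in> E'" using u eq v by (auto simp: E'_def calculation)
        ultimately show ?thesis using e1(2) by blast
      qed
      moreover have "e1 \<in> E" using e1 by (simp add: E'_def)
      ultimately show ?thesis by blast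
    qed
  qed
  moreover have "key v < Suc (Max (key ` V))" if "v \<in> V" for v
    using that assms(1) by (simp add: le_imp_less_Suc)
  ultimately show ?thesis using that by metis
qed

section \<open>Leading exponents\<close>

definition row_dep :: "(nat \<times> nat \<Rightarrow> 'a :: comm_semiring_0) \<Rightarrow> nat \<Rightarrow> nat \<Rightarrow> bool" where
  "row_dep Y r s \<longleftrightarrow> (\<exists>u. \<forall>b. Y (r, b) = (\<Sum>k=s..<r. u k * Y (k, b)))"

text \<open>The variables of a lower triangular matrix that remain when the columns before \<open>p\<close>, and in column \<open>p\<close>
  the rows below \<open>i\<close>, have been processed.\<close>

definition stage_vars :: "nat \<Rightarrow> nat \<Rightarrow> nat \<Rightarrow> (nat \<times> nat) set" where
  "stage_vars n p i = {(a, b). b = p \<and> p \<le> a \<and> a \<le> i \<or> p < b \<and> b \<le> a \<and> a \<le> n}"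

lemma finite_stage_vars: "finite (stage_vars n p i)"
proof (rule finite_subset)
  show "stage_vars n p i \<subseteq> {..max n i} \<times> {..max n (max p i)}" by (auto simp: stage_vars_def)
qed simp

text \<open>A point with dependent row \<open>r\<close> can be moved off the hyperplane of the variable \<open>(i, p)\<close> without
  leaving the variety of matrices with dependent row \<open>r\<close>. When the coefficient of row \<open>i\<close> is not zero, the
  change in column \<open>p\<close> is compensated by moving the entry and the coefficient of row \<open>s\<close> at the same time;
  this fails for \<open>i = s\<close>, where the variety may become reducible.\<close>

lemma row_dep_perturb:
  fixes Y :: "nat \<times> nat \<Rightarrow> complex"
  assumes sr: "p \<le> s" "s < r" "r \<le> n" and i: "p \<le> i" "i \<le> n" "i \<noteq> s"
    and Y: "\<And>x. x \<notin> stage_vars n p i - {(i, p)} \<Longrightarrow> Y x = 0" and dep: "row_dep Y r s"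
  obtains Z :: "complex \<Rightarrow> nat \<times> nat \<Rightarrow> complex" where "Z 0 = Y" "\<And>x. isCont (\<lambda>t. Z t x) 0"
    "eventually (\<lambda>t. Z t (i, p) \<noteq> 0 \<and> (\<forall>x. x \<notin> stage_vars n p i \<longrightarrow> Z t x = 0) \<and> row_dep (Z t) r s) (at 0)"
proof -
  obtain u where u: "\<And>b. Y (r, b) = (\<Sum>k=s..<r. u k * Y (k, b))" using dep by (auto simp: row_dep_def)
  have Yip: "Y (i, p) = 0" using Y by auto
  have ip: "(i, p) \<in> stage_vars n p i" using i by (auto simp: stage_vars_def)
  show ?thesis
  proof (cases "i \<noteq> r \<and> (s < i \<and> i < r \<longrightarrow> u i = 0)")
    case True
    \<comment> \<open>Row \<open>i\<close> does not enter the relation with a nonzero coefficient,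
      so its entry can be varied freely.\<close>
    define Z where "Z t = Y((i, p) := t)" for t
    show ?thesis
    proof (rule that[of Z])
      show "Z 0 = Y" using Yip by (auto simp: Z_def)
      show "isCont (\<lambda>t. Z t x) 0" for x by (cases "x = (i, p)") (auto simp: Z_def)
      have dep: "row_dep (Z t) r s" for t
        unfolding row_dep_def
      proof (intro exI allI)
        fix b
        have "Z t (r, b) = Y (r, b)" using True by (auto simp: Z_def)
        also have "\<dots> = (\<Sum>k=s..<r. u k * Z t (k, b))"
          unfolding u using True i(3) by (intro sum.cong) (auto simp: Z_def)
        finally show "Z t (r, b) = (\<Sum>k=s..<r. u k * Z t (k, b))" .
      qed
      have "t \<noteq> 0 \<Longrightarrow> Z t (i, p) \<noteq> 0 \<and> (\<forall>x. x \<notin> stage_vars n p i \<longrightarrow> Z t x = 0) \<and> row_dep (Z t) r s" for t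
        using dep[of t] Y ip by (auto simp: Z_def)
      then show "eventually (\<lambda>t. Z t (i, p) \<noteq> 0 \<and> (\<forall>x. x \<notin> stage_vars n p i \<longrightarrow> Z t x = 0) \<and>
          row_dep (Z t) r s) (at 0)"
        by (simp add: eventually_at_filter)
    qed
  next
    case False
    then have i': "s < i" "i \<le> r" "i \<noteq> r \<Longrightarrow> u i \<noteq> 0" using sr by auto
    \<comment> \<open>\<open>f t\<close> is the increase of \<open>u s * Y (s, p)\<close> when both
      factors grow by \<open>t\<close>. The quadratic term keeps it nonzero for small
      \<open>t \<noteq> 0\<close> even when \<open>u s + Y (s, p) = 0\<close>.\<close>
    define f where "f t = t * (u s + Y (s, p) + t)" for t
    \<comment> \<open>Outside column \<open>p\<close>, row \<open>r\<close> absorbs the new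
      coefficient \<open>u s + t\<close> of row \<open>s\<close>. In column \<open>p\<close> the
      entry \<open>(i, p)\<close> absorbs it; if \<open>i < r\<close>, the variable
      \<open>(r, p)\<close> is already gone and its value must stay 0.\<close>
    define Z where "Z t = (\<lambda>(a, b).
      if a = r then if b = p then if i = r then f t else 0 else Y (r, b) + t * Y (s, b)
      else if (a, b) = (i, p) then - f t / u i
      else if (a, b) = (s, p) then Y (s, p) + t else Y (a, b))" for t
    have Yrp: "Y (r, p) = 0" using i' by (intro Y) (auto simp: stage_vars_def)
    show ?thesis
    proof (rule that[of Z])
      show "Z 0 = Y" using Yip Yrp by (auto simp: Z_def f_def)
      show "isCont (\<lambda>t. Z t x) 0" for x
        by (cases x; cases "fst x = r"; cases "snd x = p"; cases "i = r"; cases "fst x = i"; cases "fst x = s")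
          (auto simp: Z_def f_def divide_inverse intro!: continuous_intros)
      have dep: "row_dep (Z t) r s" for t
        unfolding row_dep_def
      proof (intro exI allI)
        fix b
        define ut where "ut = u(s := u s + t)"
        define Ds where "Ds = t * Y (s, b) + (if b = p then (u s + t) * t else 0)"
        define Di where "Di = (if b = p then - f t else 0)"
        have "(\<Sum>k=s..<r. ut k * Z t (k, b)) - (\<Sum>k=s..<r. u k * Y (k, b)) =
          (\<Sum>k=s..<r. (if k = s then Ds else 0) + (if k = i then Di else 0))"
          unfolding sum_subtractf[symmetric]
        proof (rule sum.cong[OF refl])
          fix k assume k: "k \<in> {s..<r}"
          show "ut k * Z t (k, b) - u k * Y (k, b) = (if k = s then Ds else 0) + (if k = i then Di else 0)"
            using k i' Yip by (auto simp: ut_def Z_def Ds_def Di_def algebra_simps)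
        qed
        also have "\<dots> = Ds + (if i = r then 0 else Di)"
          using sr i' by (auto simp: sum.distrib)
        finally have "(\<Sum>k=s..<r. ut k * Z t (k, b)) = Y (r, b) + Ds + (if i = r then 0 else Di)"
          unfolding u by (simp add: algebra_simps)
        also have "\<dots> = Z t (r, b)"
          using Yrp by (auto simp: Z_def Ds_def Di_def f_def algebra_simps)
        finally show "Z t (r, b) = (\<Sum>k=s..<r. ut k * Z t (k, b))" by simp
      qed
      have sp: "(s, p) \<in> stage_vars n p i" using sr i' by (auto simp: stage_vars_def)
      have zero: "Z t x = 0" if x: "x \<notin> stage_vars n p i" for x t
      proof (cases x)
        case (Pair a b)
        show ?thesis
        proof (cases "a = r \<and> b \<noteq> p")
          case True
          have "(s, b) \<notin> stage_vars n p i"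
            using x True Pair sr by (auto simp: stage_vars_def)
          then have "Y (s, b) = 0" "Y (r, b) = 0" using Y x True Pair by auto
          then show ?thesis using True Pair by (simp add: Z_def)
        next
          case False
          have "x \<noteq> (i, p)" "x \<noteq> (s, p)" using x ip sp by auto
          then show ?thesis using False Pair Y x by (auto simp: Z_def)
        qed
      qed
      have "isCont (\<lambda>t. u s + Y (s, p) + t) 0" by (intro continuous_intros)
      then have "((\<lambda>t. u s + Y (s, p) + t) \<longlongrightarrow> u s + Y (s, p)) (at 0)" by (simp add: isCont_def)
      then have "eventually (\<lambda>t. f t \<noteq> 0) (at 0)"
      proof (cases "u s + Y (s, p) = 0")
        case True
        then show ?thesis by (simp add: f_def eventually_at_filter)
      next
        case False
        from tendsto_imp_eventually_ne[OF \<open>((\<lambda>t. u s + Y (s, p) + t) \<longlongrightarrow> _) _\<close> False]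
        show ?thesis by (auto simp: f_def eventually_at_filter elim: eventually_mono)
      qed
      then show "eventually (\<lambda>t. Z t (i, p) \<noteq> 0 \<and> (\<forall>x. x \<notin> stage_vars n p i \<longrightarrow> Z t x = 0) \<and>
          row_dep (Z t) r s) (at 0)"
      proof eventually_elim
        case (elim t)
        then have "Z t (i, p) \<noteq> 0" using i' by (auto simp: Z_def)
        then show ?case using zero dep by blast
      qed
    qed
  qed
qed

text \<open>The orders of vanishing after the columns \<open>1, \<dots>, k\<close> of exponents have been removed. For
  \<open>s \<le> k\<close> the value has no meaning.\<close>

primrec rank_bound :: "(nat \<Rightarrow> nat \<Rightarrow> nat) \<Rightarrow> (nat \<times> nat \<Rightarrow> nat) \<Rightarrow> nat \<Rightarrow> nat \<Rightarrow> nat \<Rightarrow> nat" where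
  "rank_bound c e 0 r s = c r s"
| "rank_bound c e (Suc k) r s = max (rank_bound c e k r s - e (s, Suc k)) (rank_bound c e k r (s - 1))"

section \<open>Propagation of the vanishing orders through the stages\<close>

definition lead_exps :: "(nat \<times> nat \<Rightarrow> nat) set \<Rightarrow> (nat \<times> nat \<Rightarrow> nat) \<Rightarrow> nat \<Rightarrow> nat \<Rightarrow> nat \<Rightarrow> (nat \<times> nat \<Rightarrow> nat) set" where
  "lead_exps E e0 n p i = {e \<in> E. \<forall>x\<in>stage_vars n 1 n - stage_vars n p i. e x = e0 x}"

text \<open>The bound for \<open>s\<close> is updated exactly when the variable
  \<open>(s, Suc k)\<close> is removed. The condition \<open>Suc k \<le> i \<or> Suc k < s\<close>
  drops \<open>s = Suc k\<close> once column \<open>Suc k\<close> is exhausted, since row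
  \<open>Suc k\<close> has no variables left.\<close>

definition stage_ok :: "(nat \<Rightarrow> nat \<Rightarrow> nat) \<Rightarrow> ((nat \<times> nat \<Rightarrow> nat) \<Rightarrow> complex) \<Rightarrow> (nat \<times> nat \<Rightarrow> nat) set \<Rightarrow>
    nat \<Rightarrow> (nat \<times> nat \<Rightarrow> nat) \<Rightarrow> nat \<Rightarrow> nat \<Rightarrow> bool" where
  "stage_ok c A E n e0 k i \<longleftrightarrow> (\<forall>r s Y. Suc k \<le> s \<and> s < r \<and> r \<le> n \<and> (Suc k \<le> i \<or> Suc k < s) \<and>
     (\<forall>x. x \<notin> stage_vars n (Suc k) i \<longrightarrow> Y x = 0) \<and> row_dep Y r s \<longrightarrow>
     vanishes A (lead_exps E e0 n (Suc k) i) (stage_vars n (Suc k) i)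
       (if s \<le> i then rank_bound c e0 k r s else rank_bound c e0 (Suc k) r s) Y)"

lemma row_dep_mono: "row_dep Y r s \<Longrightarrow> s' \<le> s \<Longrightarrow> row_dep (Y :: _ \<Rightarrow> 'a :: comm_semiring_0) r s'"
  unfolding row_dep_def
proof (elim exE)
  fix u assume u: "\<forall>b. Y (r, b) = (\<Sum>k=s..<r. u k * Y (k, b))" and s: "s' \<le> s"
  show "\<exists>u. \<forall>b. Y (r, b) = (\<Sum>k=s'..<r. u k * Y (k, b))"
  proof (intro exI allI)
    fix b
    have "(\<Sum>k=s'..<r. (if s \<le> k then u k else 0) * Y (k, b)) = (\<Sum>k=s..<r. u k * Y (k, b))"
      using s by (intro sum.mono_neutral_cong_right) auto
    then show "Y (r, b) = (\<Sum>k=s'..<r. (if s \<le> k then u k else 0) * Y (k, b))" using u by simp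
  qed
qed

text \<open>Removing \<open>(i, Suc k)\<close> changes only the bound for \<open>s = i\<close>. For
  the other \<open>s\<close> every point of the smaller locus is a limit of points off the
  hyperplane, by \<open>row_dep_perturb\<close>.\<close>

lemma stage_ok_step:
  assumes E: "finite E" and k: "Suc k \<le> i" "i \<le> n" "i \<ge> 1"
    and least: "\<And>e. e \<in> lead_exps E e0 n (Suc k) i \<Longrightarrow> e0 (i, Suc k) \<le> e (i, Suc k)"
    and ok: "stage_ok c A E n e0 k i"
  shows "stage_ok c A E n e0 k (i - 1)"
proof -
  define p where "p = Suc k"
  define V where "V = stage_vars n p i"
  define E1 where "E1 = lead_exps E e0 n p i"
  have V': "stage_vars n p (i - 1) = V - {(i, p)}"
    using k by (auto simp: V_def stage_vars_def p_def)
  have ip: "(i, p) \<in> V" using k by (auto simp: V_def stage_vars_def p_def)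
  have "V \<subseteq> stage_vars n 1 n" using k by (auto simp: V_def stage_vars_def p_def)
  then have "stage_vars n 1 n - (V - {(i, p)}) = insert (i, p) (stage_vars n 1 n - V)" using ip by blast
  then have E': "lead_exps E e0 n p (i - 1) = {e \<in> E1. e (i, p) = e0 (i, p)}"
    unfolding lead_exps_def V' E1_def by (auto simp: V_def)
  have fin: "finite V" "finite E1" using E finite_stage_vars by (auto simp: V_def E1_def lead_exps_def)
  have ok': "vanishes A E1 V (if s \<le> i then rank_bound c e0 k r s else rank_bound c e0 (Suc k) r s) Y"
    if "p \<le> s" "s < r" "r \<le> n" "\<And>x. x \<notin> V \<Longrightarrow> Y x = 0" "row_dep Y r s" for r s Y
  proof -
    have "p \<le> s \<and> s < r \<and> r \<le> n \<and> (p \<le> i \<or> p < s) \<and> (\<forall>x. x \<notin> V \<longrightarrow> Y x = 0) \<and> row_dep Y r s"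
      using that k by (simp add: p_def)
    then show ?thesis using ok unfolding stage_ok_def E1_def V_def p_def by metis
  qed
  have *: "vanishes A {e \<in> E1. e (i, p) = e0 (i, p)} (V - {(i, p)})
      (if s \<le> i then rank_bound c e0 k r s else rank_bound c e0 (Suc k) r s) Y"
    if prem: "p \<le> s" "s < r" "r \<le> n" "\<And>x. x \<notin> V - {(i, p)} \<Longrightarrow> Y x = 0" "row_dep Y r s" "i \<noteq> s" for r s Y
  proof -
    obtain Z :: "complex \<Rightarrow> nat \<times> nat \<Rightarrow> complex" where Z: "Z 0 = Y" "\<And>x. isCont (\<lambda>t. Z t x) 0"
      "eventually (\<lambda>t. Z t (i, p) \<noteq> 0 \<and> (\<forall>x. x \<notin> V \<longrightarrow> Z t x = 0) \<and> row_dep (Z t) r s) (at 0)"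
      by (rule row_dep_perturb[of p s r n i Y]) (use prem k in \<open>auto simp: V_def p_def\<close>)
    have "vanishes A {e \<in> E1. e (i, p) = e0 (i, p)} (V - {(i, p)})
      (if s \<le> i then rank_bound c e0 k r s else rank_bound c e0 (Suc k) r s) (Z 0)"
    proof (rule vanishes_lead_curve[OF fin(1) ip _ fin(2) Z(2)])
      show "e \<in> E1 \<Longrightarrow> e0 (i, p) \<le> e (i, p)" for e using least by (simp add: p_def E1_def)
      show "Z 0 (i, p) = 0" using Z(1) prem(4) by auto
      show "eventually (\<lambda>t. Z t (i, p) \<noteq> 0 \<and> vanishes A E1 V
        (if s \<le> i then rank_bound c e0 k r s else rank_bound c e0 (Suc k) r s) (Z t)) (at 0)"
        using Z(3) by eventually_elim (use ok'[OF prem(1-3)] in blast)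
    qed
    then show ?thesis using Z(1) by simp
  qed
  show ?thesis
    unfolding stage_ok_def p_def[symmetric] E' V'
  proof (intro allI impI, elim conjE)
    fix r s and Y :: "nat \<times> nat \<Rightarrow> complex"
    assume a: "p \<le> s" "s < r" "r \<le> n" "p \<le> i - 1 \<or> p < s"
      "\<forall>x. x \<notin> V - {(i, p)} \<longrightarrow> Y x = 0" "row_dep Y r s"
    show "vanishes A {e \<in> E1. e (i, p) = e0 (i, p)} (V - {(i, p)})
      (if s \<le> i - 1 then rank_bound c e0 k r s else rank_bound c e0 p r s) Y"
    proof (cases "i = s")
      case False
      then have "s \<le> i - 1 \<longleftrightarrow> s \<le> i" using k by linarith
      then show ?thesis using *[of s r Y] a False by (cases "s \<le> i") (simp_all add: p_def)
    next
      case True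
      \<comment> \<open>For \<open>i = s = p\<close> the disjunction in \<open>stage_ok\<close>
        would fail at \<open>i - 1\<close>; hence \<open>p < s\<close>.\<close>
      have s: "p \<le> s - 1" "s - 1 < r" using a True by auto
      \<comment> \<open>Row \<open>s - 1\<close> is added to the relation with coefficient 0. As
        \<open>i \<noteq> s - 1\<close>, the limit argument applies to the enlarged span.\<close>
      have 1: "vanishes A {e \<in> E1. e (i, p) = e0 (i, p)} (V - {(i, p)}) (rank_bound c e0 k r (s - 1)) Y"
      proof -
        have "row_dep Y r (s - 1)" using a row_dep_mono by (metis diff_le_self)
        then show ?thesis using *[of "s - 1" r Y] a s True k by auto
      qed
      have 2: "vanishes A {e \<in> E1. e (i, p) = e0 (i, p)} (V - {(i, p)}) (rank_bound c e0 k r s - e0 (s, p)) Y"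
        using vanishes_lead_diff[OF fin(1) ip _ fin(2), of "e0 (s, p)" Y A "rank_bound c e0 k r s"]
          ok'[of s r Y] a True least by (auto simp: p_def E1_def)
      show ?thesis using 1 2 True k by (auto simp: max_def p_def)
    qed
  qed
qed

lemma stage_ok_column:
  assumes "finite E" "k < n"
    and least: "\<And>i e. Suc k \<le> i \<Longrightarrow> i \<le> n \<Longrightarrow> e \<in> lead_exps E e0 n (Suc k) i \<Longrightarrow> e0 (i, Suc k) \<le> e (i, Suc k)"
    and ok: "stage_ok c A E n e0 k n" and "k \<le> i" "i \<le> n"
  shows "stage_ok c A E n e0 k i"
  using assms(6,5)
proof (induction i rule: inc_induct)
  case base
  then show ?case using ok by simp
next
  case (step i)
  then show ?case using stage_ok_step[of E k "Suc i" n e0 c A] assms by auto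
qed

text \<open>At \<open>i = k\<close> the whole column \<open>Suc k\<close> is gone and every
  remaining \<open>s\<close> exceeds \<open>i\<close>, so all bounds have been updated.\<close>

lemma stage_ok_next:
  assumes "stage_ok c A E n e0 k k"
  shows "stage_ok c A E n e0 (Suc k) n"
proof -
  have V: "stage_vars n (Suc k) k = stage_vars n (Suc (Suc k)) n" by (auto simp: stage_vars_def)
  have "lead_exps E e0 n (Suc k) k = lead_exps E e0 n (Suc (Suc k)) n" by (simp add: lead_exps_def V)
  then show ?thesis using assms unfolding stage_ok_def V by (auto split: if_splits)
qed

lemma stage_ok_all:
  assumes "finite E"
    and least: "\<And>k i e. Suc k \<le> i \<Longrightarrow> i \<le> n \<Longrightarrow> e \<in> lead_exps E e0 n (Suc k) i \<Longrightarrow> e0 (i, Suc k) \<le> e (i, Suc k)"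
    and ok: "stage_ok c A E n e0 0 n" and "k < n" "k \<le> i" "i \<le> n"
  shows "stage_ok c A E n e0 k i"
proof -
  have "stage_ok c A E n e0 k n"
    using assms(4)
  proof (induction k)
    case 0
    then show ?case using ok by simp
  next
    case (Suc k)
    then have "stage_ok c A E n e0 k k"
      using stage_ok_column[of E k n e0 c A k] assms by auto
    then show ?case by (rule stage_ok_next)
  qed
  then show ?thesis using stage_ok_column[of E k n e0 c A i] assms by auto
qed

text \<open>When row \<open>r\<close> is zero, the function is homogeneous in the direction of row \<open>r\<close>, of degree the
  remaining row sum.\<close>

lemma vanishes_row_degree:
  fixes A :: "(nat \<times> nat \<Rightarrow> nat) \<Rightarrow> complex"
  assumes V: "finite V" and E: "finite E" "E \<noteq> {}" "\<And>e. e \<in> E \<Longrightarrow> A e \<noteq> 0"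
    "\<And>e e'. e \<in> E \<Longrightarrow> e' \<in> E \<Longrightarrow> \<forall>x\<in>V. e x = e' x \<Longrightarrow> e = e'"
    and d: "\<And>e. e \<in> E \<Longrightarrow> (\<Sum>x | x \<in> V \<and> fst x = r. e x) = d"
    and van: "\<And>Y. (\<And>x. x \<notin> V \<Longrightarrow> Y x = 0) \<Longrightarrow> (\<And>b. Y (r, b) = 0) \<Longrightarrow> vanishes A E V c Y"
  shows "c \<le> d"
proof (rule ccontr)
  assume "\<not> c \<le> d"
  obtain Y :: "nat \<times> nat \<Rightarrow> complex" where Y: "(\<Sum>e\<in>E. A e * (\<Prod>x\<in>V. Y x ^ e x)) \<noteq> 0"
    using monomial_sum_nonzero[of V E A] V E by blast
  define Y0 where "Y0 x = (if x \<in> V \<and> fst x \<noteq> r then Y x else 0)" for x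
  define Q where "Q x = (if fst x = r then Y x else 0)" for x
  have pr: "(\<Prod>x\<in>V. [:Y0 x, Q x:] ^ e x) = monom (\<Prod>x\<in>V. Y x ^ e x) d" if "e \<in> E" for e
  proof -
    have "(\<Prod>x\<in>V. [:Y0 x, Q x:] ^ e x) = (\<Prod>x\<in>V. monom (Y x ^ e x) (if fst x = r then e x else 0))"
    proof (rule prod.cong[OF refl])
      fix x assume "x \<in> V"
      have "[:0, Y x:] = monom (Y x) 1" by (simp add: monom_altdef)
      moreover have "[:Y x:] ^ e x = monom (Y x ^ e x) 0"
        by (simp add: monom_0 poly_const_pow)
      ultimately show "[:Y0 x, Q x:] ^ e x = monom (Y x ^ e x) (if fst x = r then e x else 0)"
        using \<open>x \<in> V\<close> by (simp add: Y0_def Q_def monom_power)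
    qed
    also have "\<dots> = monom (\<Prod>x\<in>V. Y x ^ e x) (\<Sum>x\<in>V. if fst x = r then e x else 0)"
      using V by (induction V rule: finite_induct) (simp_all add: mult_monom)
    also have "(\<Sum>x\<in>V. if fst x = r then e x else 0) = d"
      using d[OF that] V by (simp add: sum.inter_filter)
    finally show ?thesis .
  qed
  have "line_poly A E V Y0 Q = monom (\<Sum>e\<in>E. A e * (\<Prod>x\<in>V. Y x ^ e x)) d"
    unfolding line_poly_def by (simp add: pr smult_monom monom_sum)
  moreover have "monom 1 c dvd line_poly A E V Y0 Q"
    using van[of Y0] by (auto simp: Y0_def vanishes_def)
  ultimately have "d < c \<longrightarrow> (\<Sum>e\<in>E. A e * (\<Prod>x\<in>V. Y x ^ e x)) = 0"
    by (auto simp: monom_1_dvd_iff' dest: spec[of _ d])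
  then show False using \<open>\<not> c \<le> d\<close> Y by simp
qed

text \<open>The inequality compares order and degree in row \<open>r\<close> immediately after
  \<open>(r, Suc k)\<close> has been removed: the right side is the degree left in that row, the
  left side the order of vanishing where the row is zero. Only \<open>s = r - 1\<close> occurs;
  smaller \<open>s\<close> enter through the recursion of \<open>rank_bound\<close>.\<close>

definition valid_exp :: "nat \<Rightarrow> (nat \<Rightarrow> nat \<Rightarrow> nat) \<Rightarrow> (nat \<times> nat \<Rightarrow> nat) \<Rightarrow> bool" where
  "valid_exp n c e \<longleftrightarrow> (\<forall>x. x \<notin> stage_vars n 1 n \<longrightarrow> e x = 0) \<and> (\<forall>r\<in>{1..n}. (\<Sum>q=1..r. e (r, q)) = c r r) \<and>
     (\<forall>k r. Suc k < r \<and> r \<le> n \<longrightarrow> rank_bound c e k r (r - 1) \<le> (\<Sum>q=Suc (Suc k)..r. e (r, q)))"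

lemma lead_exponent_valid:
  fixes A :: "(nat \<times> nat \<Rightarrow> nat) \<Rightarrow> complex"
  assumes E: "finite E" "E \<noteq> {}" "\<And>e. e \<in> E \<Longrightarrow> A e \<noteq> 0"
    and supp: "\<And>e x. e \<in> E \<Longrightarrow> x \<notin> stage_vars n 1 n \<Longrightarrow> e x = 0"
    and deg: "\<And>e r. e \<in> E \<Longrightarrow> r \<in> {1..n} \<Longrightarrow> (\<Sum>q=1..r. e (r, q)) = c r r"
    and van: "\<And>r s Y. 1 \<le> s \<Longrightarrow> s < r \<Longrightarrow> r \<le> n \<Longrightarrow> (\<And>x. x \<notin> stage_vars n 1 n \<Longrightarrow> Y x = 0) \<Longrightarrow> row_dep Y r s \<Longrightarrow>
      vanishes A E (stage_vars n 1 n) (c r s) Y"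
  shows "\<exists>e\<in>E. valid_exp n c e"
proof -
  \<comment> \<open>Columns from left to right, each from the bottom row upwards; the factor
    \<open>n + 1\<close> exceeds every value of \<open>n - a\<close>.\<close>
  define key :: "nat \<times> nat \<Rightarrow> nat" where "key = (\<lambda>(a, b). b * (n + 1) + (n - a))"
  have key_less: "key (a, b) < key (a', b')" if "b < b' \<or> b = b' \<and> a' < a" "a \<le> n" for a b a' b'
  proof (cases "b < b'")
    case True
    then have "Suc b * (n + 1) \<le> b' * (n + 1)" by (intro mult_le_mono1) simp
    moreover have "n - a < n + 1" by simp
    ultimately have "b * (n + 1) + (n - a) < b' * (n + 1)" unfolding mult_Suc by linarith
    then show ?thesis by (simp add: key_def)
  qed (use that in \<open>auto simp: key_def\<close>)
  have inj: "inj_on key (stage_vars n 1 n)"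
  proof (rule inj_onI, rule ccontr)
    fix x y assume "x \<in> stage_vars n 1 n" "y \<in> stage_vars n 1 n" and eq: "key x = key y" "x \<noteq> y"
    moreover obtain a b a' b' where "x = (a, b)" "y = (a', b')" by fastforce
    ultimately have "a \<le> n" "a' \<le> n" by (auto simp: stage_vars_def)
    then show False
      using key_less[of b b' a' a] key_less[of b' b a a'] eq \<open>x = _\<close> \<open>y = _\<close>
      by (metis linorder_neqE_nat nat_neq_iff)
  qed
  obtain e0 where e0: "e0 \<in> E" and least: "\<And>v e. v \<in> stage_vars n 1 n \<Longrightarrow> e \<in> E \<Longrightarrow>
     (\<And>w. w \<in> stage_vars n 1 n \<Longrightarrow> key w < key v \<Longrightarrow> e w = e0 w) \<Longrightarrow> e0 v \<le> e v"
    using lex_least_exponent[OF finite_stage_vars inj E(2)] by metis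
  have "stage_ok c A E n e0 0 n"
  proof -
    have "lead_exps E e0 n 1 n = E" by (simp add: lead_exps_def)
    then show ?thesis using van by (auto simp: stage_ok_def)
  qed
  moreover have "e0 (i, Suc k) \<le> e (i, Suc k)" if "Suc k \<le> i" "i \<le> n" "e \<in> lead_exps E e0 n (Suc k) i" for k i e
  proof (rule least)
    show "(i, Suc k) \<in> stage_vars n 1 n" using that by (auto simp: stage_vars_def)
    show "e \<in> E" using that by (simp add: lead_exps_def)
    fix w assume w: "w \<in> stage_vars n 1 n" "key w < key (i, Suc k)"
    have "w \<notin> stage_vars n (Suc k) i"
    proof
      assume "w \<in> stage_vars n (Suc k) i"
      moreover obtain a b where ab: "w = (a, b)" by fastforce
      ultimately have "b = Suc k \<and> a \<le> i \<or> Suc k < b" by (auto simp: stage_vars_def)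
      then have "w = (i, Suc k) \<or> key (i, Suc k) < key w"
        using key_less[of "Suc k" b a i] that ab by (cases "a = i") auto
      then show False using w by auto
    qed
    then show "e w = e0 w" using that w by (simp add: lead_exps_def)
  qed
  ultimately have ok: "stage_ok c A E n e0 k i" if "k < n" "k \<le> i" "i \<le> n" for k i
    using stage_ok_all[OF E(1), of n e0 c A k i] that by blast
  have "rank_bound c e0 k r (r - 1) \<le> (\<Sum>q=Suc (Suc k)..r. e0 (r, q))" if "Suc k < r" "r \<le> n" for k r
  proof (rule vanishes_row_degree[where V = "stage_vars n (Suc k) (r - 1)" and A = A and
        E = "lead_exps E e0 n (Suc k) (r - 1)" and r = r])
    show "finite (stage_vars n (Suc k) (r - 1))" by (rule finite_stage_vars)
    show "finite (lead_exps E e0 n (Suc k) (r - 1))" using E by (simp add: lead_exps_def)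
    show "lead_exps E e0 n (Suc k) (r - 1) \<noteq> {}" using e0 by (auto simp: lead_exps_def)
    show "A e \<noteq> 0" if "e \<in> lead_exps E e0 n (Suc k) (r - 1)" for e
      using that E by (auto simp: lead_exps_def)
    show "e = e'" if "e \<in> lead_exps E e0 n (Suc k) (r - 1)" "e' \<in> lead_exps E e0 n (Suc k) (r - 1)"
      "\<forall>x\<in>stage_vars n (Suc k) (r - 1). e x = e' x" for e e'
    proof
      fix x
      show "e x = e' x"
        using that supp[of e x] supp[of e' x] by (cases "x \<in> stage_vars n 1 n") (auto simp: lead_exps_def)
    qed
    show "(\<Sum>x | x \<in> stage_vars n (Suc k) (r - 1) \<and> fst x = r. e x) = (\<Sum>q=Suc (Suc k)..r. e0 (r, q))"
      if e: "e \<in> lead_exps E e0 n (Suc k) (r - 1)" for e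
    proof -
      have "{x. x \<in> stage_vars n (Suc k) (r - 1) \<and> fst x = r} = Pair r ` {Suc (Suc k)..r}"
        using \<open>r \<le> n\<close> \<open>Suc k < r\<close> by (auto simp: stage_vars_def)
      \<comment> \<open>The remaining degree in row \<open>r\<close> does not depend on
        \<open>e\<close>: the total row degree is fixed, and the removed columns agree with
        \<open>e0\<close>.\<close>
      then have "(\<Sum>x | x \<in> stage_vars n (Suc k) (r - 1) \<and> fst x = r. e x) = (\<Sum>q=Suc (Suc k)..r. e (r, q))"
        by (simp add: sum.reindex inj_on_def)
      moreover have "e (r, q) = e0 (r, q)" if "q \<in> {1..Suc k}" for q
        using e that \<open>r \<le> n\<close> \<open>Suc k < r\<close> by (auto simp: lead_exps_def stage_vars_def)
      then have "(\<Sum>q=1..Suc k. e (r, q)) = (\<Sum>q=1..Suc k. e0 (r, q))" by (intro sum.cong) auto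
      moreover have "(\<Sum>q=1..r. f q) = (\<Sum>q=1..Suc k. f q) + (\<Sum>q=Suc (Suc k)..r. f q)" for f :: "nat \<Rightarrow> nat"
        using sum.ub_add_nat[of 1 "Suc k" f "r - Suc k"] \<open>Suc k < r\<close> by simp
      moreover have "(\<Sum>q=1..r. e (r, q)) = (\<Sum>q=1..r. e0 (r, q))"
        using deg[of e r] deg[of e0 r] e e0 \<open>r \<le> n\<close> \<open>Suc k < r\<close> by (auto simp: lead_exps_def)
      ultimately show ?thesis by (metis add_left_cancel)
    qed
    fix Y :: "nat \<times> nat \<Rightarrow> complex"
    assume Y: "\<And>x. x \<notin> stage_vars n (Suc k) (r - 1) \<Longrightarrow> Y x = 0" "\<And>b. Y (r, b) = 0"
    have "Suc k \<le> r - 1" "r - 1 \<le> n" using \<open>r \<le> n\<close> \<open>Suc k < r\<close> by auto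
    \<comment> \<open>A zero row is dependent on row \<open>r - 1\<close> with coefficient 0, so the
      stage invariant covers this locus.\<close>
    moreover have "row_dep Y r (r - 1)" unfolding row_dep_def using Y(2) by (intro exI[of _ "\<lambda>_. 0"]) simp
    ultimately show "vanishes A (lead_exps E e0 n (Suc k) (r - 1)) (stage_vars n (Suc k) (r - 1)) (rank_bound c e0 k r (r - 1)) Y"
      using ok[of k "r - 1", unfolded stage_ok_def, rule_format, of "r - 1" r Y] \<open>r \<le> n\<close> \<open>Suc k < r\<close> Y
      by auto
  qed
  then have "valid_exp n c e0" using e0 supp deg by (auto simp: valid_exp_def)
  then show ?thesis using e0 by blast
qed

section \<open>Column antisymmetry\<close>

text \<open>The product, over the columns of \<open>D\<close>, of determinants with row vectors
  \<open>Z b\<close> and column indices read from \<open>S\<close>. A separate vector for each box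
  allows row operations in selected columns only.\<close>

definition column_alternator :: "box set \<Rightarrow> filling \<Rightarrow> (box \<Rightarrow> nat \<Rightarrow> 'a :: comm_ring_1) \<Rightarrow> 'a" where
  "column_alternator D S Z = (\<Sum>w\<in>Col D. of_int (sign w) * (\<Prod>b\<in>D. Z (w b) (S b)))"

lemma finite_Col: "finite D \<Longrightarrow> finite (Col D)"
  by (rule finite_subset[OF _ finite_permutations[of D]]) (auto simp: Col_def Sym_def)

lemma finite_Row: "finite D \<Longrightarrow> finite (Row D)"
  by (rule finite_subset[OF _ finite_permutations[of D]]) (auto simp: Row_def Sym_def)

lemma column_alternator_eq_zero:
  fixes Z :: "box \<Rightarrow> nat \<Rightarrow> 'a :: {idom, ring_char_0}"
  assumes D: "finite D" and b: "b \<in> D" "b' \<in> D" "b \<noteq> b'" "snd b = snd b'" and Z: "Z b = Z b'"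
  shows "column_alternator D S Z = 0"
proof -
  let ?t = "transpose b b'"
  have tt: "?t \<circ> (?t \<circ> w) = w" for w by (simp add: fun_eq_iff)
  have tp: "?t permutes D" using b by (simp add: permutes_swap_id)
  have mem: "?t \<circ> w \<in> Col D" if "w \<in> Col D" for w
  proof -
    have "?t \<circ> w permutes D" using that tp by (auto simp: Col_def Sym_def intro: permutes_compose)
    moreover have "snd (?t c) = snd c" for c using b(4) by (auto simp: transpose_def)
    ultimately show ?thesis using that by (auto simp: Col_def Sym_def)
  qed
  have "column_alternator D S Z = (\<Sum>w\<in>Col D. of_int (sign (?t \<circ> w)) * (\<Prod>c\<in>D. Z ((?t \<circ> w) c) (S c)))"
    unfolding column_alternator_def
    by (rule sum.reindex_bij_witness[of _ "\<lambda>w. ?t \<circ> w" "\<lambda>w. ?t \<circ> w"]) (simp_all add: tt mem)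
  also have "\<dots> = (\<Sum>w\<in>Col D. - (of_int (sign w) * (\<Prod>c\<in>D. Z (w c) (S c))))"
  proof (rule sum.cong[OF refl])
    fix w assume "w \<in> Col D"
    then have "w permutes D" by (simp add: Col_def Sym_def)
    then have pw: "permutation w" using D permutation_permutes by blast
    have pt: "permutation ?t" using tp D permutation_permutes by blast
    have "sign (?t \<circ> w) = - sign w"
      using sign_compose[OF pt pw] b(3) by (simp add: sign_swap_id)
    moreover have "Z (?t c) = Z c" for c using Z by (auto simp: transpose_def)
    ultimately show "of_int (sign (?t \<circ> w)) * (\<Prod>c\<in>D. Z ((?t \<circ> w) c) (S c)) =
      - (of_int (sign w) * (\<Prod>c\<in>D. Z (w c) (S c)))" by simp
  qed
  also have "\<dots> = - column_alternator D S Z" by (simp add: column_alternator_def sum_negf)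
  finally have "2 * column_alternator D S Z = 0" 
    unfolding eq_neg_iff_add_eq_0 mult_2 .
  then show ?thesis by simp
qed

lemma column_alternator_linear:
  assumes D: "finite D" and b: "b \<in> D"
  shows "column_alternator D S (Z(b := \<lambda>q. f q + a * g q)) =
    column_alternator D S (Z(b := f)) + a * column_alternator D S (Z(b := g))"
proof -
  define F where "F h w = of_int (sign w) * (\<Prod>c\<in>D. (Z(b := h)) (w c) (S c))" for h :: "nat \<Rightarrow> 'a" and w
  have F: "column_alternator D S (Z(b := h)) = (\<Sum>w\<in>Col D. F h w)" for h
    by (simp only: column_alternator_def F_def)
  have "F (\<lambda>q. f q + a * g q) w = F f w + a * F g w" if "w \<in> Col D" for w
  proof -
    have w: "w permutes D" using that by (simp add: Col_def Sym_def)
    define b' where "b' = inv w b"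
    have b': "b' \<in> D" "w b' = b"
      using b permutes_in_image[OF permutes_inv[OF w]] permutes_inverses[OF w] by (auto simp: b'_def)
    have ne: "w c \<noteq> b" if "c \<in> D - {b'}" for c
    proof
      assume "w c = b"
      then have "b' = c" using permutes_inverses(2)[OF w, of c] by (simp only: b'_def)
      then show False using that by blast
    qed
    have p: "(\<Prod>c\<in>D. (Z(b := h)) (w c) (S c)) = h (S b') * (\<Prod>c\<in>D - {b'}. Z (w c) (S c))" for h
      using ne by (simp add: prod.remove[OF D b'(1)] b'(2))
    show ?thesis unfolding F_def p by (simp add: algebra_simps)
  qed
  then have "(\<Sum>w\<in>Col D. F (\<lambda>q. f q + a * g q) w) = (\<Sum>w\<in>Col D. F f w + a * F g w)"
    by (rule sum.cong[OF refl])
  then show ?thesis by (simp only: F sum.distrib sum_distrib_left)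
qed

lemma column_alternator_row_op:
  fixes Z :: "box \<Rightarrow> nat \<Rightarrow> 'a :: {idom, ring_char_0}"
  assumes D: "finite D" and b: "b \<in> D" and K: "finite K"
    and c: "\<And>k. k \<in> K \<Longrightarrow> c k \<in> D \<and> c k \<noteq> b \<and> snd (c k) = snd b"
  shows "column_alternator D S (Z(b := \<lambda>q. Z b q - (\<Sum>k\<in>K. u k * Z (c k) q))) = column_alternator D S Z"
  using K c
proof (induction K rule: finite_induct)
  case (insert k K)
  define f where "f = (\<lambda>q. Z b q - (\<Sum>k\<in>K. u k * Z (c k) q))"
  have ck: "c k \<in> D" "b \<noteq> c k" "snd b = snd (c k)" using insert.prems[of k] by auto
  have 0: "x - (a * y + z) = x - z + (- a) * y" for x y z a :: 'a
    by (simp only: diff_add_eq_diff_diff_swap mult_minus_left add_uminus_conv_diff)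
  have 1: "(\<lambda>q. Z b q - (\<Sum>k\<in>insert k K. u k * Z (c k) q)) = (\<lambda>q. f q + (- u k) * Z (c k) q)"
    unfolding f_def sum.insert[OF insert.hyps] by (rule ext) (rule 0)
  have 2: "column_alternator D S (Z(b := Z (c k))) = 0"
    by (rule column_alternator_eq_zero[OF D b ck]) (simp add: ck(2)[symmetric])
  have 3: "column_alternator D S (Z(b := f)) = column_alternator D S Z"
    unfolding f_def by (rule insert.IH) (rule insert.prems, simp)
  show ?case
    unfolding 1 by (simp only: column_alternator_linear[OF D b, of S Z f "- u k" "Z (c k)"] 2 3 mult_zero_right add_0_right)
qed simp

text \<open>The columns in \<open>J\<close> can be treated one at a time: a step changes row
  \<open>r\<close> in a single column, and \<open>r \<notin> K\<close> keeps the subtracted rows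
  intact.\<close>

lemma column_alternator_row_ops:
  fixes Z :: "box \<Rightarrow> nat \<Rightarrow> 'a :: {idom, ring_char_0}"
  assumes D: "finite D" and J: "finite J" "\<And>j k. j \<in> J \<Longrightarrow> k \<in> insert r K \<Longrightarrow> (k, j) \<in> D" and K: "finite K" "r \<notin> K"
  shows "column_alternator D S (\<lambda>b. if fst b = r \<and> snd b \<in> J then \<lambda>q. Z b q - (\<Sum>k\<in>K. u k * Z (k, snd b) q) else Z b) =
    column_alternator D S Z"
  using J
proof (induction J rule: finite_induct)
  case (insert j J)
  define Z' where "Z' = (\<lambda>b. if fst b = r \<and> snd b \<in> J then \<lambda>q. Z b q - (\<Sum>k\<in>K. u k * Z (k, snd b) q) else Z b)"
  have Zk: "Z' (k, j) = Z (k, j)" if "k \<in> insert r K" for k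
    using insert.hyps by (auto simp: Z'_def)
  have 1: "(\<lambda>b. if fst b = r \<and> snd b \<in> insert j J then \<lambda>q. Z b q - (\<Sum>k\<in>K. u k * Z (k, snd b) q) else Z b) =
     Z'((r, j) := \<lambda>q. Z' (r, j) q - (\<Sum>k\<in>K. u k * Z' (k, j) q))"
  proof
    fix b
    have "(\<Sum>k\<in>K. u k * Z' (k, j) q) = (\<Sum>k\<in>K. u k * Z (k, j) q)" for q
      using Zk by (intro sum.cong) auto
    moreover have "Z' (r, j) = Z (r, j)" using Zk by simp
    ultimately show "(if fst b = r \<and> snd b \<in> insert j J then \<lambda>q. Z b q - (\<Sum>k\<in>K. u k * Z (k, snd b) q) else Z b) =
      (Z'((r, j) := \<lambda>q. Z' (r, j) q - (\<Sum>k\<in>K. u k * Z' (k, j) q))) b"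
      by (cases b) (auto simp: Z'_def)
  qed
  have 2: "column_alternator D S (Z'((r, j) := \<lambda>q. Z' (r, j) q - (\<Sum>k\<in>K. u k * Z' (k, j) q))) =
      column_alternator D S Z'"
    using D K insert.prems by (intro column_alternator_row_op[of D "(r, j)" K "\<lambda>k. (k, j)" S Z' u]) auto
  have 3: "column_alternator D S Z' = column_alternator D S Z"
    unfolding Z'_def by (rule insert.IH) (use insert.prems in auto)
  show ?case by (rule trans[OF arg_cong[OF 1, of "column_alternator D S"] trans[OF 2 3]])
qed simp

lemma power_dvd_prod:
  fixes p :: "'a :: comm_semiring_1"
  assumes "finite D" "B \<subseteq> D" "\<And>b. b \<in> B \<Longrightarrow> p dvd f b"
  shows "p ^ card B dvd prod f D"
proof -
  have "(\<Prod>b\<in>B. p) dvd prod f B" using assms by (intro prod_dvd_prod) auto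
  also have "prod f B dvd prod f D" using assms by (intro prod_dvd_prod_subset) auto
  finally show ?thesis by simp
qed

text \<open>These are the initial orders of vanishing; for \<open>r = s\<close> the value is the
  length of row \<open>r\<close>.\<close>

definition common_columns :: "box set \<Rightarrow> nat \<Rightarrow> nat \<Rightarrow> nat" where
  "common_columns D r s = card {j. (r, j) \<in> D \<and> (s, j) \<in> D}"

lemma column_convexD:
  assumes "column_convex D" "(a, j) \<in> D" "(b, j) \<in> D" "a \<le> i" "i \<le> b"
  shows "(i, j) \<in> D"
proof -
  obtain x y where "{i. (i, j) \<in> D} = {x..y}" using assms(1)[unfolded column_convex_def, rule_format, of j] by blast
  then have "(k, j) \<in> D \<longleftrightarrow> x \<le> k \<and> k \<le> y" for k by (simp add: set_eq_iff)
  then show ?thesis using assms(2-) by simp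
qed

text \<open>By convexity a column meeting rows \<open>s\<close> and \<open>r\<close> contains all
  rows between, so the relation can be subtracted from its row \<open>r\<close>. Afterwards these
  boxes carry multiples of the variable, and every term of the alternator uses each of them exactly
  once.\<close>

lemma column_alternator_dvd:
  fixes \<gamma> :: "nat \<times> nat \<Rightarrow> complex poly"
  assumes D: "finite D" "column_convex D" and sr: "s < r"
    and dep: "\<And>q. monom 1 1 dvd \<gamma> (r, q) - (\<Sum>k=s..<r. u k * \<gamma> (k, q))"
  shows "monom 1 (common_columns D r s) dvd column_alternator D S (\<lambda>b q. \<gamma> (fst b, q))"
proof -
  define J where "J = {j. (r, j) \<in> D \<and> (s, j) \<in> D}"
  have "J \<subseteq> snd ` D" by (force simp: J_def)
  then have J: "finite J" using D finite_subset by blast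
  define Z' where "Z' b = (if fst b = r \<and> snd b \<in> J then \<lambda>q. \<gamma> (fst b, q) - (\<Sum>k=s..<r. u k * \<gamma> (k, q))
    else (\<lambda>q. \<gamma> (fst b, q)))" for b
  have "column_alternator D S (\<lambda>b q. \<gamma> (fst b, q)) = column_alternator D S Z'"
  proof -
    have "(k, j) \<in> D" if "j \<in> J" "k \<in> insert r {s..<r}" for j k
      using that sr column_convexD[OF D(2), of s j r k] by (auto simp: J_def)
    from column_alternator_row_ops[OF D(1) J this, of r "{s..<r}" S "\<lambda>b q. \<gamma> (fst b, q)" u, unfolded fst_conv]
    show ?thesis unfolding Z'_def[abs_def] by simp
  qed
  moreover have "monom 1 (common_columns D r s) dvd (\<Prod>b\<in>D. Z' (w b) (S b))" if "w \<in> Col D" for w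
  proof -
    have w: "w permutes D" using that by (simp add: Col_def Sym_def)
    have "(\<Prod>b\<in>D. Z' (w b) (S b)) = (\<Prod>b\<in>D. Z' b (S (inv w b)))"
      using prod.permute[OF w, of "\<lambda>b. Z' b (S (inv w b))"] permutes_inverses[OF w] by (simp add: comp_def)
    moreover have "monom 1 1 ^ card (Pair r ` J) dvd (\<Prod>b\<in>D. Z' b (S (inv w b)))"
      by (rule power_dvd_prod) (use D dep in \<open>auto simp: J_def Z'_def\<close>)
    moreover have "(monom 1 1 :: complex poly) ^ card (Pair r ` J) = monom 1 (common_columns D r s)"
      by (simp add: monom_power card_image inj_on_def J_def common_columns_def)
    ultimately show ?thesis by metis
  qed
  ultimately show ?thesis unfolding column_alternator_def by (auto intro: dvd_sum)
qed

section \<open>Spanning vectors of the flagged Schur module\<close>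

lemma group_alg_act_apply: "group_alg_act D F a S = (\<Sum>w\<in>Sym D. a w * F (S \<circ> inv w))"
  by (simp add: group_alg_act_def sum_fun_apply cscale_def sym_act_def)

lemma smult_sum_right: "smult c (\<Sum>i\<in>I. f i) = (\<Sum>i\<in>I. smult c (f i))"
  by (induction I rule: infinite_finite_induct) (simp_all add: smult_add_right)

lemma finite_Sym: "finite D \<Longrightarrow> finite (Sym D)"
  by (simp add: Sym_def finite_permutations)

lemma e_vec_apply:
  assumes "finite D"
  shows "e_vec D T S = (\<Sum>w\<in>Col D. \<Sum>v\<in>Row D. of_int (sign w) * (if S \<circ> inv w \<circ> inv v = T then 1 else 0)) /
    (of_nat (card (Col D)) * of_nat (card (Row D)))"
proof -
  have a: "group_alg_act D F (alpha D) U = (\<Sum>v\<in>Row D. F (U \<circ> inv v)) / of_nat (card (Row D))" for F U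
  proof -
    have "group_alg_act D F (alpha D) U = (\<Sum>v\<in>Row D. 1 / of_nat (card (Row D)) * F (U \<circ> inv v))"
      unfolding group_alg_act_apply
      by (rule sum.mono_neutral_cong_right) (use finite_Sym[OF assms] in \<open>auto simp: alpha_def Row_def\<close>)
    then show ?thesis by (simp add: sum_divide_distrib)
  qed
  have b: "group_alg_act D F (beta D) U = (\<Sum>w\<in>Col D. of_int (sign w) * F (U \<circ> inv w)) / of_nat (card (Col D))" for F U
  proof -
    have "group_alg_act D F (beta D) U = (\<Sum>w\<in>Col D. of_int (sign w) / of_nat (card (Col D)) * F (U \<circ> inv w))"
      unfolding group_alg_act_apply
      by (rule sum.mono_neutral_cong_right) (use finite_Sym[OF assms] in \<open>auto simp: beta_def Col_def\<close>)
    then show ?thesis by (simp add: sum_divide_distrib)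
  qed
  show ?thesis
    by (simp add: e_vec_def a b basis_vec_def sum_divide_distrib sum_distrib_left mult.commute)
qed

definition flagged_fillings :: "nat \<Rightarrow> box set \<Rightarrow> filling set" where
  "flagged_fillings n D = {T \<in> fillings n D. row_flagged D T}"

text \<open>The exponent vector of the monomial attached to \<open>T\<close>, the variable
  \<open>(r, q)\<close> standing for an entry \<open>q\<close> in row \<open>r\<close>.\<close>

definition row_content :: "box set \<Rightarrow> filling \<Rightarrow> nat \<times> nat \<Rightarrow> nat" where
  "row_content D T x = card {b \<in> D. (fst b, T b) = x}"

lemma prod_content:
  fixes \<gamma> :: "nat \<times> nat \<Rightarrow> 'a :: comm_semiring_1"
  assumes "finite D" "finite V" "\<And>b. b \<in> D \<Longrightarrow> (fst b, T b) \<in> V"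
  shows "(\<Prod>b\<in>D. \<gamma> (fst b, T b)) = (\<Prod>x\<in>V. \<gamma> x ^ row_content D T x)"
proof -
  have "(\<Prod>x\<in>V. \<gamma> x ^ row_content D T x) = (\<Prod>x\<in>V. \<Prod>b\<in>{b \<in> D. (fst b, T b) = x}. \<gamma> (fst b, T b))"
    by (intro prod.cong) (auto simp: row_content_def)
  also have "\<dots> = (\<Prod>b\<in>D. \<gamma> (fst b, T b))"
    by (rule prod.group) (use assms in auto)
  finally show ?thesis by simp
qed

lemma flagged_in_stage_vars:
  assumes "D \<subseteq> {1..n} \<times> UNIV" "T \<in> flagged_fillings n D" "b \<in> D"
  shows "(fst b, T b) \<in> stage_vars n 1 n"
proof -
  have "T b \<le> fst b" using assms by (cases b) (auto simp: flagged_fillings_def row_flagged_def)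
  moreover have "T b \<in> {1..n}" using assms by (auto simp: flagged_fillings_def fillings_def)
  moreover have "fst b \<in> {1..n}" using assms by auto
  ultimately show ?thesis by (auto simp: stage_vars_def)
qed

text \<open>The monomial of a filling is unchanged by row permutations, so the row symmetrizer is
  invisible, while the column antisymmetrizer produces determinants. Vanishing of
  \<open>\<gamma>\<close> outside the lower triangle kills all fillings that are not row-flagged,
  hence the restricted sum loses nothing.\<close>

lemma sum_e_vec:
  fixes \<gamma> :: "nat \<times> nat \<Rightarrow> complex poly"
  assumes D: "finite D" "D \<subseteq> {1..n} \<times> UNIV" and S: "S \<in> fillings n D"
    and \<gamma>: "\<And>x. x \<notin> stage_vars n 1 n \<Longrightarrow> \<gamma> x = 0"
  shows "(\<Sum>T\<in>flagged_fillings n D. smult (e_vec D T S) (\<Prod>b\<in>D. \<gamma> (fst b, T b))) =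
    smult (1 / of_nat (card (Col D))) (column_alternator D S (\<lambda>b q. \<gamma> (fst b, q)))"
proof -
  let ?F = "flagged_fillings n D"
  let ?g = "\<lambda>T. \<Prod>b\<in>D. \<gamma> (fst b, T b)"
  define N where "N = (of_nat (card (Col D)) * of_nat (card (Row D)) :: complex)"
  have finF: "finite ?F" using finite_fillings[OF D(1)] by (auto simp: flagged_fillings_def)
  have g0: "?g U = 0" if "U \<in> fillings n D" "U \<notin> ?F" for U
  proof -
    have "\<not> row_flagged D U" using that by (simp add: flagged_fillings_def)
    then obtain i j where b: "(i, j) \<in> D" "\<not> U (i, j) \<le> i" unfolding row_flagged_def by blast
    then have "\<gamma> (fst (i, j), U (i, j)) = 0"
      by (intro \<gamma>) (use b D in \<open>auto simp: stage_vars_def\<close>)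
    then show ?thesis using b(1) D(1) by (intro prod_zero bexI[of _ "(i, j)"]) auto
  qed
  have inner: "(\<Sum>T\<in>?F. smult (if U = T then 1 else 0) (?g T)) = ?g U" if "U \<in> fillings n D" for U
  proof -
    have "(\<Sum>T\<in>?F. smult (if U = T then 1 else 0) (?g T)) = (\<Sum>T\<in>?F. if T = U then ?g U else 0)"
      by (intro sum.cong) auto
    then show ?thesis using finF g0[OF that] by simp
  qed
  have row: "?g (U \<circ> inv v) = ?g U" if v: "v \<in> Row D" for U v
  proof -
    have v': "v permutes D" "\<And>b. b \<in> D \<Longrightarrow> fst (v b) = fst b" using v by (auto simp: Row_def Sym_def)
    have "?g (U \<circ> inv v) = (\<Prod>b\<in>D. \<gamma> (fst (v b), U (inv v (v b))))"
      using prod.permute[OF v'(1), of "\<lambda>b. \<gamma> (fst b, U (inv v b))"] by (simp add: comp_def)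
    also have "\<dots> = ?g U" using v' permutes_inverses(2)[OF v'(1)] by (intro prod.cong) auto
    finally show ?thesis .
  qed
  have col: "?g (S \<circ> inv w) = (\<Prod>b\<in>D. \<gamma> (fst (w b), S b))" if w: "w \<in> Col D" for w
  proof -
    have w': "w permutes D" using w by (auto simp: Col_def Sym_def)
    show ?thesis
      using prod.permute[OF w', of "\<lambda>b. \<gamma> (fst b, S (inv w b))"] permutes_inverses(2)[OF w']
      by (simp add: comp_def)
  qed
  have "(\<Sum>T\<in>?F. smult (e_vec D T S) (?g T)) =
    (\<Sum>T\<in>?F. \<Sum>w\<in>Col D. \<Sum>v\<in>Row D. smult (of_int (sign w) / N) (smult (if S \<circ> inv w \<circ> inv v = T then 1 else 0) (?g T)))"
    by (simp add: e_vec_apply[OF D(1)] N_def[symmetric] sum_divide_distrib smult_sum)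
  also have "\<dots> = (\<Sum>w\<in>Col D. \<Sum>T\<in>?F. \<Sum>v\<in>Row D. smult (of_int (sign w) / N) (smult (if S \<circ> inv w \<circ> inv v = T then 1 else 0) (?g T)))"
    by (rule sum.swap)
  also have "\<dots> = (\<Sum>w\<in>Col D. \<Sum>v\<in>Row D. \<Sum>T\<in>?F. smult (of_int (sign w) / N) (smult (if S \<circ> inv w \<circ> inv v = T then 1 else 0) (?g T)))"
    by (intro sum.cong refl sum.swap)
  also have "\<dots> = (\<Sum>w\<in>Col D. \<Sum>v\<in>Row D. smult (of_int (sign w) / N) (\<Prod>b\<in>D. \<gamma> (fst (w b), S b)))"
  proof (intro sum.cong refl)
    fix w v assume w: "w \<in> Col D" and v: "v \<in> Row D"
    have "S \<circ> inv w \<circ> inv v \<in> fillings n D"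
      using S w v by (intro fillings_comp_perm permutes_inv) (auto simp: Col_def Row_def Sym_def)
    then show "(\<Sum>T\<in>?F. smult (of_int (sign w) / N) (smult (if S \<circ> inv w \<circ> inv v = T then 1 else 0) (?g T))) =
      smult (of_int (sign w) / N) (\<Prod>b\<in>D. \<gamma> (fst (w b), S b))"
      by (simp only: smult_sum_right[symmetric] inner row[OF v] col[OF w])
  qed
  also have "\<dots> = (\<Sum>w\<in>Col D. smult (1 / of_nat (card (Col D))) (of_int (sign w) * (\<Prod>b\<in>D. \<gamma> (fst (w b), S b))))"
  proof (intro sum.cong refl)
    fix w :: "box \<Rightarrow> box"
    have "id \<in> Row D" by (simp add: Row_def Sym_def permutes_id)
    then have "card (Row D) \<noteq> 0" using finite_Row[OF D(1)] by auto
    then have "of_nat (card (Row D)) * (of_int (sign w) / N) = of_int (sign w) / of_nat (card (Col D))"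
      by (simp add: N_def)
    then show "(\<Sum>v\<in>Row D. smult (of_int (sign w) / N) (\<Prod>b\<in>D. \<gamma> (fst (w b), S b))) =
      smult (1 / of_nat (card (Col D))) (of_int (sign w) * (\<Prod>b\<in>D. \<gamma> (fst (w b), S b)))"
      by (simp add: of_nat_poly of_int_poly mult.commute)
  qed
  also have "\<dots> = smult (1 / of_nat (card (Col D))) (column_alternator D S (\<lambda>b q. \<gamma> (fst b, q)))"
    by (simp add: column_alternator_def smult_sum_right)
  finally show ?thesis .
qed

section \<open>Dependence of the spanning vectors on the row content alone\<close>

lemma e_vec_row:
  assumes D: "finite D" and v: "v \<in> Row D"
  shows "e_vec D (T \<circ> v) = e_vec D T"
proof
  fix S
  have v': "v permutes D" using v by (simp add: Row_def Sym_def)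
  have iv: "inv v \<in> Row D"
  proof -
    have "fst (inv v b) = fst b" if "b \<in> D" for b
    proof -
      have "inv v b \<in> D" using that permutes_in_image[OF permutes_inv[OF v']] by simp
      then have "fst (v (inv v b)) = fst (inv v b)" using v unfolding Row_def by blast
      then show ?thesis by (simp only: permutes_inverses(1)[OF v'])
    qed
    then show ?thesis using v' by (auto simp: Row_def Sym_def permutes_inv)
  qed
  have comp: "w \<circ> w' \<in> Row D" if "w \<in> Row D" "w' \<in> Row D" for w w'
  proof -
    have "w' b \<in> D" if "b \<in> D" for b
      using \<open>w' \<in> Row D\<close> that by (auto simp: Row_def Sym_def permutes_in_image)
    then show ?thesis using that by (auto simp: Row_def Sym_def intro: permutes_compose)
  qed
  have vv: "v \<circ> inv v = id" "inv v \<circ> v = id" using permutes_inv_o[OF v'] by auto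
  have "(\<Sum>u\<in>Row D. of_int (sign w) * (if S \<circ> inv w \<circ> inv u = T \<circ> v then 1 else (0 :: complex))) =
    (\<Sum>u\<in>Row D. of_int (sign w) * (if S \<circ> inv w \<circ> inv u = T then 1 else 0))" for w
  proof (rule sum.reindex_bij_witness[of _ "\<lambda>u. inv v \<circ> u" "\<lambda>u. v \<circ> u"])
    fix u assume u: "u \<in> Row D"
    show "inv v \<circ> (v \<circ> u) = u" "v \<circ> (inv v \<circ> u) = u"
      by (simp_all add: comp_assoc[symmetric] vv)
    show "v \<circ> u \<in> Row D" "inv v \<circ> u \<in> Row D" using comp v iv u by auto
    have "inv (v \<circ> u) = inv u \<circ> inv v"
      using u v' by (intro o_inv_distrib permutes_bij) (auto simp: Row_def Sym_def)
    moreover have "S \<circ> inv w \<circ> inv u = T \<circ> v \<longleftrightarrow> S \<circ> inv w \<circ> (inv u \<circ> inv v) = T"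
    proof
      assume "S \<circ> inv w \<circ> inv u = T \<circ> v"
      then have "S \<circ> inv w \<circ> inv u \<circ> inv v = T \<circ> (v \<circ> inv v)" by (simp add: comp_assoc)
      then show "S \<circ> inv w \<circ> (inv u \<circ> inv v) = T" by (simp add: comp_assoc vv)
    next
      assume "S \<circ> inv w \<circ> (inv u \<circ> inv v) = T"
      then have "S \<circ> inv w \<circ> inv u \<circ> (inv v \<circ> v) = T \<circ> v" by (simp add: comp_assoc[symmetric])
      then show "S \<circ> inv w \<circ> inv u = T \<circ> v" by (simp add: vv)
    qed
    ultimately show "of_int (sign w) * (if S \<circ> inv w \<circ> inv (v \<circ> u) = T then 1 else (0 :: complex)) =
      of_int (sign w) * (if S \<circ> inv w \<circ> inv u = T \<circ> v then 1 else 0)" by simp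
  qed
  then show "e_vec D (T \<circ> v) S = e_vec D T S"
    by (simp only: e_vec_apply[OF D])
qed

lemma same_content_row:
  assumes D: "finite D" and T: "T \<in> fillings n D" "T' \<in> fillings n D" and c: "row_content D T = row_content D T'"
  obtains v where "v \<in> Row D" "T' = T \<circ> v"
proof -
  have "image_mset (\<lambda>b. (fst b, T' b)) (mset_set D) = image_mset (\<lambda>b. (fst b, T b)) (mset_set D)"
  proof (rule multiset_eqI)
    fix x
    have "count (image_mset (\<lambda>b. (fst b, U b)) (mset_set D)) x = row_content D U x" for U
      using D by (simp add: count_image_mset_eq_card_vimage row_content_def)
    then show "count (image_mset (\<lambda>b. (fst b, T' b)) (mset_set D)) x = count (image_mset (\<lambda>b. (fst b, T b)) (mset_set D)) x"
      using c by simp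
  qed
  from image_mset_eq_implies_permutes[OF D this] obtain v where
    v: "v permutes D" "\<forall>b\<in>D. (fst b, T' b) = (fst (v b), T (v b))" .
  have "v \<in> Row D" using v by (auto simp: Row_def Sym_def)
  moreover have "T' b = (T \<circ> v) b" for b
  proof (cases "b \<in> D")
    case False
    then have "v b = b" using v(1) by (simp add: permutes_not_in)
    then show ?thesis using PiE_arb[OF T(1)[unfolded fillings_def] False] PiE_arb[OF T(2)[unfolded fillings_def] False]
      by simp
  qed (use v in auto)
  ultimately show ?thesis using that by blast
qed

lemma e_vec_content:
  assumes "finite D" "T \<in> fillings n D" "T' \<in> fillings n D" "row_content D T = row_content D T'"
  shows "e_vec D T = e_vec D T'"
  using same_content_row[OF assms] e_vec_row[OF assms(1)] by metis

lemma row_content_sum: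
  assumes D: "finite D" "column_convex D" "D \<subseteq> {1..n} \<times> UNIV" and T: "T \<in> flagged_fillings n D" and r: "r \<in> {1..n}"
  shows "(\<Sum>q=1..r. row_content D T (r, q)) = common_columns D r r"
proof -
  have "(\<Sum>q=1..r. row_content D T (r, q)) = (\<Sum>q=1..r. card {b \<in> {b \<in> D. fst b = r}. T b = q})"
    unfolding row_content_def by (intro sum.cong arg_cong[of _ _ card]) auto
  also have "\<dots> = card (\<Union>q\<in>{1..r}. {b \<in> {b \<in> D. fst b = r}. T b = q})"
    using D by (intro card_UN_disjoint[symmetric]) auto
  also have "(\<Union>q\<in>{1..r}. {b \<in> {b \<in> D. fst b = r}. T b = q}) = Pair r ` {j. (r, j) \<in> D}"
  proof -
    have "T (r, j) \<in> {1..r}" if "(r, j) \<in> D" for j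
      using T that by (auto simp: flagged_fillings_def row_flagged_def fillings_def)
    then show ?thesis by auto
  qed
  also have "card \<dots> = common_columns D r r"
    by (simp add: card_image inj_on_def common_columns_def)
  finally show ?thesis .
qed

section \<open>Spanning by duality\<close>

lemma separating_functional:
  fixes v :: "'a \<Rightarrow> complex"
  assumes X: "finite X" "\<And>S. S \<notin> X \<Longrightarrow> v S = 0" "\<And>b S. b \<in> B \<Longrightarrow> S \<notin> X \<Longrightarrow> b S = 0"
    and v: "v \<notin> cfun.span B"
  shows "\<exists>\<phi>. (\<Sum>S\<in>X. \<phi> S * v S) \<noteq> 0 \<and> (\<forall>b\<in>B. (\<Sum>S\<in>X. \<phi> S * b S) = 0)"
proof -
  interpret vp: vector_space_pair "cscale :: complex \<Rightarrow> ('a \<Rightarrow> complex) \<Rightarrow> _" "(*) :: complex \<Rightarrow> complex \<Rightarrow> complex"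
    by unfold_locales (auto simp: algebra_simps)
  obtain B' where B': "B' \<subseteq> B" "cfun.independent B'" "B \<subseteq> cfun.span B'"
    by (rule cfun.maximal_independent_subset[of B])
  have sp: "cfun.span B' = cfun.span B"
    by (rule antisym[OF cfun.span_mono[OF B'(1)] cfun.span_minimal[OF B'(3) cfun.subspace_span]])
  have "cfun.independent (insert v B')" using v B' sp by (intro cfun.independent_insertI) auto
  from vp.linear_independent_extend[OF this, of "\<lambda>x. if x = v then 1 else 0"] obtain g where
    g: "Vector_Spaces.linear cscale (*) g" "\<And>x. x \<in> insert v B' \<Longrightarrow> g x = (if x = v then 1 else 0)" by blast
  define \<delta> :: "'a \<Rightarrow> 'a \<Rightarrow> complex" where "\<delta> S = (\<lambda>U. if U = S then 1 else 0)" for S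
  have rep: "g F = (\<Sum>S\<in>X. g (\<delta> S) * F S)" if "\<And>S. S \<notin> X \<Longrightarrow> F S = 0" for F
  proof -
    have "F = (\<Sum>S\<in>X. cscale (F S) (\<delta> S))"
    proof
      fix U
      show "F U = (\<Sum>S\<in>X. cscale (F S) (\<delta> S)) U"
        unfolding sum_fun_apply cscale_def \<delta>_def using X(1) that[of U] by (simp add: if_distrib cong: if_cong)
    qed
    then have "g F = g (\<Sum>S\<in>X. cscale (F S) (\<delta> S))" by simp
    also have "\<dots> = (\<Sum>S\<in>X. F S * g (\<delta> S))"
      by (simp add: vp.linear_sum[OF g(1)] vp.linear_scale[OF g(1)])
    finally show ?thesis by (simp add: mult.commute)
  qed
  have "g b = 0" if "b \<in> B" for b
  proof -
    have "b \<in> cfun.span B'" using that B' by blast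
    moreover have "v \<notin> B'" using v B'(1) cfun.span_base by blast
    then have "\<And>x. x \<in> B' \<Longrightarrow> g x = 0" using g(2) by auto
    ultimately show ?thesis using vp.linear_eq_0_on_span[OF g(1)] by blast
  qed
  moreover have "g v = 1" using g(2) by simp
  moreover have "g v = (\<Sum>S\<in>X. g (\<delta> S) * v S)" by (rule rep) (rule X(2))
  moreover have "g b = (\<Sum>S\<in>X. g (\<delta> S) * b S)" if "b \<in> B" for b by (rule rep) (rule X(3)[OF that])
  ultimately show ?thesis by (intro exI[of _ "\<lambda>S. g (\<delta> S)"]) simp
qed

lemma e_vec_support: "finite D \<Longrightarrow> T \<in> fillings n D \<Longrightarrow> S \<notin> fillings n D \<Longrightarrow> e_vec D T S = 0"
proof -
  assume D: "finite D" and T: "T \<in> fillings n D" and S: "S \<notin> fillings n D"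
  have "S \<circ> inv w \<circ> inv v \<noteq> T" if w: "w \<in> Col D" and v: "v \<in> Row D" for w v
  proof
    have w': "w permutes D" and v': "v permutes D" using w v by (auto simp: Col_def Row_def Sym_def)
    assume "S \<circ> inv w \<circ> inv v = T"
    then have "S \<circ> inv w \<circ> inv v \<circ> v \<circ> w \<in> fillings n D" using T w' v' by (auto intro: fillings_comp_perm)
    moreover have "S \<circ> inv w \<circ> inv v \<circ> v \<circ> w = S"
      by (simp add: fun_eq_iff permutes_inverses[OF w'] permutes_inverses[OF v'])
    ultimately show False using S by simp
  qed
  then show ?thesis by (simp add: e_vec_apply[OF D])
qed

lemma e_vec_in_span:
  assumes D: "finite D" "column_convex D" "D \<subseteq> {1..n} \<times> UNIV"
    and f: "\<And>e. valid_exp n (common_columns D) e \<Longrightarrow> f e \<in> flagged_fillings n D \<and> row_content D (f e) = e"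
    and T0: "T0 \<in> flagged_fillings n D"
  shows "e_vec D T0 \<in> cfun.span ((\<lambda>e. e_vec D (f e)) ` {e. valid_exp n (common_columns D) e})"
proof (rule ccontr)
  let ?F = "flagged_fillings n D" and ?X = "fillings n D" and ?V = "stage_vars n 1 n"
  let ?B = "(\<lambda>e. e_vec D (f e)) ` {e. valid_exp n (common_columns D) e}"
  have FX: "T \<in> ?X" if "T \<in> ?F" for T using that by (simp add: flagged_fillings_def)
  have es: "e_vec D T S = 0" if "T \<in> ?F" "S \<notin> ?X" for T S
    by (rule e_vec_support[OF D(1) FX[OF that(1)] that(2)])
  assume "e_vec D T0 \<notin> cfun.span ?B"
  then have "\<exists>\<phi>. (\<Sum>S\<in>?X. \<phi> S * e_vec D T0 S) \<noteq> 0 \<and> (\<forall>b\<in>?B. (\<Sum>S\<in>?X. \<phi> S * b S) = 0)"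
  proof (rule separating_functional[OF finite_fillings[OF D(1), of n], rotated 2])
    show "e_vec D T0 S = 0" if "S \<notin> ?X" for S by (rule es[OF T0 that])
    show "b S = 0" if b: "b \<in> ?B" and S: "S \<notin> ?X" for b S
    proof -
      obtain e where "valid_exp n (common_columns D) e" "b = e_vec D (f e)" using b by blast
      then show ?thesis using es[OF _ S, of "f e"] f by simp
    qed
  qed
  then obtain \<phi> where \<phi>: "(\<Sum>S\<in>?X. \<phi> S * e_vec D T0 S) \<noteq> 0" "\<And>b. b \<in> ?B \<Longrightarrow> (\<Sum>S\<in>?X. \<phi> S * b S) = 0"
    by blast
  define \<Phi> where "\<Phi> T = (\<Sum>S\<in>?X. \<phi> S * e_vec D T S)" for T
  \<comment> \<open>All fillings with content \<open>e\<close> give the same value of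
    \<open>\<Phi>\<close>, so \<open>A e\<close> is a positive multiple of it and no cancellation
    hides a nonzero value.\<close>
  define A where "A e = (\<Sum>T\<in>{T \<in> ?F. row_content D T = e}. \<Phi> T)" for e
  define E where "E = {e \<in> row_content D ` ?F. A e \<noteq> 0}"
  have finF: "finite ?F" using finite_fillings[OF D(1)] by (auto simp: flagged_fillings_def)
  have A: "A (row_content D T) = of_nat (card {T' \<in> ?F. row_content D T' = row_content D T}) * \<Phi> T" if "T \<in> ?F" for T
  proof -
    have "\<Phi> T' = \<Phi> T" if "T' \<in> {T' \<in> ?F. row_content D T' = row_content D T}" for T'
      using e_vec_content[OF D(1), of T' n T] FX that \<open>T \<in> ?F\<close> by (simp add: \<Phi>_def)
    then show ?thesis by (simp add: A_def)
  qed
  have cards: "card {T' \<in> ?F. row_content D T' = row_content D T} \<noteq> 0" if "T \<in> ?F" for T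
    using finF that by auto
  have lp: "line_poly A E ?V Y Q = (\<Sum>S\<in>?X. smult (\<phi> S)
      (\<Sum>T\<in>?F. smult (e_vec D T S) (\<Prod>b\<in>D. [:Y (fst b, T b), Q (fst b, T b):])))" for Y Q
  proof -
    have pc: "(\<Prod>b\<in>D. [:Y (fst b, T b), Q (fst b, T b):]) = (\<Prod>i\<in>?V. [:Y i, Q i:] ^ row_content D T i)"
      if "T \<in> ?F" for T
      by (rule prod_content[OF D(1) finite_stage_vars, of T n 1 n "\<lambda>i. [:Y i, Q i:]"])
        (rule flagged_in_stage_vars[OF D(3) that])
    have "line_poly A E ?V Y Q = (\<Sum>e\<in>row_content D ` ?F. smult (A e) (\<Prod>i\<in>?V. [:Y i, Q i:] ^ e i))"
      unfolding line_poly_def using finF by (intro sum.mono_neutral_left) (auto simp: E_def)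
    also have "\<dots> = (\<Sum>e\<in>row_content D ` ?F. \<Sum>T\<in>{T \<in> ?F. row_content D T = e}.
        smult (\<Phi> T) (\<Prod>b\<in>D. [:Y (fst b, T b), Q (fst b, T b):]))"
      unfolding A_def smult_sum by (intro sum.cong refl) (auto simp: pc)
    also have "\<dots> = (\<Sum>T\<in>?F. smult (\<Phi> T) (\<Prod>b\<in>D. [:Y (fst b, T b), Q (fst b, T b):]))"
      using finF by (intro sum.group) auto
    also have "\<dots> = (\<Sum>T\<in>?F. \<Sum>S\<in>?X. smult (\<phi> S) (smult (e_vec D T S) (\<Prod>b\<in>D. [:Y (fst b, T b), Q (fst b, T b):])))"
      unfolding \<Phi>_def smult_sum by simp
    also have "\<dots> = (\<Sum>S\<in>?X. \<Sum>T\<in>?F. smult (\<phi> S) (smult (e_vec D T S) (\<Prod>b\<in>D. [:Y (fst b, T b), Q (fst b, T b):])))"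
      by (rule sum.swap)
    finally show ?thesis by (simp only: smult_sum_right)
  qed
  have "\<exists>e\<in>E. valid_exp n (common_columns D) e"
  proof (rule lead_exponent_valid)
    show "finite E" using finF by (simp add: E_def)
    have "A (row_content D T0) \<noteq> 0"
      unfolding A[OF T0] \<Phi>_def mult_eq_0_iff of_nat_eq_0_iff using cards[OF T0] \<phi>(1) by blast
    then show "E \<noteq> {}" using T0 unfolding E_def by blast
    show "A e \<noteq> 0" if "e \<in> E" for e using that by (simp add: E_def)
    show "e x = 0" if e: "e \<in> E" and x: "x \<notin> ?V" for e x
    proof -
      obtain T where T: "T \<in> ?F" "e = row_content D T" using e unfolding E_def by blast
      have "{b \<in> D. (fst b, T b) = x} = {}" using flagged_in_stage_vars[OF D(3) T(1)] x by auto
      then show ?thesis using T by (simp only: row_content_def card.empty)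
    qed
    show "(\<Sum>q=1..r. e (r, q)) = common_columns D r r" if "e \<in> E" "r \<in> {1..n}" for e r
      using that row_content_sum[OF D] by (auto simp: E_def)
    show "vanishes A E ?V (common_columns D r s) Y"
      if sr: "1 \<le> s" "s < r" "r \<le> n" and Y: "\<And>x. x \<notin> ?V \<Longrightarrow> Y x = 0" "row_dep Y r s" for r s Y
      unfolding vanishes_def
    proof
      fix Q :: "nat \<times> nat \<Rightarrow> complex"
      \<comment> \<open>\<open>sum_e_vec\<close> needs a lower triangular matrix; entries of
        \<open>Q\<close> outside the triangle do not affect \<open>line_poly\<close>.\<close>
      define R where "R x = (if x \<in> ?V then Q x else 0)" for x
      obtain u where u: "\<And>b. Y (r, b) = (\<Sum>k=s..<r. u k * Y (k, b))" using Y(2) by (auto simp: row_dep_def)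
      have dv: "monom 1 (common_columns D r s) dvd
        (\<Sum>T\<in>?F. smult (e_vec D T S) (\<Prod>b\<in>D. [:Y (fst b, T b), R (fst b, T b):]))" if "S \<in> ?X" for S
      proof -
        have "monom 1 (common_columns D r s) dvd column_alternator D S (\<lambda>b q. [:Y (fst b, q), R (fst b, q):])"
        proof (rule column_alternator_dvd[OF D(1,2) sr(2), of "\<lambda>x. [:Y x, R x:]" "\<lambda>k. [:u k:]"])
          fix q
          \<comment> \<open>The constant coefficients are the entries at \<open>Y\<close>, where the
            relation holds exactly.\<close>
          have "coeff ([:Y (r, q), R (r, q):] - (\<Sum>k=s..<r. [:u k:] * [:Y (k, q), R (k, q):])) 0 = 0"
            by (simp add: coeff_sum u mult.commute)
          then show "monom 1 1 dvd [:Y (r, q), R (r, q):] - (\<Sum>k=s..<r. [:u k:] * [:Y (k, q), R (k, q):])"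
            unfolding monom_1_dvd_iff' by (simp only: less_one) simp
        qed
        then show ?thesis
          using sum_e_vec[OF D(1,3) that, of "\<lambda>x. [:Y x, R x:]"] Y(1) by (simp add: R_def dvd_smult)
      qed
      have "monom 1 (common_columns D r s) dvd line_poly A E ?V Y R"
        unfolding lp by (rule dvd_sum) (rule dvd_smult, rule dv)
      then show "monom 1 (common_columns D r s) dvd line_poly A E ?V Y Q"
        using line_poly_cong[of ?V Y Y R Q A E] by (simp add: R_def)
    qed
  qed
  then obtain e where e: "e \<in> E" "valid_exp n (common_columns D) e" by blast
  then have "\<Phi> (f e) = 0" unfolding \<Phi>_def by (intro \<phi>(2)) blast
  then have "A e = 0" using A[of "f e"] f[OF e(2)] by simp
  then show False using e(1) by (simp add: E_def)
qed

section \<open>Column-strict fillings\<close>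

lemma exists_top_subset:
  fixes key :: "'a \<Rightarrow> nat"
  assumes "finite A" "m \<le> card A"
  shows "\<exists>J\<subseteq>A. card J = m \<and> (\<forall>x\<in>J. \<forall>y\<in>A - J. key y \<le> key x)"
  using assms(2)
proof (induction m)
  case 0
  then show ?case by (intro exI[of _ "{}"]) auto
next
  case (Suc m)
  then obtain J where J: "J \<subseteq> A" "card J = m" "\<forall>x\<in>J. \<forall>y\<in>A - J. key y \<le> key x" by auto
  have fJ: "finite J" using J(1) assms(1) finite_subset by blast
  have ne: "A - J \<noteq> {}" using J Suc.prems by auto
  have fin: "finite (key ` (A - J))" using assms(1) by simp
  have "Max (key ` (A - J)) \<in> key ` (A - J)" using Max_in[OF fin] ne by simp
  then obtain a where a: "a \<in> A - J" "key a = Max (key ` (A - J))" by (metis imageE)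
  have max: "key y \<le> key a" if "y \<in> A - J" for y using that fin a(2) by simp
  have "card (insert a J) = Suc m" using J(2) a(1) fJ by simp
  moreover have "\<forall>x\<in>insert a J. \<forall>y\<in>A - insert a J. key y \<le> key x"
    using J(3) max by blast
  ultimately show ?case using J(1) a(1) by (intro exI[of _ "insert a J"]) auto
qed

lemma finite_columns: "finite D \<Longrightarrow> finite {j. (r, j) \<in> (D :: box set) \<and> P j}"
  by (rule finite_subset[of _ "snd ` D"]) force+

lemma lowest_row_ge_iff:
  assumes "finite D" "column_convex D" "(i, j) \<in> D" "i \<le> r"
  shows "r \<le> lowest_row D j \<longleftrightarrow> (r, j) \<in> D"
proof -
  have fin: "finite {i. (i, j) \<in> D}"
    by (rule finite_subset[of _ "fst ` D"]) (use assms(1) in force)+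
  have "(lowest_row D j, j) \<in> D" unfolding lowest_row_def using Max_in[OF fin] assms(3) by auto
  moreover have "(r, j) \<in> D \<Longrightarrow> r \<le> lowest_row D j" unfolding lowest_row_def using fin by (auto intro: Max_ge)
  ultimately show ?thesis using column_convexD[OF assms(2,3) _ assms(4)] by blast
qed

definition top_columns :: "box set \<Rightarrow> nat \<Rightarrow> nat set" where
  "top_columns D r = {j. (r, j) \<in> D \<and> (r - 1, j) \<notin> D}"

lemma card_top_columns:
  assumes "finite D" "r \<ge> 1"
  shows "card {j \<in> top_columns D r. P j} = card {j. (r, j) \<in> D \<and> P j} - card {j. (r, j) \<in> D \<and> (r - 1, j) \<in> D \<and> P j}"
proof -
  have "{j \<in> top_columns D r. P j} = {j. (r, j) \<in> D \<and> P j} - {j. (r, j) \<in> D \<and> (r - 1, j) \<in> D \<and> P j}"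
    by (auto simp: top_columns_def)
  moreover have "{j. (r, j) \<in> D \<and> (r - 1, j) \<in> D \<and> P j} \<subseteq> {j. (r, j) \<in> D \<and> P j}" by auto
  ultimately show ?thesis using assms by (simp add: card_Diff_subset finite_columns)
qed

text \<open>Among the columns with the same top box, cutting those that reach lowest makes the remaining
  diagram as large as possible for \<^const>\<open>common_columns\<close>, matching the recursion of \<^const>\<open>rank_bound\<close>.\<close>

lemma cut_tops:
  assumes D: "finite D" "column_convex D" and J: "\<And>r. J r \<subseteq> top_columns D r"
    and top: "\<And>r x y. x \<in> J r \<Longrightarrow> y \<in> top_columns D r - J r \<Longrightarrow> lowest_row D y \<le> lowest_row D x"
  defines "D' \<equiv> {(r, j) \<in> D. j \<notin> J r}"
  shows "finite D'" "column_convex D'"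
    "1 \<le> s \<Longrightarrow> s < r \<Longrightarrow> common_columns D' r s = max (common_columns D r s - card (J s)) (common_columns D r (s - 1))"
    "common_columns D' r r = common_columns D r r - card (J r)"
proof -
  have fJ: "finite (J r)" for r
    using J[of r] finite_columns[OF D(1), of r "\<lambda>j. (r - 1, j) \<notin> D"] by (auto simp: top_columns_def dest: finite_subset)
  show "finite D'" using D(1) by (auto simp: D'_def intro: finite_subset)
  show "column_convex D'"
    unfolding column_convex_def
  proof
    fix j
    obtain a b where ab: "{i. (i, j) \<in> D} = {a..b}" using D(2)[unfolded column_convex_def, rule_format, of j] by blast
    then have in_D: "(i, j) \<in> D \<longleftrightarrow> a \<le> i \<and> i \<le> b" for i by (simp add: set_eq_iff)
    have nj: "j \<notin> J i" if "a < i" for i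
    proof
      assume "j \<in> J i"
      then have "(i, j) \<in> D" "(i - 1, j) \<notin> D" using J by (auto simp: top_columns_def)
      moreover have "a \<le> i - 1" using that by simp
      ultimately show False
        using in_D[of i] in_D[of "i - 1"] le_trans[OF diff_le_self[of i 1]] by blast
    qed
    have iff: "(i, j) \<in> D' \<longleftrightarrow> a \<le> i \<and> i \<le> b \<and> (i = a \<longrightarrow> j \<notin> J a)" for i
      using in_D[of i] nj[of i] by (cases "i = a") (auto simp: D'_def)
    show "\<exists>a b. {i. (i, j) \<in> D'} = {a..b}"
    proof (cases "j \<in> J a")
      case True
      then have "{i. (i, j) \<in> D'} = {Suc a..b}" unfolding iff by (auto simp: Suc_le_eq order.strict_iff_order)
      then show ?thesis by (intro exI)
    next
      case False
      then have "{i. (i, j) \<in> D'} = {a..b}" unfolding iff by auto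
      then show ?thesis by (intro exI)
    qed
  qed
  show "common_columns D' r r = common_columns D r r - card (J r)"
  proof -
    have "{j. (r, j) \<in> D' \<and> (r, j) \<in> D'} = {j. (r, j) \<in> D \<and> (r, j) \<in> D} - J r" by (auto simp: D'_def)
    moreover have "J r \<subseteq> {j. (r, j) \<in> D \<and> (r, j) \<in> D}" using J[of r] by (auto simp: top_columns_def)
    ultimately show ?thesis unfolding common_columns_def using fJ by (simp add: card_Diff_subset)
  qed
  show "common_columns D' r s = max (common_columns D r s - card (J s)) (common_columns D r (s - 1))" if s: "1 \<le> s" "s < r"
  proof -
    define A where "A = {j \<in> top_columns D s. (r, j) \<in> D}"
    have fA: "finite A"
      using finite_columns[OF D(1), of s] by (rule finite_subset[rotated]) (auto simp: A_def top_columns_def)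
    have "{j. (r, j) \<in> D' \<and> (s, j) \<in> D'} = {j. (r, j) \<in> D \<and> (s, j) \<in> D} - (J s \<inter> A)"
    proof -
      have "j \<notin> J r" if "(r, j) \<in> D" "(s, j) \<in> D" for j
      proof -
        have "(r - 1, j) \<in> D" by (rule column_convexD[OF D(2) that(2,1)]) (use s in auto)
        then show ?thesis using J[of r] by (auto simp: top_columns_def)
      qed
      then show ?thesis using J[of s] by (auto simp: D'_def A_def)
    qed
    moreover have "J s \<inter> A \<subseteq> {j. (r, j) \<in> D \<and> (s, j) \<in> D}" by (auto simp: A_def top_columns_def)
    ultimately have 1: "common_columns D' r s = common_columns D r s - card (J s \<inter> A)"
      unfolding common_columns_def using fA by (simp add: card_Diff_subset)
    have mid: "(s, j) \<in> D" if "(s - 1, j) \<in> D" "(r, j) \<in> D" for j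
      by (rule column_convexD[OF D(2) that]) (use s in auto)
    have eq: "{j. (s, j) \<in> D \<and> (s - 1, j) \<in> D \<and> (r, j) \<in> D} = {j. (r, j) \<in> D \<and> (s - 1, j) \<in> D}"
      using mid by blast
    have "card A = card {j. (s, j) \<in> D \<and> (r, j) \<in> D} - card {j. (s, j) \<in> D \<and> (s - 1, j) \<in> D \<and> (r, j) \<in> D}"
      unfolding A_def using card_top_columns[OF D(1) s(1)] .
    then have 2: "card A = common_columns D r s - common_columns D r (s - 1)"
      unfolding eq common_columns_def by (simp add: conj_commute)
    have "common_columns D r (s - 1) \<le> common_columns D r s"
      unfolding common_columns_def
      using mid by (intro card_mono finite_columns[OF D(1)]) blast
    \<comment> \<open>The sets \<open>J s\<close> and \<open>A\<close> are nested: if a column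
      reaching row \<open>r\<close> is left uncut, every cut column reaches at least as low, hence
      row \<open>r\<close> too.\<close>
    moreover have "card (J s \<inter> A) = min (card (J s)) (card A)"
    proof (cases "A \<subseteq> J s")
      case True
      then show ?thesis using card_mono[OF fJ True] by (simp add: Int_absorb1)
    next
      case False
      then obtain y where y: "y \<in> A" "y \<notin> J s" by blast
      have "x \<in> A" if x: "x \<in> J s" for x
      proof -
        have xs: "x \<in> top_columns D s" using J x by blast
        then have xD: "(s, x) \<in> D" by (simp add: top_columns_def)
        have yD: "(s, y) \<in> D" "(r, y) \<in> D" using y by (auto simp: A_def top_columns_def)
        have "r \<le> lowest_row D y" using lowest_row_ge_iff[OF D yD(1), of r] yD(2) s by simp
        also have "\<dots> \<le> lowest_row D x" using top[OF x, of y] y by (auto simp: A_def)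
        finally show ?thesis using lowest_row_ge_iff[OF D xD, of r] s xs by (simp add: A_def)
      qed
      then have "J s \<subseteq> A" by blast
      then show ?thesis using card_mono[OF fA, of "J s"] by (simp add: Int_absorb2)
    qed
    ultimately show ?thesis using 1 2 by linarith
  qed
qed

definition column_strict :: "box set \<Rightarrow> filling \<Rightarrow> bool" where
  "column_strict D T \<longleftrightarrow> (\<forall>i i' j. (i, j) \<in> D \<longrightarrow> (i', j) \<in> D \<longrightarrow> i < i' \<longrightarrow> T (i, j) < T (i', j))"

text \<open>Here \<open>D\<close> is the part of the diagram still to be filled with entries above
  \<open>k\<close>. The next entry \<open>Suc k\<close> goes into top boxes, which makes the columns
  strict; the hypotheses say that \<open>rank_bound\<close> describes the remaining shape.\<close>

lemma column_strict_filling_aux: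
  assumes "finite D" "column_convex D" "D \<subseteq> {Suc k..n} \<times> UNIV" "k \<le> n"
    and "\<And>r s. Suc k \<le> s \<Longrightarrow> s < r \<Longrightarrow> r \<le> n \<Longrightarrow> common_columns D r s = rank_bound c e k r s"
    and "\<And>r. Suc k \<le> r \<Longrightarrow> r \<le> n \<Longrightarrow> common_columns D r r = (\<Sum>q=Suc k..r. e (r, q))"
    and "\<And>k r. Suc k < r \<Longrightarrow> r \<le> n \<Longrightarrow> rank_bound c e k r (r - 1) \<le> (\<Sum>q=Suc (Suc k)..r. e (r, q))"
  shows "\<exists>T. (\<forall>b\<in>D. Suc k \<le> T b \<and> T b \<le> fst b) \<and> column_strict D T \<and>
     (\<forall>r q. Suc k \<le> q \<longrightarrow> q \<le> r \<longrightarrow> r \<le> n \<longrightarrow> row_content D T (r, q) = e (r, q))"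
  using assms(4,1-3,5-)
proof (induction k arbitrary: D rule: inc_induct)
  case base
  then have "D = {}" by auto
  then show ?case by (simp add: column_strict_def)
next
  case (step k)
  note D = step.prems(1,2)
  let ?p = "Suc k"
  \<comment> \<open>The validity inequality at \<open>k\<close> says exactly that row
    \<open>r\<close> has enough top boxes: the boxes with one directly above them must take entries
    larger than \<open>Suc k\<close>.\<close>
  have tops: "e (r, ?p) \<le> card (top_columns D r)" if r: "?p \<le> r" "r \<le> n" for r
  proof -
    have "card (top_columns D r) = common_columns D r r - common_columns D r (r - 1)"
      using card_top_columns[OF D(1), of r "\<lambda>_. True"] r by (simp add: common_columns_def conj_commute)
    moreover have "common_columns D r r = e (r, ?p) + (\<Sum>q=Suc ?p..r. e (r, q))"
      using step.prems(5)[OF r] r by (simp add: sum.atLeast_Suc_atMost)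
    moreover have "common_columns D r (r - 1) \<le> (\<Sum>q=Suc ?p..r. e (r, q))"
    proof (cases "r = ?p")
      case True
      then have "{j. (r, j) \<in> D \<and> (r - 1, j) \<in> D} = {}" using step.prems(3) by auto
      then show ?thesis by (simp only: common_columns_def card.empty)
    next
      case False
      then have "common_columns D r (r - 1) = rank_bound c e k r (r - 1)" using r by (intro step.prems(4)) auto
      then show ?thesis using step.prems(6)[of k r] False r by auto
    qed
    ultimately show ?thesis by linarith
  qed
  have "\<exists>J\<subseteq>top_columns D r. card J = (if ?p \<le> r \<and> r \<le> n then e (r, ?p) else 0) \<and>
      (\<forall>x\<in>J. \<forall>y\<in>top_columns D r - J. lowest_row D y \<le> lowest_row D x)" for r
  proof (rule exists_top_subset)
    show "finite (top_columns D r)" using finite_columns[OF D(1)] by (simp add: top_columns_def)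
  qed (use tops in auto)
  then obtain J where J: "\<And>r. J r \<subseteq> top_columns D r"
    "\<And>r. card (J r) = (if ?p \<le> r \<and> r \<le> n then e (r, ?p) else 0)"
    "\<And>r x y. x \<in> J r \<Longrightarrow> y \<in> top_columns D r - J r \<Longrightarrow> lowest_row D y \<le> lowest_row D x"
    by metis
  define D' where "D' = {(r, j) \<in> D. j \<notin> J r}"
  have cut1: "finite D'" "column_convex D'"
    unfolding D'_def by (rule cut_tops(1)[OF D]; fact J) (rule cut_tops(2)[OF D]; fact J)
  have cut3: "common_columns D' r s = max (common_columns D r s - card (J s)) (common_columns D r (s - 1))"
    if "1 \<le> s" "s < r" for r s
    unfolding D'_def by (rule cut_tops(3)[OF D _ _ that]; fact J)
  have cut4: "common_columns D' r r = common_columns D r r - card (J r)" for r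
    unfolding D'_def by (rule cut_tops(4)[OF D]; fact J)
  have fJ: "finite (J r)" for r
    using J(1)[of r] finite_columns[OF D(1), of r "\<lambda>j. (r - 1, j) \<notin> D"] by (auto simp: top_columns_def dest: finite_subset)
  have JD: "(r, j) \<in> D" if "j \<in> J r" for r j using that J(1)[of r] by (auto simp: top_columns_def)
  have "\<exists>T. (\<forall>b\<in>D'. Suc ?p \<le> T b \<and> T b \<le> fst b) \<and> column_strict D' T \<and>
     (\<forall>r q. Suc ?p \<le> q \<longrightarrow> q \<le> r \<longrightarrow> r \<le> n \<longrightarrow> row_content D' T (r, q) = e (r, q))"
  proof (rule step.IH[OF cut1])
    \<comment> \<open>In row \<open>Suc k\<close> flaggedness leaves no entry other than
      \<open>Suc k\<close>, so the row is cut completely.\<close>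
    have "(?p, j) \<notin> D'" for j
    proof -
      have "top_columns D ?p = {j. (?p, j) \<in> D}" using step.prems(3) by (auto simp: top_columns_def)
      moreover have "card {j. (?p, j) \<in> D} = e (?p, ?p)"
        using step.prems(5)[of ?p] step.hyps by (simp add: common_columns_def)
      ultimately have "J ?p = {j. (?p, j) \<in> D}"
        using J(1,2)[of ?p] step.hyps finite_columns[OF D(1), of ?p "\<lambda>_. True"] by (intro card_subset_eq) auto
      then show ?thesis by (auto simp: D'_def)
    qed
    then show "D' \<subseteq> {Suc ?p..n} \<times> UNIV"
      using step.prems(3) by (fastforce simp: D'_def le_eq_less_or_eq)
    show "common_columns D' r s = rank_bound c e ?p r s" if "Suc ?p \<le> s" "s < r" "r \<le> n" for r s
      using that cut3[of s r] J(2)[of s] step.prems(4)[of s r] step.prems(4)[of "s - 1" r] by simp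
    show "common_columns D' r r = (\<Sum>q=Suc ?p..r. e (r, q))" if "Suc ?p \<le> r" "r \<le> n" for r
      using that cut4[of r] J(2)[of r] step.prems(5)[of r] by (simp add: sum.atLeast_Suc_atMost[of ?p])
  qed (rule step.prems(6))
  then obtain T where T: "\<And>b. b \<in> D' \<Longrightarrow> Suc ?p \<le> T b \<and> T b \<le> fst b" "column_strict D' T"
    "\<And>r q. Suc ?p \<le> q \<Longrightarrow> q \<le> r \<Longrightarrow> r \<le> n \<Longrightarrow> row_content D' T (r, q) = e (r, q)" by blast
  define T1 where "T1 b = (if snd b \<in> J (fst b) then ?p else T b)" for b
  have T1p: "T1 b = ?p \<longleftrightarrow> snd b \<in> J (fst b)" if "b \<in> D" for b
    using T(1)[of b] that by (cases b) (auto simp: T1_def D'_def)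
  have T1': "T1 b = T b" if "b \<in> D'" for b
    using that by (cases b) (auto simp: T1_def D'_def)
  have a: "?p \<le> T1 b \<and> T1 b \<le> fst b" if b: "b \<in> D" for b
  proof (cases "b \<in> D'")
    case True
    then show ?thesis using T(1)[OF True] T1'[OF True] by simp
  next
    case False
    then have "T1 b = ?p" using b by (cases b) (auto simp: T1_def D'_def)
    then show ?thesis using step.prems(3) b by auto
  qed
  have "column_strict D T1"
    unfolding column_strict_def
  proof (intro allI impI)
    fix i i' j assume ij: "(i, j) \<in> D" "(i', j) \<in> D" "i < i'"
    have "(i' - 1, j) \<in> D" using column_convexD[OF D(2) ij(1,2), of "i' - 1"] ij(3) by auto
    then have "j \<notin> J i'" using J(1)[of i'] by (auto simp: top_columns_def)
    then have i': "(i', j) \<in> D'" using ij by (simp add: D'_def)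
    show "T1 (i, j) < T1 (i', j)"
    proof (cases "j \<in> J i")
      case True
      then show ?thesis using T(1)[OF i'] T1'[OF i'] by (simp add: T1_def)
    next
      case False
      then have "(i, j) \<in> D'" using ij by (simp add: D'_def)
      then show ?thesis using T(2) i' ij(3) T1' unfolding column_strict_def by metis
    qed
  qed
  moreover have "row_content D T1 (r, q) = e (r, q)" if q: "?p \<le> q" "q \<le> r" "r \<le> n" for r q
  proof (cases "q = ?p")
    case True
    have "{b \<in> D. (fst b, T1 b) = (r, ?p)} = Pair r ` J r"
      using T1p JD by force
    then show ?thesis using J(2)[of r] q True by (simp add: row_content_def card_image inj_on_def)
  next
    case False
    have "{b \<in> D. (fst b, T1 b) = (r, q)} = {b \<in> D'. (fst b, T b) = (r, q)}"
    proof -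
      have "b \<in> D \<and> T1 b = q \<longleftrightarrow> b \<in> D' \<and> T b = q" for b
        using False by (cases b) (auto simp: T1_def D'_def)
      then show ?thesis by auto
    qed
    then show ?thesis using T(3)[of q r] q False by (simp add: row_content_def)
  qed
  ultimately show ?case using a by blast
qed

lemma column_strict_filling:
  assumes D: "finite D" "column_convex D" "D \<subseteq> {1..n} \<times> UNIV" and e: "valid_exp n (common_columns D) e"
  shows "\<exists>T\<in>flagged_fillings n D. row_content D T = e \<and> column_strict D T"
proof -
  have "\<exists>T. (\<forall>b\<in>D. Suc 0 \<le> T b \<and> T b \<le> fst b) \<and> column_strict D T \<and>
     (\<forall>r q. Suc 0 \<le> q \<longrightarrow> q \<le> r \<longrightarrow> r \<le> n \<longrightarrow> row_content D T (r, q) = e (r, q))"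
    by (rule column_strict_filling_aux[where c = "common_columns D"]) (use D e in \<open>auto simp: valid_exp_def\<close>)
  then obtain T where T: "\<And>b. b \<in> D \<Longrightarrow> 1 \<le> T b \<and> T b \<le> fst b" "column_strict D T"
    "\<And>r q. 1 \<le> q \<Longrightarrow> q \<le> r \<Longrightarrow> r \<le> n \<Longrightarrow> row_content D T (r, q) = e (r, q)" by auto
  define T' where "T' = restrict T D"
  have TD: "T' b = T b" if "b \<in> D" for b using that by (simp add: T'_def)
  have "T' \<in> fillings n D"
    unfolding fillings_def
  proof (rule PiE_I)
    fix b assume b: "b \<in> D"
    then have "fst b \<le> n" using D(3) by auto
    then show "T' b \<in> {1..n}" using T(1)[OF b] TD[OF b] by auto
  qed (simp add: T'_def)
  moreover have "row_flagged D T'" using T(1) TD by (fastforce simp: row_flagged_def)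
  ultimately have F: "T' \<in> flagged_fillings n D" by (simp add: flagged_fillings_def)
  moreover have "row_content D T' = e"
  proof
    fix x :: "nat \<times> nat"
    have c: "row_content D T' x = row_content D T x" unfolding row_content_def by (rule arg_cong[of _ _ card]) (auto simp: TD)
    show "row_content D T' x = e x"
    proof (cases "x \<in> stage_vars n 1 n")
      case True
      then have "1 \<le> snd x" "snd x \<le> fst x" "fst x \<le> n" by (auto simp: stage_vars_def)
      then show ?thesis using T(3)[of "snd x" "fst x"] c by simp
    next
      case False
      have "{b \<in> D. (fst b, T' b) = x} = {}" using flagged_in_stage_vars[OF D(3) F] False by auto
      moreover have "e x = 0" using e False unfolding valid_exp_def by blast
      ultimately show ?thesis unfolding row_content_def by (simp only: card.empty)
    qed
  qed
  moreover have "column_strict D T'" using T(2) TD by (simp add: column_strict_def)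
  ultimately show ?thesis by blast
qed

section \<open>A basis of the flagged Schur module and its character\<close>

lemma Col_inversion:
  assumes w: "w \<in> Col D" "w \<noteq> id"
  obtains i i' j where "(i, j) \<in> D" "(i', j) \<in> D" "i < i'" "fst (w (i', j)) < fst (w (i, j))"
proof -
  have wp: "w permutes D" and wc: "\<And>b. b \<in> D \<Longrightarrow> snd (w b) = snd b" using w by (auto simp: Col_def Sym_def)
  obtain b0 where b0: "w b0 \<noteq> b0" using w(2) by (auto simp: fun_eq_iff)
  \<comment> \<open>In the highest row that is not fixed, a moved box can only go down, and its
    place is taken by a box from below; these two boxes form the inversion.\<close>
  define m where "m = (LEAST i. \<exists>j. w (i, j) \<noteq> (i, j))"
  have "\<exists>i j. w (i, j) \<noteq> (i, j)" using b0 by (cases b0) auto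
  then have "\<exists>j. w (m, j) \<noteq> (m, j)" unfolding m_def by (rule LeastI_ex)
  then obtain j where j: "w (m, j) \<noteq> (m, j)" by blast
  have least: "w (i, j') = (i, j')" if "i < m" for i j'
    using not_less_Least[of i "\<lambda>i. \<exists>j. w (i, j) \<noteq> (i, j)"] that unfolding m_def by blast
  have mD: "(m, j) \<in> D" using j wp by (metis permutes_not_in)
  have inj: "inj w" using wp by (rule permutes_inj)
  obtain k where k: "w (m, j) = (k, j)" using wc[OF mD] by (metis prod.collapse snd_conv)
  have "m < k"
  proof (rule ccontr)
    assume "\<not> m < k"
    then have "k < m" using j k by (metis linorder_neqE_nat)
    then have "w (k, j) = w (m, j)" using least k by simp
    then show False using injD[OF inj] \<open>k < m\<close> by blast
  qed
  define b where "b = inv w (m, j)"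
  have wb: "w b = (m, j)" unfolding b_def by (rule permutes_inverses(1)[OF wp])
  have bD: "b \<in> D" unfolding b_def using permutes_in_image[OF permutes_inv[OF wp]] mD by blast
  have sb: "snd b = j" using wc[OF bD] wb by simp
  then have bj: "b = (fst b, j)" by (metis prod.collapse)
  have "m < fst b"
  proof (rule ccontr)
    assume "\<not> m < fst b"
    then consider "fst b < m" | "fst b = m" by linarith
    then show False
    proof cases
      case 1
      then have "w b = b" using least bj by metis
      then show False using wb 1 by (metis fst_conv less_irrefl)
    next
      case 2
      then show False using j wb bj by simp
    qed
  qed
  moreover have "(fst b, j) \<in> D" using bD bj by simp
  moreover have "fst (w (fst b, j)) < fst (w (m, j))" using wb bj k \<open>m < k\<close> by simp
  ultimately show ?thesis using that mD by blast
qed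

text \<open>Exchanging the images of an inversion strictly increases the sum, as \<open>T\<close>
  increases down the columns. A maximiser over the finite group \<open>Col D\<close> therefore has
  no inversion and is the identity.\<close>

lemma column_strict_potential:
  assumes D: "finite D" and T: "column_strict D T" and w: "w \<in> Col D" "w \<noteq> id"
  shows "(\<Sum>b\<in>D. fst (w b) * T b) < (\<Sum>b\<in>D. fst b * T b)"
proof -
  define P where "P w = (\<Sum>b\<in>D. fst (w b) * T b)" for w :: "box \<Rightarrow> box"
  have up: "\<exists>w'\<in>Col D. P w < P w'" if w: "w \<in> Col D" "w \<noteq> id" for w
  proof -
    obtain i i' j where ij: "(i, j) \<in> D" "(i', j) \<in> D" "i < i'" "fst (w (i', j)) < fst (w (i, j))"
      using Col_inversion[OF w] .
    define b b' where "b = (i, j)" and "b' = (i', j)"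
    have bb: "b \<in> D" "b' \<in> D" "b \<noteq> b'" "snd b = snd b'" "T b < T b'" "fst (w b') < fst (w b)"
      using ij T by (auto simp: b_def b'_def column_strict_def)
    define w' where "w' = w \<circ> transpose b b'"
    have "w' permutes D"
      unfolding w'_def using w bb by (intro permutes_compose permutes_swap_id) (auto simp: Col_def Sym_def)
    moreover have "snd (w' c) = snd c" if "c \<in> D" for c
      using w bb that by (auto simp: w'_def Col_def transpose_def)
    ultimately have w': "w' \<in> Col D" by (simp add: Col_def Sym_def)
    have split: "P u = fst (u b) * T b + (fst (u b') * T b' + (\<Sum>c\<in>D - {b} - {b'}. fst (u c) * T c))" for u
      unfolding P_def using D bb by (simp add: sum.remove[of D b] sum.remove[of "D - {b}" b'])
    have rest: "(\<Sum>c\<in>D - {b} - {b'}. fst (w' c) * T c) = (\<Sum>c\<in>D - {b} - {b'}. fst (w c) * T c)"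
      by (intro sum.cong) (auto simp: w'_def transpose_def)
    have "w' b = w b'" "w' b' = w b" by (simp_all add: w'_def)
    moreover have "fst (w b) * T b + fst (w b') * T b' < fst (w b') * T b + fst (w b) * T b'"
    proof -
      obtain d where d: "fst (w b) = fst (w b') + Suc d" using bb(6) less_imp_Suc_add by fastforce
      obtain d' where d': "T b' = T b + Suc d'" using bb(5) less_imp_Suc_add by fastforce
      show ?thesis unfolding d d' by (simp add: algebra_simps)
    qed
    ultimately have "P w < P w'" unfolding split rest by simp
    then show ?thesis using w' by blast
  qed
  have fin: "finite (P ` Col D)" using finite_Col[OF D] by simp
  have ne: "Col D \<noteq> {}" using w by blast
  have "Max (P ` Col D) \<in> P ` Col D" using Max_in[OF fin] ne by simp
  then obtain m where m: "m \<in> Col D" "P m = Max (P ` Col D)" by (metis imageE)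
  have mx: "P u \<le> P m" if "u \<in> Col D" for u using that fin m(2) by simp
  have "m = id" using up[OF m(1)] mx by (meson leD)
  then show ?thesis using up[OF w] mx by (auto simp: P_def dest: order.strict_trans2)
qed

lemma row_content_comp_row:
  assumes v: "v \<in> Row D"
  shows "row_content D (T \<circ> v) = row_content D T"
proof
  fix x
  have vp: "v permutes D" and vr: "\<And>b. b \<in> D \<Longrightarrow> fst (v b) = fst b" using v by (auto simp: Row_def Sym_def)
  have "bij_betw v {b \<in> D. (fst b, (T \<circ> v) b) = x} {b \<in> D. (fst b, T b) = x}"
  proof (rule bij_betwI[of _ _ _ "inv v"])
    have ivD: "inv v b \<in> D" if "b \<in> D" for b using permutes_in_image[OF permutes_inv[OF vp]] that by blast
    have ivr: "fst (inv v b) = fst b" if "b \<in> D" for b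
      using vr[OF ivD[OF that]] permutes_inverses(1)[OF vp] by simp
    show "v \<in> {b \<in> D. (fst b, (T \<circ> v) b) = x} \<rightarrow> {b \<in> D. (fst b, T b) = x}"
      using vr permutes_in_image[OF vp] by auto
    show "inv v \<in> {b \<in> D. (fst b, T b) = x} \<rightarrow> {b \<in> D. (fst b, (T \<circ> v) b) = x}"
      using ivD ivr permutes_inverses(1)[OF vp] by auto
  qed (use permutes_inverses[OF vp] in auto)
  then show "row_content D (T \<circ> v) x = row_content D T x" unfolding row_content_def by (rule bij_betw_same_card)
qed

definition potential :: "box set \<Rightarrow> filling \<Rightarrow> nat" where
  "potential D T = (\<Sum>b\<in>D. fst b * T b)"

text \<open>Row permutations preserve both the potential and the row content, so only the column
  permutation matters, and it is governed by the rearrangement inequality.\<close>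

lemma e_vec_triangular_aux:
  assumes D: "finite D" and T: "column_strict D T" and w: "w \<in> Col D" and v: "v \<in> Row D"
    and eq: "T \<circ> inv w \<circ> inv v = T'"
  shows "w \<noteq> id \<Longrightarrow> potential D T' < potential D T" "w = id \<Longrightarrow> row_content D T' = row_content D T"
proof -
  have wp: "w permutes D" and vp: "v permutes D" and vr: "\<And>b. b \<in> D \<Longrightarrow> fst (v b) = fst b"
    using w v by (auto simp: Row_def Col_def Sym_def)
  have T'v: "T' \<circ> v = T \<circ> inv w" unfolding eq[symmetric] using permutes_inverses(2)[OF vp] by (simp add: fun_eq_iff)
  have "potential D T' = (\<Sum>b\<in>D. fst b * T' (v b))"
    unfolding potential_def using prod.permute sum.permute[OF vp, of "\<lambda>b. fst b * T' b"] vr by simp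
  also have "\<dots> = (\<Sum>b\<in>D. fst b * T (inv w b))"
    using fun_cong[OF T'v] by (intro sum.cong) simp_all
  also have "\<dots> = (\<Sum>b\<in>D. fst (w b) * T b)"
    using sum.permute[OF wp, of "\<lambda>b. fst b * T (inv w b)"] permutes_inverses(2)[OF wp] by (simp add: comp_def)
  finally have p: "potential D T' = (\<Sum>b\<in>D. fst (w b) * T b)" .
  show "potential D T' < potential D T" if "w \<noteq> id"
    unfolding p using column_strict_potential[OF D T w that] by (simp add: potential_def)
  show "row_content D T' = row_content D T" if "w = id"
    using T'v row_content_comp_row[OF v, of T'] that by simp
qed

lemma e_vec_triangular:
  assumes D: "finite D" and T: "column_strict D T" and ne: "e_vec D T' T \<noteq> 0" "row_content D T' \<noteq> row_content D T"
  shows "potential D T' < potential D T"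
proof -
  have "\<exists>w\<in>Col D. \<exists>v\<in>Row D. T \<circ> inv w \<circ> inv v = T'"
  proof (rule ccontr)
    assume "\<not> ?thesis"
    then have "e_vec D T' T = 0" unfolding e_vec_apply[OF D] by (simp add: sum.neutral)
    then show False using ne(1) by simp
  qed
  then obtain w v where "w \<in> Col D" "v \<in> Row D" "T \<circ> inv w \<circ> inv v = T'" by blast
  from e_vec_triangular_aux[OF D T this] ne(2) show ?thesis by blast
qed

text \<open>Only \<open>w = id\<close> can return \<open>T\<close> to itself, so all nonzero
  contributions carry sign 1 and cannot cancel.\<close>

lemma e_vec_diagonal:
  assumes D: "finite D" and T: "column_strict D T"
  shows "e_vec D T T \<noteq> 0"
proof -
  have id: "id \<in> Col D" "id \<in> Row D" by (simp_all add: Col_def Row_def Sym_def permutes_id)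
  define R where "R = {v \<in> Row D. T \<circ> inv v = T}"
  have R: "finite R" "id \<in> R" using finite_Row[OF D] id by (auto simp: R_def)
  have "(\<Sum>w\<in>Col D. \<Sum>v\<in>Row D. of_int (sign w) * (if T \<circ> inv w \<circ> inv v = T then 1 else 0)) =
     (\<Sum>w\<in>Col D. if w = id then of_nat (card R) else (0 :: complex))"
  proof (rule sum.cong[OF refl])
    fix w assume w: "w \<in> Col D"
    show "(\<Sum>v\<in>Row D. of_int (sign w) * (if T \<circ> inv w \<circ> inv v = T then 1 else 0)) =
      (if w = id then of_nat (card R) else (0 :: complex))"
    proof (cases "w = id")
      case True
      have "(\<Sum>v\<in>Row D. if T \<circ> inv v = T then 1 else (0 :: complex)) = of_nat (card R)"
        using finite_Row[OF D] by (simp add: R_def sum.If_cases Int_def)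
      then show ?thesis using True by (simp add: sign_id)
    next
      case False
      have "T \<circ> inv w \<circ> inv v \<noteq> T" if "v \<in> Row D" for v
        using e_vec_triangular_aux(1)[OF D T w that _ False] by blast
      then show ?thesis using False by (simp add: sum.neutral)
    qed
  qed
  also have "\<dots> = of_nat (card R)" using id finite_Col[OF D] by simp
  finally have *: "e_vec D T T = of_nat (card R) / (of_nat (card (Col D)) * of_nat (card (Row D)))"
    by (simp only: e_vec_apply[OF D])
  have "card R \<noteq> 0" "card (Col D) \<noteq> 0" "card (Row D) \<noteq> 0"
    using R id finite_Col[OF D] finite_Row[OF D] by auto
  then show ?thesis unfolding * by simp
qed

text \<open>In a nontrivial relation take a term of least potential and evaluate at its filling: by
  triangularity every other term with nonzero coefficient vanishes there.\<close>

lemma e_vec_independent: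
  assumes D: "finite D" and I: "finite I"
    and f: "\<And>e. e \<in> I \<Longrightarrow> column_strict D (f e) \<and> row_content D (f e) = e"
    and zero: "\<And>S. (\<Sum>e\<in>I. a e * e_vec D (f e) S) = 0" and e: "e \<in> I"
  shows "a e = (0 :: complex)"
proof (rule ccontr)
  assume "a e \<noteq> 0"
  define P where "P = (\<lambda>e. e \<in> I \<and> a e \<noteq> 0)"
  define pot where "pot e = potential D (f e)" for e
  have "P e" using e \<open>a e \<noteq> 0\<close> by (simp add: P_def)
  from ex_has_least_nat[of P e pot, OF this] obtain m where "P m" "\<forall>e. P e \<longrightarrow> pot m \<le> pot e" by blast
  then have m: "m \<in> I" "a m \<noteq> 0" "\<And>e. e \<in> I \<Longrightarrow> a e \<noteq> 0 \<Longrightarrow> pot m \<le> pot e"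
    by (simp_all add: P_def)
  have "a e * e_vec D (f e) (f m) = (if e = m then a m * e_vec D (f m) (f m) else 0)" if "e \<in> I" for e
  proof (cases "e = m")
    case False
    then have "row_content D (f e) \<noteq> row_content D (f m)" using f that m(1) by simp
    then have "e_vec D (f e) (f m) = 0 \<or> pot e < pot m"
      using e_vec_triangular[OF D conjunct1[OF f[OF m(1)]], of "f e"] unfolding pot_def by argo
    then have "e_vec D (f e) (f m) = 0 \<or> a e = 0" using m(3)[OF that] leD by blast
    then show ?thesis using False by (elim disjE) simp_all
  qed simp
  then have "(\<Sum>e\<in>I. a e * e_vec D (f e) (f m)) = (\<Sum>e\<in>I. if e = m then a m * e_vec D (f m) (f m) else 0)"
    by (rule sum.cong[OF refl])
  then have "a m * e_vec D (f m) (f m) = (\<Sum>e\<in>I. a e * e_vec D (f e) (f m))"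
    by (simp only: sum.delta[OF I] m(1) if_True)
  also have "(\<Sum>e\<in>I. a e * e_vec D (f e) (f m)) = 0" by (rule zero)
  finally have "a m * e_vec D (f m) (f m) = 0" .
  then show False
    using m(2) e_vec_diagonal[OF D conjunct1[OF f[OF m(1)]]] by simp
qed

section \<open>The trace and the torus weights\<close>

text \<open>\<open>trace_on\<close> uses an unspecified basis \<open>B\<close>; the two
  change-of-basis matrices between \<open>B\<close> and \<open>B0\<close> are inverse to each other,
  so the diagonal sum collapses to the eigenvalues.\<close>

lemma trace_on_eigenbasis:
  assumes B0: "finite B0" "cfun.independent B0" "cfun.span B0 = V"
    and lin: "Vector_Spaces.linear cscale cscale f" and eig: "\<And>b. b \<in> B0 \<Longrightarrow> f b = cscale (\<mu> b) b"
  shows "trace_on V f = (\<Sum>b\<in>B0. \<mu> b)"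
proof -
  define B where "B = (SOME B. cfun.independent B \<and> cfun.span B = V)"
  have B: "cfun.independent B" "cfun.span B = V"
    using someI[of "\<lambda>B. cfun.independent B \<and> cfun.span B = V" B0] B0 by (auto simp: B_def)
  have finB: "finite B"
    using cfun.independent_span_bound[OF B0(1) B(1)] B(2) B0(3) cfun.span_superset by blast
  interpret f: Vector_Spaces.linear cscale cscale f by (rule lin)
  have inB: "b \<in> cfun.span B0" if "b \<in> B" for b using B(2) B0(3) cfun.span_base[OF that] by simp
  have inB0: "c \<in> cfun.span B" if "c \<in> B0" for c using B(2) B0(3) cfun.span_base[OF that] by simp
  have "cfun.representation B (f b) b = (\<Sum>c\<in>B0. \<mu> c * (cfun.representation B0 b c * cfun.representation B c b))"
    if b: "b \<in> B" for b
  proof -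
    have "f b = f (\<Sum>c\<in>B0. cscale (cfun.representation B0 b c) c)"
      using cfun.sum_representation_eq[OF B0(2) inB[OF b] B0(1)] by simp
    also have "\<dots> = (\<Sum>c\<in>B0. cscale (cfun.representation B0 b c * \<mu> c) c)"
      unfolding f.sum by (intro sum.cong refl) (simp add: f.scale eig)
    finally have "cfun.representation B (f b) = cfun.representation B (\<Sum>c\<in>B0. cscale (cfun.representation B0 b c * \<mu> c) c)"
      by simp
    also have "\<dots> = (\<lambda>b'. \<Sum>c\<in>B0. cfun.representation B (cscale (cfun.representation B0 b c * \<mu> c) c) b')"
      by (rule cfun.representation_sum[OF B(1)]) (intro cfun.span_scale inB0)
    finally show ?thesis
      using cfun.representation_scale[OF B(1) inB0] by (simp add: mult_ac)
  qed
  then have "trace_on V f = (\<Sum>b\<in>B. \<Sum>c\<in>B0. \<mu> c * (cfun.representation B0 b c * cfun.representation B c b))"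
    by (simp add: trace_on_def B_def[symmetric] Let_def)
  also have "\<dots> = (\<Sum>c\<in>B0. \<mu> c * (\<Sum>b\<in>B. cfun.representation B c b * cfun.representation B0 b c))"
    by (subst sum.swap) (simp add: sum_distrib_left mult_ac)
  also have "\<dots> = (\<Sum>c\<in>B0. \<mu> c)"
  proof (rule sum.cong[OF refl])
    fix c assume c: "c \<in> B0"
    have "(\<Sum>b\<in>B. cfun.representation B c b * cfun.representation B0 b c) =
      cfun.representation B0 (\<Sum>b\<in>B. cscale (cfun.representation B c b) b) c"
      using cfun.representation_sum[OF B0(2), of B "\<lambda>b. cscale (cfun.representation B c b) b"]
        cfun.representation_scale[OF B0(2) inB] cfun.span_scale[OF inB] by simp
    also have "\<dots> = 1"
      using cfun.sum_representation_eq[OF B(1) inB0[OF c] finB] cfun.representation_basis[OF B0(2) c] by simp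
    finally show "\<mu> c * (\<Sum>b\<in>B. cfun.representation B c b * cfun.representation B0 b c) = \<mu> c" by simp
  qed
  finally show ?thesis .
qed

lemma linear_gl_act: "Vector_Spaces.linear cscale cscale (gl_act n D g)"
proof -
  have "gl_act n D g (F + G) = gl_act n D g F + gl_act n D g G" for F G
    by (rule ext) (simp add: gl_act_def algebra_simps sum.distrib)
  moreover have "gl_act n D g (cscale c F) = cscale c (gl_act n D g F)" for c F
    by (rule ext) (simp add: gl_act_def cscale_def sum_distrib_left mult_ac)
  ultimately show ?thesis by (unfold_locales) auto
qed

lemma group_alg_act_cscale: "group_alg_act D (cscale c F) a = cscale c (group_alg_act D F a)"
  by (rule ext) (simp add: group_alg_act_apply, simp add: cscale_def group_alg_act_apply sum_distrib_left mult_ac)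

lemma gl_act_diag_e_vec:
  assumes D: "finite D" and T: "T \<in> fillings n D"
  shows "gl_act n D (diag x) (e_vec D T) = cscale (\<Prod>b\<in>D. x (T b)) (e_vec D T)"
proof -
  have "(\<Sum>S\<in>fillings n D. cscale (\<Prod>b\<in>D. diag x (S b) (T b)) (basis_vec S)) =
    (\<Sum>S\<in>fillings n D. if S = T then cscale (\<Prod>b\<in>D. x (T b)) (basis_vec T) else 0)"
  proof (rule sum.cong[OF refl])
    fix S assume S: "S \<in> fillings n D"
    show "cscale (\<Prod>b\<in>D. diag x (S b) (T b)) (basis_vec S) =
      (if S = T then cscale (\<Prod>b\<in>D. x (T b)) (basis_vec T) else 0)"
    proof (cases "S = T")
      case False
      then obtain b where "b \<in> D" "S b \<noteq> T b"
        using S T unfolding fillings_def by (meson PiE_ext)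
      then have "(\<Prod>b\<in>D. diag x (S b) (T b)) = 0" using D by (intro prod_zero) (auto simp: diag_def)
      then show ?thesis using False by (simp add: cfun.scale_zero_left)
    qed (simp add: diag_def)
  qed
  also have "\<dots> = cscale (\<Prod>b\<in>D. x (T b)) (basis_vec T)" using finite_fillings[OF D] T by simp
  finally show ?thesis
    by (simp add: e_vec_def gl_act_group_alg_act gl_act_basis_vec[OF D T] group_alg_act_cscale)
qed

lemma flagged_character_valid:
  assumes D: "finite D" "column_convex D" "D \<subseteq> {1..n} \<times> UNIV"
    and ex: "\<And>e. valid_exp n (common_columns D) e \<Longrightarrow> \<exists>T\<in>flagged_fillings n D. row_content D T = e \<and> column_strict D T"
  shows "finite {e. valid_exp n (common_columns D) e}"
    "flagged_character n D x = (\<Sum>e | valid_exp n (common_columns D) e. \<Prod>p\<in>stage_vars n 1 n. x (snd p) ^ e p)"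
proof -
  let ?I = "{e. valid_exp n (common_columns D) e}" and ?F = "flagged_fillings n D"
  have "\<forall>e. \<exists>T. valid_exp n (common_columns D) e \<longrightarrow> T \<in> ?F \<and> row_content D T = e \<and> column_strict D T"
    using ex by blast
  then obtain f where f: "\<And>e. valid_exp n (common_columns D) e \<Longrightarrow> f e \<in> ?F \<and> row_content D (f e) = e \<and> column_strict D (f e)"
    by metis
  have finF: "finite ?F" using finite_fillings[OF D(1)] by (auto simp: flagged_fillings_def)
  have "?I \<subseteq> row_content D ` ?F" using f by (force simp: image_iff)
  then show finI: "finite ?I" using finF finite_subset by blast
  define h where "h e = e_vec D (f e)" for e
  have zero: "a e = 0" if "(\<Sum>e\<in>?I. cscale (a e) (h e)) = 0" "e \<in> ?I" for a e
  proof (rule e_vec_independent[OF D(1) finI, where f = f])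
    show "(\<Sum>e\<in>?I. a e * e_vec D (f e) S) = 0" for S
    proof -
      have "(\<Sum>e\<in>?I. a e * e_vec D (f e) S) = (\<Sum>e\<in>?I. cscale (a e) (h e)) S"
        by (simp add: sum_fun_apply cscale_def h_def)
      then show ?thesis using that(1) by simp
    qed
  qed (use f that in auto)
  have inj: "inj_on h ?I"
  proof (rule inj_onI, rule ccontr)
    fix e e' assume e: "e \<in> ?I" "e' \<in> ?I" and eq: "h e = h e'" and ne: "e \<noteq> e'"
    define a where "a u = (if u = e then 1 else if u = e' then - 1 else 0 :: complex)" for u
    have "(\<Sum>u\<in>?I. cscale (a u) (h u)) = (\<Sum>u\<in>?I. (if u = e then h e else 0) + (if u = e' then - h e' else 0))"
    proof (rule sum.cong[OF refl])
      fix u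
      show "cscale (a u) (h u) = (if u = e then h e else 0) + (if u = e' then - h e' else 0)"
        using ne by (cases "u = e"; cases "u = e'") (simp_all add: a_def cfun.scale_minus_left)
    qed
    also have "\<dots> = 0" using finI e eq by (simp add: sum.distrib)
    finally show False using zero[of a e] e(1) by (simp add: a_def)
  qed
  have ind: "cfun.independent (h ` ?I)"
  proof (rule cfun.independent_if_scalars_zero)
    show "finite (h ` ?I)" using finI by simp
    fix a b assume "(\<Sum>b\<in>h ` ?I. cscale (a b) b) = 0" "b \<in> h ` ?I"
    then show "a b = 0" using zero[of "\<lambda>e. a (h e)"] by (auto simp: sum.reindex[OF inj])
  qed
  have span: "cfun.span (h ` ?I) = flagged_schur_module n D"
  proof (rule antisym)
    have "h ` ?I \<subseteq> e_vec D ` ?F" using f by (auto simp: h_def)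
    then show "cfun.span (h ` ?I) \<subseteq> flagged_schur_module n D"
      unfolding flagged_schur_module_def flagged_fillings_def by (rule cfun.span_mono)
    have "e_vec D ` ?F \<subseteq> cfun.span (h ` ?I)"
    proof
      fix v assume "v \<in> e_vec D ` ?F"
      then obtain T where T: "T \<in> ?F" "v = e_vec D T" by blast
      show "v \<in> cfun.span (h ` ?I)"
        unfolding T(2) h_def by (rule e_vec_in_span[OF D _ T(1)]) (use f in auto)
    qed
    then show "flagged_schur_module n D \<subseteq> cfun.span (h ` ?I)"
      unfolding flagged_schur_module_def flagged_fillings_def
      by (rule cfun.span_minimal) (rule cfun.subspace_span)
  qed
  \<comment> \<open>An eigenvalue has to be a function of the basis vector; injectivity of
    \<open>h\<close> recovers the exponent.\<close>
  define \<mu> where "\<mu> b = (\<Prod>c\<in>D. x (f (the_inv_into ?I h b) c))" for b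
  have mu: "\<mu> (h e) = (\<Prod>c\<in>D. x (f e c))" if "e \<in> ?I" for e
    unfolding \<mu>_def by (simp only: the_inv_into_f_f[OF inj that])
  have "flagged_character n D x = (\<Sum>b\<in>h ` ?I. \<mu> b)"
    unfolding flagged_character_def
  proof (rule trace_on_eigenbasis[OF _ ind span linear_gl_act])
    show "finite (h ` ?I)" using finI by simp
    fix b assume "b \<in> h ` ?I"
    then obtain e where e: "e \<in> ?I" "b = h e" by blast
    then have "f e \<in> fillings n D" using f by (auto simp: flagged_fillings_def)
    then show "gl_act n D (diag x) b = cscale (\<mu> b) b"
      unfolding e(2) mu[OF e(1)] unfolding h_def by (rule gl_act_diag_e_vec[OF D(1)])
  qed
  also have "\<dots> = (\<Sum>e\<in>?I. \<Prod>c\<in>D. x (f e c))" by (simp add: sum.reindex[OF inj] mu)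
  also have "\<dots> = (\<Sum>e\<in>?I. \<Prod>p\<in>stage_vars n 1 n. x (snd p) ^ e p)"
  proof (rule sum.cong[OF refl])
    fix e assume "e \<in> ?I"
    then have fe: "f e \<in> ?F" "row_content D (f e) = e" using f by auto
    show "(\<Prod>c\<in>D. x (f e c)) = (\<Prod>p\<in>stage_vars n 1 n. x (snd p) ^ e p)"
      using prod_content[OF D(1) finite_stage_vars flagged_in_stage_vars[OF D(3) fe(1)], of "\<lambda>p. x (snd p)"] fe(2)
      by simp
  qed
  finally show "flagged_character n D x = (\<Sum>e | valid_exp n (common_columns D) e. \<Prod>p\<in>stage_vars n 1 n. x (snd p) ^ e p)" .
qed

section \<open>Integer points of the Minkowski sum\<close>

text \<open>By convexity, a column with a box in row \<open>s\<close> meets row \<open>r\<close>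
  exactly when its lowest box is in row \<open>r\<close> or below.\<close>

lemma card_by_lowest_row:
  assumes D: "finite D" "column_convex D" "D \<subseteq> {1..n} \<times> UNIV" and sr: "s \<le> r"
  shows "card {j. (s, j) \<in> D \<and> (r, j) \<in> D \<and> P j} = (\<Sum>k=r..n. card {j. (s, j) \<in> D \<and> lowest_row D j = k \<and> P j})"
proof -
  have fin: "finite {j. (s, j) \<in> D \<and> lowest_row D j = k \<and> P j}" for k
    using finite_columns[OF D(1), of s "\<lambda>j. lowest_row D j = k \<and> P j"] by simp
  have low: "lowest_row D j \<le> n" if "(s, j) \<in> D" for j
  proof -
    have s: "s \<le> lowest_row D j" using lowest_row_ge_iff[OF D(1,2) that, of s] that by simp
    have "(lowest_row D j, j) \<in> D" using lowest_row_ge_iff[OF D(1,2) that s] by simp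
    then show ?thesis using D(3) by auto
  qed
  have "{j. (s, j) \<in> D \<and> (r, j) \<in> D \<and> P j} = (\<Union>k\<in>{r..n}. {j. (s, j) \<in> D \<and> lowest_row D j = k \<and> P j})"
    using lowest_row_ge_iff[OF D(1,2) _ sr] low by auto
  also have "card \<dots> = (\<Sum>k=r..n. card {j. (s, j) \<in> D \<and> lowest_row D j = k \<and> P j})"
    using fin by (intro card_UN_disjoint) auto
  finally show ?thesis .
qed

lemma common_columns_Par:
  assumes D: "finite D" "column_convex D" "D \<subseteq> {1..n} \<times> UNIV" and sr: "1 \<le> s" "s \<le> r"
  shows "common_columns D r s = (\<Sum>k=r..n. Par D k (k - s + 1))"
proof -
  have "common_columns D r s = (\<Sum>k=r..n. card {j. (s, j) \<in> D \<and> lowest_row D j = k \<and> True})"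
    using card_by_lowest_row[OF D sr(2), of "\<lambda>_. True"] by (simp add: common_columns_def conj_commute)
  also have "\<dots> = (\<Sum>k=r..n. Par D k (k - s + 1))"
  proof (rule sum.cong[OF refl])
    fix k assume "k \<in> {r..n}"
    then have "k - (k - s + 1) + 1 = s" using sr by auto
    then show "card {j. (s, j) \<in> D \<and> lowest_row D j = k \<and> True} = Par D k (k - s + 1)"
      by (simp only: Par_def simp_thms)
  qed
  finally show ?thesis .
qed

lemma GT_sum_iff:
  "x \<in> GT_sum n D \<longleftrightarrow> (\<exists>y. (\<forall>k\<in>{1..n}. y k \<in> GT k (Par D k)) \<and> (\<forall>p. x p = (\<Sum>k=1..n. embed n k (y k) p)))"
proof
  assume "x \<in> GT_sum n D"
  then obtain s where s: "x = sum s {1..n}" "\<And>k. k \<in> {1..n} \<Longrightarrow> s k \<in> embed n k ` GT k (Par D k)"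
    unfolding GT_sum_def set_sum_alt[OF finite_atLeastAtMost] by blast
  then have "\<forall>k\<in>{1..n}. \<exists>y. y \<in> GT k (Par D k) \<and> s k = embed n k y" by blast
  then obtain y where y: "\<And>k. k \<in> {1..n} \<Longrightarrow> y k \<in> GT k (Par D k) \<and> s k = embed n k (y k)" by metis
  then have "x p = (\<Sum>k=1..n. embed n k (y k) p)" for p unfolding s(1) sum_fun_apply by simp
  then show "\<exists>y. (\<forall>k\<in>{1..n}. y k \<in> GT k (Par D k)) \<and> (\<forall>p. x p = (\<Sum>k=1..n. embed n k (y k) p))" using y by blast
next
  assume "\<exists>y. (\<forall>k\<in>{1..n}. y k \<in> GT k (Par D k)) \<and> (\<forall>p. x p = (\<Sum>k=1..n. embed n k (y k) p))"
  then obtain y where y: "\<And>k. k \<in> {1..n} \<Longrightarrow> y k \<in> GT k (Par D k)" "\<And>p. x p = (\<Sum>k=1..n. embed n k (y k) p)" by blast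
  have "x = (\<Sum>k=1..n. embed n k (y k))" by (rule ext) (simp add: y(2) sum_fun_apply)
  then show "x \<in> GT_sum n D"
    unfolding GT_sum_def set_sum_alt[OF finite_atLeastAtMost] using y(1) by blast
qed

lemma embed_outside: "k \<in> {1..n} \<Longrightarrow> p \<notin> tri n \<Longrightarrow> embed n k y p = 0"
  by (cases p) (auto simp: embed_def tri_def)

text \<open>The shift by \<open>n - k\<close> preserves the diagram row: for
  \<open>j' = j - (n - k)\<close> one has \<open>k - j' + i = n - j + i\<close>. A summand
  contributes only if its columns reach down to that row.\<close>

lemma sum_embed:
  assumes ij: "(i, j) \<in> tri n"
  shows "(\<Sum>k=1..n. embed n k (y k) (i, j)) = (\<Sum>k=n - j + i..n. y k (i, k - (n - j + i) + i))"
proof -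
  have "(\<Sum>k=1..n. embed n k (y k) (i, j)) = (\<Sum>k=1..n. if n - j + i \<le> k then y k (i, k - (n - j + i) + i) else 0)"
  proof (rule sum.cong[OF refl])
    fix k assume k: "k \<in> {1..n}"
    have "(i, j - (n - k)) \<in> tri k \<longleftrightarrow> n - j + i \<le> k" using ij k by (auto simp: tri_def)
    moreover have "j - (n - k) = k - (n - j + i) + i" if "n - j + i \<le> k" using that ij k by (auto simp: tri_def)
    ultimately show "embed n k (y k) (i, j) = (if n - j + i \<le> k then y k (i, k - (n - j + i) + i) else 0)"
      by (simp add: embed_def)
  qed
  also have "\<dots> = (\<Sum>k\<in>{k \<in> {1..n}. n - j + i \<le> k}. y k (i, k - (n - j + i) + i))"
    by (rule sum.inter_filter[symmetric]) simp
  also have "{k \<in> {1..n}. n - j + i \<le> k} = {n - j + i..n}" using ij by (auto simp: tri_def)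
  finally show ?thesis .
qed

text \<open>The coordinate \<open>(i, j)\<close> corresponds to the row \<open>n - j + i\<close> of the diagram.\<close>

definition gt_point :: "nat \<Rightarrow> (nat \<times> nat \<Rightarrow> nat) \<Rightarrow> nat \<times> nat \<Rightarrow> int" where
  "gt_point n e = (\<lambda>(i, j). if (i, j) \<in> tri n then int (\<Sum>q=i..n - j + i. e (n - j + i, q)) else 0)"

lemma row_content_tail_sum:
  assumes D: "finite D" "D \<subseteq> {1..n} \<times> UNIV" and T: "T \<in> flagged_fillings n D"
  shows "(\<Sum>q=i..r. row_content D T (r, q)) = card {j. (r, j) \<in> D \<and> i \<le> T (r, j)}"
proof -
  have "(\<Sum>q=i..r. row_content D T (r, q)) = (\<Sum>q=i..r. card {b \<in> {b \<in> D. fst b = r}. T b = q})"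
    unfolding row_content_def by (intro sum.cong arg_cong[of _ _ card]) auto
  also have "\<dots> = card (\<Union>q\<in>{i..r}. {b \<in> {b \<in> D. fst b = r}. T b = q})"
    using D by (intro card_UN_disjoint[symmetric]) auto
  also have "(\<Union>q\<in>{i..r}. {b \<in> {b \<in> D. fst b = r}. T b = q}) = Pair r ` {j. (r, j) \<in> D \<and> i \<le> T (r, j)}"
  proof -
    have "T (r, j) \<le> r" if "(r, j) \<in> D" for j
      using T that by (auto simp: flagged_fillings_def row_flagged_def)
    then show ?thesis by auto
  qed
  also have "card \<dots> = card {j. (r, j) \<in> D \<and> i \<le> T (r, j)}"
    by (simp add: card_image inj_on_def)
  finally show ?thesis .
qed

text \<open>Sorting the columns of the filling by their lowest row \<open>k\<close> yields one
  integral pattern for each \<open>k\<close>.\<close>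

lemma gt_point_in_GT_sum:
  assumes D: "finite D" "column_convex D" "D \<subseteq> {1..n} \<times> UNIV"
    and T: "T \<in> flagged_fillings n D" "column_strict D T"
  shows "(\<lambda>p. real_of_int (gt_point n (row_content D T) p)) \<in> GT_sum n D"
proof -
  define N where "N k r i = card {j. (r, j) \<in> D \<and> lowest_row D j = k \<and> i \<le> T (r, j)}" for k r i
  define y where "y k = (\<lambda>(i, j). if (i, j) \<in> tri k then real (N k (k - j + i) i) else 0)" for k
  have fin: "finite {j. (r, j) \<in> D \<and> lowest_row D j = k \<and> i \<le> T (r, j)}" for k r i
    using finite_columns[OF D(1), of r "\<lambda>j. lowest_row D j = k \<and> i \<le> T (r, j)"] by simp
  have N1: "N k r i \<le> N k r (i - 1)" for k r i
    unfolding N_def using fin by (intro card_mono) auto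
  \<comment> \<open>This interlacing inequality is column strictness: an entry at least
    \<open>i - 1\<close> has an entry at least \<open>i\<close> directly below it.\<close>
  have N2: "N k (r - 1) (i - 1) \<le> N k r i" if r: "2 \<le> i" "1 \<le> r" "r \<le> k" for k r i
    unfolding N_def
  proof (intro card_mono fin subsetI, clarsimp)
    fix j assume j: "(r - Suc 0, j) \<in> D" "k = lowest_row D j" "i - Suc 0 \<le> T (r - Suc 0, j)"
    have rD: "(r, j) \<in> D" using lowest_row_ge_iff[OF D(1,2) j(1), of r] r j(2) by simp
    have "T (r - Suc 0, j) < T (r, j)"
      using T(2) j(1) rD r unfolding column_strict_def by (metis One_nat_def Suc_le_eq diff_less zero_less_one)
    then show "(r, j) \<in> D \<and> i \<le> T (r, j)" using rD j(3) by simp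
  qed
  have "y k \<in> GT k (Par D k)" if k: "k \<in> {1..n}" for k
  proof -
    have y0: "y k p = 0" if "p \<notin> tri k" for p using that by (cases p) (simp add: y_def)
    have y1: "y k p \<ge> 0" for p by (cases p) (simp add: y_def)
    have y2: "y k (1, j) = real (Par D k j)" if j: "1 \<le> j" "j \<le> k" for j
    proof -
      have "1 \<le> T b" if "b \<in> D" for b using T(1) that by (auto simp: flagged_fillings_def fillings_def)
      then have "N k (k - j + 1) 1 = Par D k j"
        unfolding N_def Par_def by (intro arg_cong[of _ _ card]) auto
      then show ?thesis using j by (simp add: y_def tri_def)
    qed
    have y3: "y k (i - 1, j - 1) \<ge> y k (i, j) \<and> y k (i, j) \<ge> y k (i - 1, j)" if ij: "2 \<le> i" "i \<le> j" "j \<le> k" for i j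
    proof -
      have a: "y k (i - 1, j - 1) = real (N k (k - j + i) (i - 1))"
        "y k (i, j) = real (N k (k - j + i) i)" "y k (i - 1, j) = real (N k (k - j + i - 1) (i - 1))"
        using ij by (auto simp: y_def tri_def)
      show ?thesis unfolding a using N1[of k "k - j + i" i] N2[of i "k - j + i" k] ij by simp
    qed
    show ?thesis unfolding GT_def using y0 y1 y2 y3 by blast
  qed
  moreover have "real_of_int (gt_point n (row_content D T) p) = (\<Sum>k=1..n. embed n k (y k) p)" for p
  proof (cases "p \<in> tri n")
    case False
    then show ?thesis using embed_outside[OF _ False] by (cases p) (simp add: gt_point_def)
  next
    case True
    obtain i j where p: "p = (i, j)" by fastforce
    define r where "r = n - j + i"
    have ij: "1 \<le> i" "i \<le> j" "j \<le> n" using True p by (auto simp: tri_def)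
    have "(\<Sum>k=1..n. embed n k (y k) p) = (\<Sum>k=r..n. y k (i, k - r + i))"
      using sum_embed[of i j n y] True by (simp add: p r_def)
    also have "\<dots> = (\<Sum>k=r..n. real (N k r i))"
    proof (rule sum.cong[OF refl])
      fix k assume k: "k \<in> {r..n}"
      then have "(i, k - r + i) \<in> tri k" using ij by (auto simp: tri_def r_def)
      moreover have "k - (k - r + i) + i = r" using k ij by (auto simp: r_def)
      ultimately show "y k (i, k - r + i) = real (N k r i)" by (simp add: y_def)
    qed
    also have "\<dots> = real (\<Sum>k=r..n. N k r i)" by simp
    also have "(\<Sum>k=r..n. N k r i) = card {j. (r, j) \<in> D \<and> i \<le> T (r, j)}"
      using card_by_lowest_row[OF D order_refl, of r "\<lambda>j. i \<le> T (r, j)"] by (simp add: N_def)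
    also have "\<dots> = (\<Sum>q=i..r. row_content D T (r, q))"
      using row_content_tail_sum[OF D(1,3) T(1)] by simp
    finally show ?thesis using True by (simp add: gt_point_def p r_def)
  qed
  ultimately show ?thesis unfolding GT_sum_iff by blast
qed

section \<open>From integer points back to exponents\<close>

lemma GT_sum_point_valid:
  assumes D: "finite D" "column_convex D" "D \<subseteq> {1..n} \<times> UNIV"
    and c: "(\<lambda>p. real_of_int (c p)) \<in> GT_sum n D"
  obtains e where "valid_exp n (common_columns D) e" "gt_point n e = c"
proof -
  obtain y where y: "\<And>k. k \<in> {1..n} \<Longrightarrow> y k \<in> GT k (Par D k)"
    and cy: "\<And>p. real_of_int (c p) = (\<Sum>k=1..n. embed n k (y k) p)"
    using c unfolding GT_sum_iff by blast
  have c0: "c p = 0" if "p \<notin> tri n" for p using cy[of p] embed_outside[OF _ that] by simp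
  \<comment> \<open>\<open>G k q r\<close> imitates the number of columns with lowest row
    \<open>k\<close> whose entry in row \<open>r\<close> is at least \<open>q\<close>. It need not
    be an integer; only sums over \<open>k\<close> are.\<close>
  define G where "G k q r = y k (q, k - r + q)" for k q r
  have y_out: "y k p = 0" if "k \<in> {1..n}" "p \<notin> tri k" for k p
    using y[OF that(1)] that(2) unfolding GT_def by blast
  have y_nonneg: "0 \<le> y k p" if "k \<in> {1..n}" "p \<in> tri k" for k p
    using y[OF that(1)] that(2) unfolding GT_def by blast
  have y_top: "y k (1, j) = real (Par D k j)" if "k \<in> {1..n}" "1 \<le> j" "j \<le> k" for k j
    using y[OF that(1)] that(2,3) unfolding GT_def by blast
  have y_mid: "y k (i, j) \<le> y k (i - 1, j - 1) \<and> y k (i - 1, j) \<le> y k (i, j)"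
    if "k \<in> {1..n}" "2 \<le> i" "i \<le> j" "j \<le> k" for k i j
    using y[OF that(1)] that(2-) unfolding GT_def by blast
  have Gnn: "0 \<le> G k q r" if "k \<in> {1..n}" for k q r
    unfolding G_def using y_out[OF that] y_nonneg[OF that] by (metis order_refl)
  have G1: "G k (Suc q) r \<le> G k q r" if "1 \<le> q" "q \<le> r" "k \<in> {r..n}" for k q r
  proof (cases "q = r")
    case True
    then have "(Suc q, k - r + Suc q) \<notin> tri k" using that by (auto simp: tri_def)
    then have "G k (Suc q) r = 0" unfolding G_def using that by (intro y_out) auto
    then show ?thesis using Gnn[of k q r] that by simp
  next
    case False
    then have "k - r + Suc q \<le> k" using that by auto
    then show ?thesis using y_mid[of k "Suc q" "k - r + Suc q"] that unfolding G_def by simp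
  qed
  have G2: "G k q (r - 1) \<le> G k (Suc q) r" if "1 \<le> q" "q < r" "k \<in> {r..n}" for k q r
  proof -
    have "k - (r - 1) + q = k - r + Suc q" using that by auto
    then show ?thesis using y_mid[of k "Suc q" "k - r + Suc q"] that unfolding G_def by simp
  qed
  have G3: "G k 1 r = real (Par D k (k - r + 1))" if "1 \<le> r" "k \<in> {r..n}" for k r
    unfolding G_def using that by (intro y_top) auto
  have cG: "real_of_int (c (q, n - r + q)) = (\<Sum>k=r..n. G k q r)" if "1 \<le> q" "q \<le> Suc r" "1 \<le> r" "r \<le> n" for q r
  proof (cases "q \<le> r")
    case True
    then have t: "(q, n - r + q) \<in> tri n" "n - (n - r + q) + q = r" using that by (auto simp: tri_def)
    show ?thesis using cy sum_embed[OF t(1), of y] unfolding t(2) by (simp add: G_def)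
  next
    case False
    then have q: "q = Suc r" using that by simp
    have "(q, k - r + q) \<notin> tri k" if "k \<in> {r..n}" for k using that q by (auto simp: tri_def)
    then have "G k q r = 0" if "k \<in> {r..n}" for k
      unfolding G_def using that \<open>1 \<le> r\<close> by (intro y_out) auto
    moreover have "c (q, n - r + q) = 0" using that q by (intro c0) (auto simp: tri_def)
    ultimately show ?thesis by simp
  qed
  \<comment> \<open>The number of entries equal to \<open>q\<close> is the difference of the counts
    for thresholds \<open>q\<close> and \<open>Suc q\<close>; the value at \<open>q = Suc r\<close>
    lies outside the triangle and is 0.\<close>
  define e where "e x = (if x \<in> stage_vars n 1 n then nat (c (snd x, n - fst x + snd x) - c (Suc (snd x), n - fst x + Suc (snd x))) else 0)" for x
  have eG: "real (e (r, q)) = (\<Sum>k=r..n. G k q r - G k (Suc q) r)"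
    and ec: "int (e (r, q)) = c (q, n - r + q) - c (Suc q, n - r + Suc q)" if qr: "1 \<le> q" "q \<le> r" "r \<le> n" for q r
  proof -
    have d: "real_of_int (c (q, n - r + q) - c (Suc q, n - r + Suc q)) = (\<Sum>k=r..n. G k q r - G k (Suc q) r)"
      using cG[of q r] cG[of "Suc q" r] qr by (simp add: sum_subtractf)
    also have "\<dots> \<ge> 0" using G1 qr by (intro sum_nonneg) auto
    finally have nn: "c (q, n - r + q) - c (Suc q, n - r + Suc q) \<ge> 0" by linarith
    have "(r, q) \<in> stage_vars n 1 n" using qr by (auto simp: stage_vars_def)
    then show ec: "int (e (r, q)) = c (q, n - r + q) - c (Suc q, n - r + Suc q)" using nn by (simp add: e_def)
    show "real (e (r, q)) = (\<Sum>k=r..n. G k q r - G k (Suc q) r)"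
      unfolding d[symmetric] ec[symmetric] by simp
  qed
  have tail: "int (\<Sum>q=p..r. e (r, q)) = c (p, n - r + p)" if "1 \<le> p" "p \<le> Suc r" "1 \<le> r" "r \<le> n" for p r
    using that(2,1)
  proof (induction p rule: inc_induct)
    case base
    have "c (Suc r, n - r + Suc r) = 0" by (rule c0) (use that in \<open>auto simp: tri_def\<close>)
    then show ?case by simp
  next
    case (step p)
    have "(\<Sum>q=p..r. e (r, q)) = e (r, p) + (\<Sum>q=Suc p..r. e (r, q))"
      using step.hyps by (simp add: sum.atLeast_Suc_atMost)
    then show ?case using step ec[of p r] that by simp
  qed
  have tailG: "real (\<Sum>q=p..r. e (r, q)) = (\<Sum>k=r..n. G k p r)" if "1 \<le> p" "p \<le> Suc r" "1 \<le> r" "r \<le> n" for p r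
    unfolding cG[OF that, symmetric] tail[OF that, symmetric] by simp
  have Par1: "real (common_columns D r s) = (\<Sum>k=r..n. G k 1 s)" if "1 \<le> s" "s \<le> r" for r s
  proof -
    have "(\<Sum>k=r..n. G k 1 s) = (\<Sum>k=r..n. real (Par D k (k - s + 1)))"
      using that by (intro sum.cong G3) auto
    then show ?thesis using common_columns_Par[OF D that] by simp
  qed
  \<comment> \<open>The induction follows the recursion of \<open>rank_bound\<close>: monotonicity
    in the threshold handles the subtracted term, where dropping the summands \<open>k < r\<close>
    is allowed since they are nonnegative, and interlacing handles the term with
    \<open>s - 1\<close>.\<close>
  have bound: "real (rank_bound (common_columns D) e m r s) \<le> (\<Sum>k=r..n. G k (Suc m) s)"
    if "Suc m \<le> s" "s \<le> r" "r \<le> n" for m r s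
    using that
  proof (induction m arbitrary: s)
    case 0
    then show ?case using Par1[of s r] by simp
  next
    case (Suc m)
    let ?B = "rank_bound (common_columns D) e m r"
    have nn: "0 \<le> (\<Sum>k=r..n. G k (Suc (Suc m)) s)" using Suc.prems by (intro sum_nonneg Gnn) auto
    have "real (?B s) - real (e (s, Suc m)) \<le> (\<Sum>k=r..n. G k (Suc m) s) - (\<Sum>k=s..n. G k (Suc m) s - G k (Suc (Suc m)) s)"
      using Suc.IH[of s] Suc.prems eG[of "Suc m" s] by simp
    also have "(\<Sum>k=r..n. G k (Suc m) s - G k (Suc (Suc m)) s) \<le> (\<Sum>k=s..n. G k (Suc m) s - G k (Suc (Suc m)) s)"
      using Suc.prems G1[of "Suc m" s] by (intro sum_mono2) auto
    then have "(\<Sum>k=r..n. G k (Suc m) s) - (\<Sum>k=s..n. G k (Suc m) s - G k (Suc (Suc m)) s) \<le> (\<Sum>k=r..n. G k (Suc (Suc m)) s)"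
      by (simp add: sum_subtractf)
    finally have 1: "real (?B s - e (s, Suc m)) \<le> (\<Sum>k=r..n. G k (Suc (Suc m)) s)" using nn by linarith
    have "real (?B (s - 1)) \<le> (\<Sum>k=r..n. G k (Suc m) (s - 1))" using Suc.IH[of "s - 1"] Suc.prems by simp
    also have "\<dots> \<le> (\<Sum>k=r..n. G k (Suc (Suc m)) s)"
      using Suc.prems by (intro sum_mono G2) auto
    finally show ?case using 1 by (simp only: rank_bound.simps of_nat_max max.bounded_iff simp_thms)
  qed
  have "valid_exp n (common_columns D) e"
    unfolding valid_exp_def
  proof (intro conjI allI ballI impI)
    show "e x = 0" if "x \<notin> stage_vars n 1 n" for x using that by (simp add: e_def)
    show "(\<Sum>q=1..r. e (r, q)) = common_columns D r r" if "r \<in> {1..n}" for r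
    proof -
      have "real (\<Sum>q=1..r. e (r, q)) = real (common_columns D r r)"
        using tailG[of 1 r] Par1[of r r] that by simp
      then show ?thesis by (simp only: of_nat_eq_iff)
    qed
    show "rank_bound (common_columns D) e m r (r - 1) \<le> (\<Sum>q=Suc (Suc m)..r. e (r, q))" if "Suc m < r \<and> r \<le> n" for m r
    proof -
      have "real (rank_bound (common_columns D) e m r (r - 1)) \<le> (\<Sum>k=r..n. G k (Suc m) (r - 1))"
        using that by (intro bound) auto
      also have "\<dots> \<le> (\<Sum>k=r..n. G k (Suc (Suc m)) r)" using that by (intro sum_mono G2) auto
      also have "\<dots> = real (\<Sum>q=Suc (Suc m)..r. e (r, q))" using that by (intro tailG[symmetric]) auto
      finally show ?thesis by (simp only: of_nat_le_iff)
    qed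
  qed
  moreover have "gt_point n e = c"
  proof
    fix p
    show "gt_point n e p = c p"
    proof (cases "p \<in> tri n")
      case False
      then show ?thesis using c0 by (cases p) (simp add: gt_point_def)
    next
      case True
      obtain i j where p: "p = (i, j)" by fastforce
      have ij: "1 \<le> i" "i \<le> j" "j \<le> n" using True p by (auto simp: tri_def)
      have "n - (n - j + i) + i = j" using ij by auto
      then show ?thesis using tail[of i "n - j + i"] ij True by (simp add: gt_point_def p)
    qed
  qed
  ultimately show ?thesis using that by blast
qed

lemma gt_point_inj:
  assumes supp: "\<And>x. x \<notin> stage_vars n 1 n \<Longrightarrow> e x = 0" "\<And>x. x \<notin> stage_vars n 1 n \<Longrightarrow> e' x = 0"
    and eq: "gt_point n e = gt_point n e'"
  shows "e = e'"
proof
  have tail: "(\<Sum>q=p..r. e (r, q)) = (\<Sum>q=p..r. e' (r, q))" if "1 \<le> p" "r \<le> n" for p r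
  proof (cases "p \<le> r")
    case True
    then have t: "(p, n - r + p) \<in> tri n" "n - (n - r + p) + p = r" using that by (auto simp: tri_def)
    show ?thesis using fun_cong[OF eq, of "(p, n - r + p)"] t(1) unfolding gt_point_def by (simp add: t(2) del: of_nat_sum)
  qed simp
  fix x :: "nat \<times> nat"
  show "e x = e' x"
  proof (cases "x \<in> stage_vars n 1 n")
    case True
    then obtain r q where x: "x = (r, q)" "1 \<le> q" "q \<le> r" "r \<le> n" by (auto simp: stage_vars_def)
    show ?thesis using tail[of q r] tail[of "Suc q" r] x by (simp add: sum.atLeast_Suc_atMost)
  qed (simp add: supp)
qed

text \<open>Summation by parts: an entry \<open>q\<close> is counted in the coordinates with first
  index \<open>1, ..., q\<close> of its row, and the product of the specialised variables over these
  indices telescopes to \<open>x q\<close>.\<close>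

lemma gt_point_weight:
  fixes x :: "nat \<Rightarrow> complex"
  assumes x: "\<forall>i\<in>{1..n}. x i \<noteq> 0"
  shows "(\<Prod>p\<in>tri n. (case p of (i, j) \<Rightarrow> if i = 1 then x 1 else inverse (x (i - 1)) * x i) powi gt_point n e p) =
    (\<Prod>p\<in>stage_vars n 1 n. x (snd p) ^ e p)"
proof -
  define \<zeta> where "\<zeta> i = (if i = 1 then x 1 else inverse (x (i - 1)) * x i)" for i
  have tel: "(\<Prod>i=1..q. \<zeta> i) = x q" if "1 \<le> q" "q \<le> n" for q
    using that
  proof (induction q rule: nat_induct_at_least)
    case base
    then show ?case by (simp add: \<zeta>_def)
  next
    case (Suc q)
    then have "x q \<noteq> 0" using x by auto
    moreover have "(\<Prod>i=1..q. \<zeta> i) = x q" using Suc by simp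
    ultimately show ?case using Suc.hyps by (simp add: \<zeta>_def)
  qed
  have V: "stage_vars n 1 n = Sigma {1..n} (\<lambda>r. {1..r})" by (auto simp: stage_vars_def)
  have "(\<Prod>p\<in>tri n. (case p of (i, j) \<Rightarrow> if i = 1 then x 1 else inverse (x (i - 1)) * x i) powi gt_point n e p) =
    (\<Prod>(r, i)\<in>stage_vars n 1 n. \<zeta> i ^ (\<Sum>q=i..r. e (r, q)))"
  proof (rule prod.reindex_bij_witness[of _ "\<lambda>(r, i). (i, n - r + i)" "\<lambda>(i, j). (n - j + i, i)"])
    fix p assume p: "p \<in> tri n"
    obtain i j where ij: "p = (i, j)" by fastforce
    show "(case case p of (i, j) \<Rightarrow> (n - j + i, i) of (r, i) \<Rightarrow> (i, n - r + i)) = p"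
      using p by (auto simp: ij tri_def)
    show "(case p of (i, j) \<Rightarrow> (n - j + i, i)) \<in> stage_vars n 1 n"
      using p by (auto simp: ij tri_def stage_vars_def)
    show "(case case p of (i, j) \<Rightarrow> (n - j + i, i) of (r, i) \<Rightarrow> \<zeta> i ^ (\<Sum>q=i..r. e (r, q))) =
      (case p of (i, j) \<Rightarrow> if i = 1 then x 1 else inverse (x (i - 1)) * x i) powi gt_point n e p"
      using p by (simp only: ij gt_point_def prod.case if_True \<zeta>_def power_int_of_nat)
  next
    fix p assume p: "p \<in> stage_vars n 1 n"
    obtain r i where ri: "p = (r, i)" by fastforce
    show "(case case p of (r, i) \<Rightarrow> (i, n - r + i) of (i, j) \<Rightarrow> (n - j + i, i)) = p"
      using p by (auto simp: ri stage_vars_def)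
    show "(case p of (r, i) \<Rightarrow> (i, n - r + i)) \<in> tri n"
      using p by (auto simp: ri tri_def stage_vars_def)
  qed
  also have "\<dots> = (\<Prod>r=1..n. \<Prod>i=1..r. \<zeta> i ^ (\<Sum>q=i..r. e (r, q)))"
    unfolding V by (rule prod.Sigma[symmetric]) auto
  also have "\<dots> = (\<Prod>r=1..n. \<Prod>q=1..r. x q ^ e (r, q))"
  proof (rule prod.cong[OF refl])
    fix r assume r: "r \<in> {1..n}"
    have "(\<Prod>i=1..r. \<zeta> i ^ (\<Sum>q=i..r. e (r, q))) = (\<Prod>i=1..r. \<Prod>q\<in>{q \<in> {1..r}. i \<le> q}. \<zeta> i ^ e (r, q))"
    proof (rule prod.cong[OF refl])
      fix i assume "i \<in> {1..r}"
      then have "{q \<in> {1..r}. i \<le> q} = {i..r}" by auto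
      then show "\<zeta> i ^ (\<Sum>q=i..r. e (r, q)) = (\<Prod>q\<in>{q \<in> {1..r}. i \<le> q}. \<zeta> i ^ e (r, q))"
        by (simp only: power_sum)
    qed
    also have "\<dots> = (\<Prod>q=1..r. \<Prod>i\<in>{i \<in> {1..r}. i \<le> q}. \<zeta> i ^ e (r, q))"
      by (rule prod.swap_restrict) auto
    also have "\<dots> = (\<Prod>q=1..r. x q ^ e (r, q))"
    proof (rule prod.cong[OF refl])
      fix q assume q: "q \<in> {1..r}"
      then have "{i \<in> {1..r}. i \<le> q} = {1..q}" by auto
      then have "(\<Prod>i\<in>{i \<in> {1..r}. i \<le> q}. \<zeta> i ^ e (r, q)) = (\<Prod>i=1..q. \<zeta> i) ^ e (r, q)"
        by (simp only: prod_power_distrib)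
      then show "(\<Prod>i\<in>{i \<in> {1..r}. i \<le> q}. \<zeta> i ^ e (r, q)) = x q ^ e (r, q)"
        using tel q r by simp
    qed
    finally show "(\<Prod>i=1..r. \<zeta> i ^ (\<Sum>q=i..r. e (r, q))) = (\<Prod>q=1..r. x q ^ e (r, q))" .
  qed
  also have "\<dots> = (\<Prod>p\<in>stage_vars n 1 n. x (snd p) ^ e p)"
    unfolding V by (subst prod.Sigma) (auto intro: prod.cong)
  finally show ?thesis .
qed

theorem theorem1p1:
  fixes n :: nat and D :: "(nat \<times> nat) set" and x :: "nat \<Rightarrow> complex"
  assumes "diagram D"
    and "column_convex D"
    and "\<forall>(i, j)\<in>D. i \<in> {1..n}"
    and "\<forall>i\<in>{1..n}. x i \<noteq> 0"
  shows "flagged_character n D x =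
    integer_point_transform n (GT_sum n D)
      (\<lambda>(i, j). if i = 1 then x 1 else inverse (x (i - 1)) * x i)"
proof -
  have D: "finite D" "column_convex D" "D \<subseteq> {1..n} \<times> UNIV"
    using assms(1-3) by (auto simp: diagram_def)
  let ?I = "{e. valid_exp n (common_columns D) e}"
  have fill: "\<exists>T\<in>flagged_fillings n D. row_content D T = e \<and> column_strict D T"
    if "valid_exp n (common_columns D) e" for e
    by (rule column_strict_filling[OF D that])
  have bij: "bij_betw (gt_point n) ?I {c. (\<lambda>p. real_of_int (c p)) \<in> GT_sum n D}"
    unfolding bij_betw_def
  proof
    show "inj_on (gt_point n) ?I"
    proof (rule inj_onI)
      fix e e' assume "e \<in> ?I" "e' \<in> ?I" "gt_point n e = gt_point n e'"
      then show "e = e'" by (intro gt_point_inj) (auto simp: valid_exp_def)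
    qed
    show "gt_point n ` ?I = {c. (\<lambda>p. real_of_int (c p)) \<in> GT_sum n D}"
    proof (intro equalityI subsetI)
      fix c assume "c \<in> gt_point n ` ?I"
      then obtain e where e: "valid_exp n (common_columns D) e" "c = gt_point n e" by blast
      obtain T where "T \<in> flagged_fillings n D" "row_content D T = e" "column_strict D T" using fill[OF e(1)] by blast
      then show "c \<in> {c. (\<lambda>p. real_of_int (c p)) \<in> GT_sum n D}"
        using gt_point_in_GT_sum[OF D, of T] e(2) by simp
    next
      fix c assume "c \<in> {c. (\<lambda>p. real_of_int (c p)) \<in> GT_sum n D}"
      then obtain e where "valid_exp n (common_columns D) e" "gt_point n e = c"
        using GT_sum_point_valid[OF D, of c] by blast
      then show "c \<in> gt_point n ` ?I" by blast
    qed
  qed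
  have "flagged_character n D x = (\<Sum>e\<in>?I. \<Prod>p\<in>stage_vars n 1 n. x (snd p) ^ e p)"
    using flagged_character_valid(2)[OF D fill] .
  also have "\<dots> = (\<Sum>e\<in>?I. \<Prod>p\<in>tri n.
      (case p of (i, j) \<Rightarrow> if i = 1 then x 1 else inverse (x (i - 1)) * x i) powi gt_point n e p)"
    by (simp only: gt_point_weight[OF assms(4)])
  also have "\<dots> = integer_point_transform n (GT_sum n D)
      (\<lambda>(i, j). if i = 1 then x 1 else inverse (x (i - 1)) * x i)"
    unfolding integer_point_transform_def
    by (rule sum.reindex_bij_betw[OF bij, of "\<lambda>c. \<Prod>p\<in>tri n.
      (case p of (i, j) \<Rightarrow> if i = 1 then x 1 else inverse (x (i - 1)) * x i) powi c p"])
  finally show ?thesis .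
qed

end
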